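(* Let $q\in[1,\infty]$ with dual exponent $q'$, and let $u \in BV^{(p_i)}(\Omega) \cap L^{\max(p_k,q)}(\Omega)$ and $\mathbf{z}=(\mathbf{z}_1,\dots,\mathbf{z}_k) \in X^{(p'_i)}_{q'}(\Omega)$. If $T: \mathbb{R} \rightarrow \mathbb{R}$ is a Lipschitz continuous increasing function, then $$\theta(\mathbf{z}_1, D_{x_1} (T \circ u),x) = \theta(\mathbf{z}_1, D_{x_1} u,x) \qquad |D_{x_1} u|\text{-a.e. in } \Omega.$$
   Context: Setting. $\Omega_1\subset\mathbb{R}^{n_1}$ and $\Omega_2\subset\mathbb{R}^{n_2+\dots+n_k}$ ($k\ge 2$) are bounded open sets, $N=n_1+\dots+n_k$, and $\Omega=\Omega_1\times\Omega_2\subset\mathbb{R}^N$ is assumed to have Lipschitz boundary. Points are written $x=(x_1,\dots,x_k)$ with $x_i\in\mathbb{R}^{n_i}$; $\nabla_{x_i}$ (or $D_{x_i}$ for measures) is the distributional gradient in the variables $x_i$; $\mathrm{div}$ is the full (distributional) divergence in $\mathbb{R}^N$. Exponents: $p_1=1<p_2\le\dots\le p_k<\infty$, and $p_i'$ is the dual exponent (so $p_1'=\infty$). Spaces. $BV^{(p_i)}(\Omega)=\{u\in BV(\Omega): \nabla_{x_i}u\in L^{p_i}(\Omega;\mathbb{R}^{n_i}),\ i=2,\dots,k\}$ (so $D_{x_1}u$ is a finite Radon measure). For $r\in[1,\infty]$, $X_r^{(p_i')}(\Omega)=\{\mathbf{z}=(\mathbf{z}_1,\dots,\mathbf{z}_k)\in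 L^{p_1'}(\Omega;\mathbb{R}^{n_1})\times\dots\times L^{p_k'}(\Omega;\mathbb{R}^{n_k}):\mathrm{div}(\mathbf{z})\in L^r(\Omega)\}$. Pairing and density. For $u\in BV^{(p_i)}(\Omega)\cap L^{\max(p_k,q)}(\Omega)$ and $\mathbf{z}\in X_{q'}^{(p_i')}(\Omega)$, $(\mathbf{z}_1,D_{x_1}u)$ is the Radon measure on $\Omega$ acting on $\varphi\in C_c^\infty(\Omega)$ by $$\langle(\mathbf{z}_1,D_{x_1}u),\varphi\rangle=-\int_\Omega u\,\varphi\,\mathrm{div}(\mathbf{z})\,dx-\sum_{i=1}^k\int_\Omega u\,\mathbf{z}_i\cdot\nabla_{x_i}\varphi\,dx-\sum_{i=2}^k\int_\Omega\varphi\,\mathbf{z}_i\cdot\nabla_{x_i}u\,dx .$$ It is absolutely continuous with respect to $|D_{x_1}u|$, and $\theta(\mathbf{z}_1,D_{x_1}u,\cdot)$ denotes its Radon-Nikodym density: $\int_B(\mathbf{z}_1,D_{x_1}u)=\int_B\theta(\mathbf{z}_1,D_{x_1}u,x)\,d|D_{x_1}u|$ for all Borel $B\subset\Omega$. Likewise $\theta(\mathbf{z}_1,D_{x_1}(T\circ u),\cdot)$ is the density of $(\mathbf{z}_1,D_{x_1}(T\circ u))$ with respect to $|D_{x_1}(T\circ u)|$. "Increasing" means strictly increasing (as opposed to nondecreasing).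
   Formalization: The density for T∘u is determined only |D_{x_1}(T∘u)|-a.e., which may be coarser than |D_{x_1}u|-a.e. if T' vanishes on a positive-measure set; the equality is thus stated for every version of θ(z_1,D_{x_1}u,·) and a suitable version of θ(z_1,D_{x_1}(T∘u),·). *)

theory Defs
  imports "HOL-Analysis.Analysis"
begin

section \<open>Exponents, Lebesgue spaces, test functions\<close>

(* 1/p + 1/p' = 1 in [1,\<infinity>]; with inverse 0 = \<infinity> and inverse \<infinity> = 0 this covers p = 1 and p = \<infinity>. *)
definition conj_exp :: "ennreal \<Rightarrow> ennreal" where
  "conj_exp p = inverse (1 - inverse p)"

(* Functions are total; only the values on \<Omega> matter, and elements of L^r are represented by
   arbitrary Lebesgue measurable representatives. *)
definition Lspace :: "ennreal \<Rightarrow> 'a::euclidean_space set \<Rightarrow> ('a \<Rightarrow> 'b::euclidean_space) set" where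
  "Lspace r \<Omega> = {f \<in> borel_measurable (lebesgue_on \<Omega>).
     if r = \<infinity> then (\<exists>C. AE x in lebesgue_on \<Omega>. norm (f x) \<le> C)
     else integrable (lebesgue_on \<Omega>) (\<lambda>x. norm (f x) powr enn2real r)}"

definition locally_integrable :: "'a::euclidean_space set \<Rightarrow> ('a \<Rightarrow> 'b::euclidean_space) \<Rightarrow> bool" where
  "locally_integrable \<Omega> f \<longleftrightarrow> (\<forall>K. compact K \<and> K \<subseteq> \<Omega> \<longrightarrow> f absolutely_integrable_on K)"

definition dir_deriv :: "'a::euclidean_space \<Rightarrow> ('a \<Rightarrow> real) \<Rightarrow> 'a \<Rightarrow> real" where
  "dir_deriv v f x = frechet_derivative f (at x) v"

definition grad :: "('a::euclidean_space \<Rightarrow> real) \<Rightarrow> 'a \<Rightarrow> 'a" where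
  "grad f x = (\<Sum>b\<in>Basis. dir_deriv b f x *\<^sub>R b)"

primrec C_k :: "nat \<Rightarrow> ('a::euclidean_space \<Rightarrow> real) \<Rightarrow> bool" where
  "C_k 0 f \<longleftrightarrow> continuous_on UNIV f"
| "C_k (Suc m) f \<longleftrightarrow> (\<forall>x. f differentiable (at x)) \<and> (\<forall>b\<in>Basis. C_k m (dir_deriv b f))"

(* C_c^\<infinity>(\<Omega>), its elements being extended by zero to the whole space *)
definition test_functions :: "'a::euclidean_space set \<Rightarrow> ('a \<Rightarrow> real) set" where
  "test_functions \<Omega> = {\<phi>. (\<forall>m. C_k m \<phi>) \<and> (\<exists>K. compact K \<and> K \<subseteq> \<Omega> \<and> (\<forall>x. x \<notin> K \<longrightarrow> \<phi> x = 0))}"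

section \<open>Lipschitz boundary\<close>

(* Near every boundary point \<Omega> is, in suitable orthogonal coordinates, the set lying strictly on
   one side of the graph of a Lipschitz function \<gamma> on a hyperplane; e is the vertical direction. *)
definition lipschitz_boundary :: "'a::euclidean_space set \<Rightarrow> bool" where
  "lipschitz_boundary \<Omega> \<longleftrightarrow> (\<forall>x\<in>frontier \<Omega>. \<exists>U e \<gamma> L.
     open U \<and> x \<in> U \<and> norm e = 1 \<and> L-lipschitz_on {v. v \<bullet> e = 0} \<gamma> \<and>
     \<Omega> \<inter> U = {y \<in> U. y \<bullet> e < \<gamma> (y - (y \<bullet> e) *\<^sub>R e)})"

section \<open>Signed and vector measures\<close>

(* The functional L on C_c^\<infinity>(\<Omega>) is integration against the finite signed Radon measure \<nu> on \<Omega>.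
   A finite signed measure is a difference P - M of finite (positive) measures, and its integral
   does not depend on the decomposition; finite Borel measures on an open \<Omega> are Radon.
   \<nu> is a set function of which only the values on Borel subsets of \<Omega> are relevant. *)
definition represents :: "'a::euclidean_space set \<Rightarrow> ('a set \<Rightarrow> real) \<Rightarrow> (('a \<Rightarrow> real) \<Rightarrow> real) \<Rightarrow> bool" where
  "represents \<Omega> \<nu> L \<longleftrightarrow> (\<exists>P M.
     finite_measure P \<and> sets P = sets (restrict_space borel \<Omega>) \<and>
     finite_measure M \<and> sets M = sets (restrict_space borel \<Omega>) \<and>
     (\<forall>B\<in>sets (restrict_space borel \<Omega>). \<nu> B = measure P B - measure M B) \<and>
     (\<forall>\<phi>\<in>test_functions \<Omega>. L \<phi> = (LINT x|P. \<phi> x) - (LINT x|M. \<phi> x)))"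

definition total_variation ::
  "'a::euclidean_space set \<Rightarrow> ('a set \<Rightarrow> 'b::euclidean_space) \<Rightarrow> 'a measure" where
  "total_variation \<Omega> D = measure_of \<Omega> (sets (restrict_space borel \<Omega>))
     (\<lambda>B. SUP A\<in>{A :: nat \<Rightarrow> 'a set. range A \<subseteq> sets (restrict_space borel \<Omega>) \<and>
                    disjoint_family A \<and> (\<Union>i. A i) = B}.
            \<Sum>i. ennreal (norm (D (A i))))"

(* D is the vector measure whose component along v is the distributional derivative of u in
   direction E v. The map E selects the variables in which one differentiates. *)
definition is_deriv_measure ::
  "'a::euclidean_space set \<Rightarrow> ('b::euclidean_space \<Rightarrow> 'a) \<Rightarrow> ('a \<Rightarrow> real) \<Rightarrow> ('a set \<Rightarrow> 'b) \<Rightarrow> bool" where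
  "is_deriv_measure \<Omega> E u D \<longleftrightarrow> (\<forall>v.
     represents \<Omega> (\<lambda>B. D B \<bullet> v) (\<lambda>\<phi>. - (LINT x|lebesgue_on \<Omega>. u x * dir_deriv (E v) \<phi> x)))"

definition BV :: "'a::euclidean_space set \<Rightarrow> ('a \<Rightarrow> real) set" where
  "BV \<Omega> = {u \<in> Lspace 1 \<Omega>. \<exists>D. is_deriv_measure \<Omega> (\<lambda>v. v) u D}"

section \<open>Block structure\<close>

(* The ambient space is the product of the space of the first block x_1 (index type 'n) and the
   space of (x_2,...,x_k) (index type 'm); blk assigns to each index in 'm the block 2,...,k it
   belongs to, so n_i is the number of indices j with blk j = i.
   block blk i v is v_i, regarded as an element of the ambient space. *)
type_synonym ('n, 'm) space = "(real^'n) \<times> (real^'m)"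

definition block :: "('m \<Rightarrow> nat) \<Rightarrow> nat \<Rightarrow> ('n::finite, 'm::finite) space \<Rightarrow> ('n, 'm) space" where
  "block blk i v = (if i = 1 then (fst v, 0)
                    else (0, \<chi> j. if blk j = i then snd v $ j else 0))"

(* g represents the distributional gradient of u in the variables x_i. Since v ranges over the
   whole space, this also forces g to take values in the i-th block almost everywhere. *)
definition is_weak_grad ::
  "('m \<Rightarrow> nat) \<Rightarrow> nat \<Rightarrow> ('n::finite, 'm::finite) space set \<Rightarrow> (('n, 'm) space \<Rightarrow> real) \<Rightarrow>
   (('n, 'm) space \<Rightarrow> ('n, 'm) space) \<Rightarrow> bool" where
  "is_weak_grad blk i \<Omega> u g \<longleftrightarrow> locally_integrable \<Omega> g \<and>
     (\<forall>\<phi>\<in>test_functions \<Omega>. \<forall>v. (LINT x|lebesgue_on \<Omega>. u x * dir_deriv (block blk i v) \<phi> x) =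
        - (LINT x|lebesgue_on \<Omega>. (g x \<bullet> v) * \<phi> x))"

definition weak_grad ::
  "('m \<Rightarrow> nat) \<Rightarrow> nat \<Rightarrow> ('n::finite, 'm::finite) space set \<Rightarrow> (('n, 'm) space \<Rightarrow> real) \<Rightarrow>
   ('n, 'm) space \<Rightarrow> ('n, 'm) space" where
  "weak_grad blk i \<Omega> u = (SOME g. is_weak_grad blk i \<Omega> u g)"

definition is_weak_div ::
  "'a::euclidean_space set \<Rightarrow> ('a \<Rightarrow> 'a) \<Rightarrow> ('a \<Rightarrow> real) \<Rightarrow> bool" where
  "is_weak_div \<Omega> z d \<longleftrightarrow> locally_integrable \<Omega> d \<and>
     (\<forall>\<phi>\<in>test_functions \<Omega>. (LINT x|lebesgue_on \<Omega>. z x \<bullet> grad \<phi> x) =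
        - (LINT x|lebesgue_on \<Omega>. d x * \<phi> x))"

definition weak_div :: "'a::euclidean_space set \<Rightarrow> ('a \<Rightarrow> 'a) \<Rightarrow> 'a \<Rightarrow> real" where
  "weak_div \<Omega> z = (SOME d. is_weak_div \<Omega> z d)"

definition BV_aniso ::
  "('m \<Rightarrow> nat) \<Rightarrow> nat \<Rightarrow> (nat \<Rightarrow> real) \<Rightarrow> ('n::finite, 'm::finite) space set \<Rightarrow>
   (('n, 'm) space \<Rightarrow> real) set" where
  "BV_aniso blk k p \<Omega> = {u \<in> BV \<Omega>.
     \<forall>i\<in>{2..k}. \<exists>g\<in>Lspace (ennreal (p i)) \<Omega>. is_weak_grad blk i \<Omega> u g}"

definition X_space ::
  "('m \<Rightarrow> nat) \<Rightarrow> nat \<Rightarrow> (nat \<Rightarrow> real) \<Rightarrow> ennreal \<Rightarrow> ('n::finite, 'm::finite) space set \<Rightarrow>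
   (('n, 'm) space \<Rightarrow> ('n, 'm) space) set" where
  "X_space blk k p r \<Omega> = {z.
     (\<forall>i\<in>{1..k}. (\<lambda>x. block blk i (z x)) \<in> Lspace (conj_exp (ennreal (p i))) \<Omega>) \<and>
     (\<exists>d\<in>Lspace r \<Omega>. is_weak_div \<Omega> z d)}"

section \<open>The pairing and its density\<close>

(* D_{x_1} u *)
definition D1 ::
  "('n::finite, 'm::finite) space set \<Rightarrow> (('n, 'm) space \<Rightarrow> real) \<Rightarrow> ('n, 'm) space set \<Rightarrow> real^'n" where
  "D1 \<Omega> u = (SOME D. is_deriv_measure \<Omega> (\<lambda>v. (v, 0)) u D)"

definition pairing_functional ::
  "('m \<Rightarrow> nat) \<Rightarrow> nat \<Rightarrow> ('n::finite, 'm::finite) space set \<Rightarrow>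
   (('n, 'm) space \<Rightarrow> ('n, 'm) space) \<Rightarrow> (('n, 'm) space \<Rightarrow> real) \<Rightarrow> (('n, 'm) space \<Rightarrow> real) \<Rightarrow> real" where
  "pairing_functional blk k \<Omega> z u \<phi> =
     - (LINT x|lebesgue_on \<Omega>. u x * \<phi> x * weak_div \<Omega> z x)
     - (\<Sum>i=1..k. LINT x|lebesgue_on \<Omega>. u x * (block blk i (z x) \<bullet> block blk i (grad \<phi> x)))
     - (\<Sum>i=2..k. LINT x|lebesgue_on \<Omega>. \<phi> x * (block blk i (z x) \<bullet> weak_grad blk i \<Omega> u x))"

definition pairing ::
  "('m \<Rightarrow> nat) \<Rightarrow> nat \<Rightarrow> ('n::finite, 'm::finite) space set \<Rightarrow>
   (('n, 'm) space \<Rightarrow> ('n, 'm) space) \<Rightarrow> (('n, 'm) space \<Rightarrow> real) \<Rightarrow> ('n, 'm) space set \<Rightarrow> real" where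
  "pairing blk k \<Omega> z u = (SOME \<nu>. represents \<Omega> \<nu> (pairing_functional blk k \<Omega> z u))"

(* t is a version of the density \<theta>(z_1, D_{x_1} u, .) of the pairing with respect to |D_{x_1} u|.
   Versions are determined only up to |D_{x_1} u|-null sets. Pitfall: for T Lipschitz and strictly
   increasing, T' may vanish on a set of positive measure, so a |D_{x_1}(T o u)|-null set need not
   be |D_{x_1} u|-null. Hence a |D_{x_1} u|-a.e. equality involving \<theta>(z_1, D_{x_1}(T o u), .)
   makes sense only for a suitable version of the latter. *)
definition is_theta ::
  "('m \<Rightarrow> nat) \<Rightarrow> nat \<Rightarrow> ('n::finite, 'm::finite) space set \<Rightarrow>
   (('n, 'm) space \<Rightarrow> ('n, 'm) space) \<Rightarrow> (('n, 'm) space \<Rightarrow> real) \<Rightarrow> (('n, 'm) space \<Rightarrow> real) \<Rightarrow> bool" where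
  "is_theta blk k \<Omega> z u t \<longleftrightarrow> integrable (total_variation \<Omega> (D1 \<Omega> u)) t \<and>
     (\<forall>B\<in>sets (restrict_space borel \<Omega>).
        pairing blk k \<Omega> z u B = (LINT x:B|total_variation \<Omega> (D1 \<Omega> u). t x))"

end

theory Submission
  imports Defs
begin

text \<open>
  The statement rests on one fact: \<open>D\<^sub>1 (T \<circ> u) = h D\<^sub>1 u\<close> for a scalar function \<open>h\<close> with
  \<open>0 \<le> h \<le> L\<close>, where \<open>L\<close> is a Lipschitz constant of \<open>T\<close>. The two derivative measures therefore have the
  same direction, and the density of the pairing depends on the measure only through its direction.

  The chain rule (\<open>weak_deriv_lipschitz_chain\<close>) is obtained by mollification. For mollifiers
  \<open>\<rho>\<^sub>n\<close>, \<open>u\<^sub>n = \<rho>\<^sub>n * u\<close> and smoothings \<open>T\<^sub>n\<close> of \<open>T\<close>, the derivative of \<open>T\<^sub>n \<circ> u\<^sub>n\<close> is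
  \<open>T\<^sub>n'(u\<^sub>n) (\<rho>\<^sub>n * Du)\<close>. Moving the mollifier to the other factor shows that, up to a
  vanishing error, this acts on a test function like \<open>h\<^sub>n Du\<close> with \<open>h\<^sub>n = \<rho>\<^sub>n * T\<^sub>n'(u\<^sub>n)\<close>, a function with
  values in \<open>[0, L]\<close> that does not depend on the direction of differentiation. Any weak limit \<open>h\<close> of the
  \<open>h\<^sub>n\<close> with respect to a measure that dominates all derivatives at once will do.

  The pairing is treated in the same way (\<open>mollified_pairing_limit\<close>): its action on a test function is
  the limit of the integrals of that function against \<open>(\<rho>\<^sub>n * z\<^sub>1) \<cdot> dD\<^sub>1 u\<close>. Writing \<open>D\<^sub>1 u = \<sigma> |D\<^sub>1 u|\<close> with a unit
  field \<open>\<sigma>\<close>, the bounded functions \<open>(\<rho>\<^sub>n * z\<^sub>1) \<cdot> \<sigma>\<close> have a weak limit \<open>\<theta>\<close>, so that the pairing of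
  \<open>u\<close> is \<open>\<theta> |D\<^sub>1 u|\<close>; as \<open>D\<^sub>1 (T \<circ> u) = h \<sigma> |D\<^sub>1 u|\<close>, the pairing of \<open>T \<circ> u\<close> is
  \<open>\<theta> h |D\<^sub>1 u| = \<theta> |D\<^sub>1 (T \<circ> u)|\<close> with the same \<open>\<theta>\<close> (\<open>pairing_densities\<close>). Hence one function is a version of
  both densities, and it agrees with every other version of the first one almost everywhere.

  Both weak limits come from \<open>bounded_weak_limit\<close>. Test functions determine densities
  (\<open>fundamental_lemma\<close>), which identifies the measures and weak derivatives that the definitions
  pick by choice, and \<open>total_variation_density\<close> computes \<open>|D\<^sub>1 u|\<close> as a supremum over partitions.
\<close>

section \<open>Smooth functions\<close>

definition smooth :: "('a::euclidean_space \<Rightarrow> real) \<Rightarrow> bool" where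
  "smooth f \<longleftrightarrow> (\<forall>m. C_k m f)"

lemma dir_deriv_eq: "(f has_derivative D) (at x) \<Longrightarrow> dir_deriv v f x = D v"
  unfolding dir_deriv_def by (simp add: frechet_derivative_at[symmetric])

lemma smooth_differentiable: "smooth f \<Longrightarrow> f differentiable (at x)"
  unfolding smooth_def by (metis C_k.simps(2))

lemma smooth_dir_deriv_Basis: "smooth f \<Longrightarrow> b \<in> Basis \<Longrightarrow> smooth (dir_deriv b f)"
  unfolding smooth_def by (metis C_k.simps(2))

lemma smooth_continuous: "smooth f \<Longrightarrow> continuous_on A f"
  by (meson differentiable_imp_continuous_on differentiable_on_def differentiable_at_withinI smooth_differentiable)

text \<open>The predicate \<open>C_k\<close> recurses on the order of differentiation. A set of differentiable functions that is
closed under partial derivatives avoids an induction on that order for each new class of functions.\<close>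

lemma smooth_coinduct:
  assumes "f \<in> S"
    and "\<And>f x. f \<in> S \<Longrightarrow> f differentiable (at x)"
    and "\<And>f b. f \<in> S \<Longrightarrow> b \<in> Basis \<Longrightarrow> dir_deriv b f \<in> S"
  shows "smooth f"
proof -
  have "\<forall>f\<in>S. C_k m f" for m
  proof (induction m)
    case 0
    then show ?case
      using assms(2) by (auto intro!: differentiable_imp_continuous_on simp: differentiable_on_def
          intro: differentiable_at_withinI)
  qed (use assms in auto)
  then show ?thesis using assms(1) by (auto simp: smooth_def)
qed

text \<open>The algebra generated by \<open>X\<close>. By the product rule it is closed under partial derivatives as soon as it
contains those of the generators, so smoothness has to be checked on generators only.\<close>

inductive generated :: "('a::euclidean_space \<Rightarrow> real) set \<Rightarrow> ('a \<Rightarrow> real) \<Rightarrow> bool" for X where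
  gen_base: "f \<in> X \<Longrightarrow> generated X f"
| gen_const: "generated X (\<lambda>x. c)"
| gen_add: "generated X f \<Longrightarrow> generated X g \<Longrightarrow> generated X (\<lambda>x. f x + g x)"
| gen_mult: "generated X f \<Longrightarrow> generated X g \<Longrightarrow> generated X (\<lambda>x. f x * g x)"

lemma dir_deriv_const: "dir_deriv v (\<lambda>x. c) = (\<lambda>x. 0)"
  by (auto simp: fun_eq_iff intro!: dir_deriv_eq has_derivative_const)

lemma dir_deriv_add:
  "f differentiable at x \<Longrightarrow> g differentiable at x \<Longrightarrow>
    dir_deriv v (\<lambda>x. f x + g x) x = dir_deriv v f x + dir_deriv v g x"
  unfolding dir_deriv_def[of v f] dir_deriv_def[of v g]
  by (rule dir_deriv_eq) (auto intro: has_derivative_add frechet_derivative_works[THEN iffD1])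

lemma dir_deriv_mult:
  "f differentiable at x \<Longrightarrow> g differentiable at x \<Longrightarrow>
    dir_deriv v (\<lambda>x. f x * g x) x = f x * dir_deriv v g x + dir_deriv v f x * g x"
  unfolding dir_deriv_def[of v f] dir_deriv_def[of v g]
  by (rule dir_deriv_eq) (auto intro: has_derivative_mult frechet_derivative_works[THEN iffD1])

lemma smooth_generated:
  assumes "generated X f"
    and X: "\<And>f x. f \<in> X \<Longrightarrow> f differentiable (at x)"
    "\<And>f b. f \<in> X \<Longrightarrow> b \<in> Basis \<Longrightarrow> generated X (dir_deriv b f)"
  shows "smooth f"
proof -
  have d: "f differentiable (at x)" if "generated X f" for f x
    using that by induction (auto intro: X)
  have "generated X (dir_deriv b f)" if "generated X f" "b \<in> Basis" for f b
    using that
  proof induction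
    case (gen_add f g)
    have "dir_deriv b (\<lambda>x. f x + g x) = (\<lambda>x. dir_deriv b f x + dir_deriv b g x)"
      by (auto simp: fun_eq_iff d gen_add dir_deriv_add)
    then show ?case using gen_add by (simp add: generated.gen_add)
  next
    case (gen_mult f g)
    have "dir_deriv b (\<lambda>x. f x * g x) = (\<lambda>x. f x * dir_deriv b g x + dir_deriv b f x * g x)"
      by (auto simp: fun_eq_iff d gen_mult dir_deriv_mult)
    then show ?case using gen_mult by (simp add: generated.gen_add generated.gen_mult)
  qed (auto simp: dir_deriv_const X intro: generated.gen_const)
  with d show ?thesis
    using assms(1) smooth_coinduct[of f "Collect (generated X)"] by simp
qed

lemma smooth_add_mult:
  assumes "smooth f" "smooth g"
  shows "smooth (\<lambda>x. f x + g x)" "smooth (\<lambda>x. f x * g x)"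
proof -
  have "generated (Collect smooth) f" "generated (Collect smooth) g"
    using assms by (auto intro: gen_base)
  then have "generated (Collect smooth) (\<lambda>x. f x + g x)" "generated (Collect smooth) (\<lambda>x. f x * g x)"
    by (auto intro: gen_add gen_mult)
  then show "smooth (\<lambda>x. f x + g x)" "smooth (\<lambda>x. f x * g x)"
    by (auto elim!: smooth_generated intro: smooth_differentiable gen_base smooth_dir_deriv_Basis)
qed

lemma smooth_const: "smooth (\<lambda>x. c)"
  by (rule smooth_generated[of "{}"]) (auto intro: gen_const)

lemma smooth_sum:
  assumes "finite I" "\<And>i. i \<in> I \<Longrightarrow> smooth (f i)"
  shows "smooth (\<lambda>x. \<Sum>i\<in>I. f i x)"
  using assms by induction (auto intro: smooth_const smooth_add_mult)

lemma dir_deriv_eq_sum_Basis: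
  assumes "f differentiable (at (x::'a::euclidean_space))"
  shows "dir_deriv v f x = (\<Sum>b\<in>Basis. (v \<bullet> b) * dir_deriv b f x)"
proof -
  interpret bounded_linear "frechet_derivative f (at x)"
    using assms by (intro has_derivative_bounded_linear[OF frechet_derivative_works[THEN iffD1]])
  have "frechet_derivative f (at x) v = frechet_derivative f (at x) (\<Sum>b\<in>Basis. (v \<bullet> b) *\<^sub>R b)"
    by (simp add: euclidean_representation)
  then show ?thesis by (simp add: dir_deriv_def sum scaleR)
qed

lemma smooth_dir_deriv:
  assumes "smooth f"
  shows "smooth (dir_deriv v f)"
proof -
  have "dir_deriv v f = (\<lambda>x. \<Sum>b\<in>Basis. (v \<bullet> b) * dir_deriv b f x)"
    using assms by (auto simp: fun_eq_iff smooth_differentiable dir_deriv_eq_sum_Basis)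
  then show ?thesis
    using assms by (auto intro!: smooth_sum smooth_add_mult smooth_const smooth_dir_deriv_Basis)
qed

lemma smooth_has_derivative: "smooth f \<Longrightarrow> (f has_derivative (\<lambda>v. dir_deriv v f x)) (at x)"
  unfolding dir_deriv_def by (auto intro: frechet_derivative_works[THEN iffD1] smooth_differentiable)

lemma dir_deriv_reflect:
  assumes "smooth f"
  shows "dir_deriv v (\<lambda>y. f (c - y)) y = - dir_deriv v f (c - y)"
proof -
  have "((\<lambda>y. f (c - y)) has_derivative (\<lambda>w. dir_deriv (-w) f (c - y))) (at y)"
    by (rule has_derivative_compose[of "\<lambda>y. c - y" "\<lambda>w. -w", OF _ smooth_has_derivative[OF assms]])
       (auto intro!: derivative_eq_intros)
  then have "dir_deriv v (\<lambda>y. f (c - y)) y = dir_deriv (-v) f (c - y)"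
    by (rule dir_deriv_eq)
  then show ?thesis
    using assms by (simp add: smooth_differentiable dir_deriv_eq_sum_Basis sum_negf)
qed

lemma dir_deriv_scale:
  "f differentiable at x \<Longrightarrow> dir_deriv v (\<lambda>x. s * f x) x = s * dir_deriv v f x"
  by (subst dir_deriv_mult) (auto simp: dir_deriv_const)

lemma smooth_reflect:
  assumes "smooth f"
  shows "smooth (\<lambda>y. f (c - y))"
proof -
  let ?S = "{g. \<exists>s f. smooth f \<and> g = (\<lambda>y. s * f (c - y))}"
  have d: "(\<lambda>y. f (c - y)) differentiable (at x)" if "smooth f" for x and f :: "'a \<Rightarrow> real"
    using smooth_differentiable[OF that]
    by (auto intro!: differentiable_compose[of f "\<lambda>y. c - y" x UNIV, simplified])
  have "(\<lambda>y. 1 * f (c - y)) \<in> ?S" using assms by blast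
  then have "smooth (\<lambda>y. 1 * f (c - y))"
  proof (rule smooth_coinduct)
    fix g b assume "g \<in> ?S" "(b::'a) \<in> Basis"
    then obtain s f where f: "smooth f" "g = (\<lambda>y. s * f (c - y))" by blast
    have "dir_deriv b g = (\<lambda>y. (-s) * dir_deriv b f (c - y))"
      unfolding f(2) by (auto simp: fun_eq_iff dir_deriv_scale d f(1) dir_deriv_reflect)
    then show "dir_deriv b g \<in> ?S"
      using smooth_dir_deriv[OF f(1)] by blast
  qed (auto intro: d)
  then show ?thesis by simp
qed

section \<open>Bump functions\<close>

text \<open>The functions \<open>t\<^sup>-\<^sup>k exp (-1/t)\<close>, extended by zero to \<open>t \<le> 0\<close>. The derivative of such a function is a linear
combination of functions of the same kind, which makes all of them smooth across \<open>t = 0\<close>.\<close>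

definition flat :: "nat \<Rightarrow> real \<Rightarrow> real" where
  "flat k t = (if t > 0 then (1/t)^k * exp (-1/t) else 0)"

lemma flat_tendsto_0: "(flat k \<longlongrightarrow> 0) (at 0)"
proof -
  have "((\<lambda>t. inverse t ^ k / exp (inverse t)) \<longlongrightarrow> 0) (at_right (0::real))"
    by (rule filterlim_compose[OF tendsto_power_div_exp_0 filterlim_inverse_at_top_right])
  then have "(flat k \<longlongrightarrow> 0) (at_right 0)"
    by (rule Lim_transform_eventually)
      (auto simp: flat_def eventually_at_right_field exp_minus field_simps intro!: exI[of _ 1])
  moreover have "(flat k \<longlongrightarrow> 0) (at_left 0)"
    by (rule Lim_transform_eventually[OF tendsto_const])
      (auto simp: flat_def eventually_at_left_field intro!: exI[of _ "-1"])
  ultimately show ?thesis by (simp add: filterlim_split_at)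
qed

lemma flat_has_derivative:
  "(flat k has_real_derivative flat (k+2) t - of_nat k * flat (k+1) t) (at t)"
proof -
  consider "t > 0" | "t = 0" | "t < 0" by linarith
  then show ?thesis
  proof cases
    case 1
    have "((\<lambda>t. (1/t)^k * exp (-1/t)) has_real_derivative
        (1/t)^k * (exp (-1/t) * (1/t^2)) + (of_nat k * (1/t)^(k-1) * (-1/t^2)) * exp (-1/t)) (at t)"
      using 1 by (auto intro!: derivative_eq_intros simp: power2_eq_square)
    moreover have "(1/t)^k * (exp (-1/t) * (1/t^2)) + (of_nat k * (1/t)^(k-1) * (-1/t^2)) * exp (-1/t)
      = flat (k+2) t - of_nat k * flat (k+1) t"
      using 1 by (cases k) (auto simp: flat_def power2_eq_square field_simps)
    ultimately have "((\<lambda>t. (1/t)^k * exp (-1/t)) has_real_derivative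
        flat (k+2) t - of_nat k * flat (k+1) t) (at t)" by simp
    then show ?thesis
      by (rule has_field_derivative_transform_within_open[of _ _ _ "{0<..}"])
         (use 1 in \<open>auto simp: flat_def\<close>)
  next
    case 2
    have "((\<lambda>h. (flat k (0 + h) - flat k 0) / h) \<longlongrightarrow> 0) (at 0)"
      by (rule Lim_transform_eventually[OF flat_tendsto_0[of "Suc k"]])
         (auto simp: flat_def eventually_at_filter field_simps)
    then show ?thesis unfolding 2 DERIV_def by (simp add: flat_def)
  next
    case 3
    have "((\<lambda>t. 0) has_real_derivative 0) (at t)" by simp
    then have "(flat k has_real_derivative 0) (at t)"
      by (rule has_field_derivative_transform_within_open[of _ _ _ "{..<0}"])
         (use 3 in \<open>auto simp: flat_def\<close>)
    then show ?thesis using 3 by (simp add: flat_def)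
  qed
qed

lemma flat_0_bounds: "0 \<le> flat 0 t" "flat 0 t \<le> 1" "flat 0 t > 0 \<longleftrightarrow> t > 0"
  by (auto simp: flat_def)

text \<open>A function that is positive exactly on the open box between \<open>a\<close> and \<open>c\<close>. Increasing \<open>n\<close> makes it
steeper; in the limit it becomes the indicator function of the box.\<close>

definition bump :: "nat \<Rightarrow> 'a::euclidean_space \<Rightarrow> 'a \<Rightarrow> 'a \<Rightarrow> real" where
  "bump n a c x = (\<Prod>e\<in>Basis. flat 0 (n * (x \<bullet> e - a \<bullet> e)) * flat 0 (n * (c \<bullet> e - x \<bullet> e)))"

lemma smooth_bump: "smooth (bump n a c)"
proof -
  define X where "X = {f :: 'a \<Rightarrow> real. \<exists>k \<alpha> \<beta> e. f = (\<lambda>x. flat k (\<alpha> * (x \<bullet> e) + \<beta>))}"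
  have der: "((\<lambda>x. flat k (\<alpha> * (x \<bullet> e) + \<beta>)) has_derivative
      (\<lambda>v. (flat (k+2) (\<alpha> * (x \<bullet> e) + \<beta>) - of_nat k * flat (k+1) (\<alpha> * (x \<bullet> e) + \<beta>)) * (\<alpha> * (v \<bullet> e)))) (at x)"
    for k \<alpha> \<beta> and e x :: 'a
    by (rule has_derivative_compose[of "\<lambda>x. \<alpha> * (x \<bullet> e) + \<beta>" "\<lambda>v. \<alpha> * (v \<bullet> e)", OF _
          flat_has_derivative[unfolded has_field_derivative_def]])
       (auto intro!: derivative_eq_intros)
  have X: "(\<lambda>x. flat k (\<alpha> * (x \<bullet> e) + \<beta>)) \<in> X" for k \<alpha> \<beta> e
    unfolding X_def by blast
  have fin: "generated X (\<lambda>x. \<Prod>i\<in>I. f i x)" if "finite I" "\<And>i. i \<in> I \<Longrightarrow> generated X (f i)"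
    for I :: "'a set" and f
    using that by induction (auto intro: gen_const gen_mult)
  have "generated X (\<lambda>x. flat 0 (n * (x \<bullet> e - a \<bullet> e)) * flat 0 (n * (c \<bullet> e - x \<bullet> e)))" for e
    using gen_mult[OF gen_base[OF X[of 0 n e "- n * (a \<bullet> e)"]] gen_base[OF X[of 0 "-n" e "n * (c \<bullet> e)"]]]
    by (simp add: algebra_simps)
  then have "generated X (bump n a c)"
    unfolding bump_def[abs_def] by (intro fin) auto
  then show ?thesis
  proof (rule smooth_generated)
    fix f b assume "f \<in> X"
    then obtain k \<alpha> \<beta> e where f: "f = (\<lambda>x. flat k (\<alpha> * (x \<bullet> e) + \<beta>))" by (auto simp: X_def)
    then show "f differentiable (at x)" for x unfolding f differentiable_def using der by blast
    have "dir_deriv b f = (\<lambda>x. (flat (k+2) (\<alpha> * (x \<bullet> e) + \<beta>) +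
        (- of_nat k) * flat (k+1) (\<alpha> * (x \<bullet> e) + \<beta>)) * (\<alpha> * (b \<bullet> e)))"
      using dir_deriv_eq[OF der] by (auto simp: f fun_eq_iff)
    moreover have "generated X \<dots>"
      by (rule gen_mult[OF gen_add[OF gen_base[OF X] gen_mult[OF gen_const gen_base[OF X]]] gen_const])
    ultimately show "generated X (dir_deriv b f)" by simp
  qed
qed

lemma bump_nonneg: "0 \<le> bump n a c x"
  and bump_le_1: "bump n a c x \<le> 1"
  unfolding bump_def by (auto intro!: prod_nonneg prod_le_1 mult_nonneg_nonneg mult_le_one flat_0_bounds)

lemma bump_eq_0: "x \<notin> box a c \<Longrightarrow> bump n a c x = 0"
  and bump_pos: "n > 0 \<Longrightarrow> x \<in> box a c \<Longrightarrow> bump n a c x > 0"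
proof -
  assume "x \<notin> box a c"
  then obtain e where "e \<in> Basis" "\<not> (a \<bullet> e < x \<bullet> e \<and> x \<bullet> e < c \<bullet> e)" by (auto simp: mem_box)
  then show "bump n a c x = 0"
    unfolding bump_def by (auto intro!: bexI[of _ e] simp: flat_def zero_less_mult_iff)
next
  assume "n > 0" "x \<in> box a c"
  then show "bump n a c x > 0"
    unfolding bump_def by (auto intro!: prod_pos mult_pos_pos simp: flat_0_bounds mem_box)
qed

lemma bump_tendsto_indicator: "(\<lambda>n. bump n a c x) \<longlonglongrightarrow> indicator (box a c) x"
proof (cases "x \<in> box a c")
  case True
  have lim: "(\<lambda>n. flat 0 (real n * t)) \<longlonglongrightarrow> 1" if "t > 0" for t
  proof -
    have "(\<lambda>n. exp (- (inverse t * inverse (real n)))) \<longlonglongrightarrow> exp (- (inverse t * 0))"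
      by (intro tendsto_intros LIMSEQ_inverse_real_of_nat_add[of 0, simplified] lim_inverse_n)
    moreover have "\<forall>\<^sub>F n in sequentially. exp (- (inverse t * inverse (real n))) = flat 0 (real n * t)"
      using eventually_gt_at_top[of 0] by eventually_elim (use that in \<open>auto simp: flat_def field_simps\<close>)
    ultimately show ?thesis
      using Lim_transform_eventually by fastforce
  qed
  have "(\<lambda>n. bump n a c x) \<longlonglongrightarrow> (\<Prod>e\<in>(Basis::'a set). 1 * 1)"
    unfolding bump_def using True by (intro tendsto_prod tendsto_mult lim) (auto simp: mem_box)
  then show ?thesis using True by simp
qed (simp add: bump_eq_0)

section \<open>Test functions\<close>

lemma test_functionsI:
  "smooth \<phi> \<Longrightarrow> compact K \<Longrightarrow> K \<subseteq> \<Omega> \<Longrightarrow> (\<And>x. x \<notin> K \<Longrightarrow> \<phi> x = 0) \<Longrightarrow> \<phi> \<in> test_functions \<Omega>"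
  unfolding test_functions_def smooth_def by blast

lemma test_functionsE:
  assumes "\<phi> \<in> test_functions \<Omega>"
  obtains K where "smooth \<phi>" "compact K" "K \<subseteq> \<Omega>" "\<And>x. x \<notin> K \<Longrightarrow> \<phi> x = 0"
  using assms unfolding test_functions_def smooth_def by blast

lemma test_functions_smooth: "\<phi> \<in> test_functions \<Omega> \<Longrightarrow> smooth \<phi>"
  by (auto elim: test_functionsE)

lemma test_functions_outside: "\<phi> \<in> test_functions \<Omega> \<Longrightarrow> x \<notin> \<Omega> \<Longrightarrow> \<phi> x = 0"
  by (auto elim: test_functionsE)

lemma bump_test_function: "cbox a c \<subseteq> \<Omega> \<Longrightarrow> bump n a c \<in> test_functions \<Omega>"
  by (rule test_functionsI[OF smooth_bump compact_cbox]) (use box_subset_cbox in \<open>auto intro!: bump_eq_0\<close>)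

lemma test_functions_mult:
  assumes "\<phi> \<in> test_functions \<Omega>" "smooth f"
  shows "(\<lambda>x. \<phi> x * f x) \<in> test_functions \<Omega>"
  by (rule test_functionsE[OF assms(1)], rule test_functionsI) (auto intro: smooth_add_mult assms)

lemma dir_deriv_eq_0_outside:
  assumes "closed K" "\<And>x. x \<notin> K \<Longrightarrow> \<phi> x = 0" "x \<notin> K"
  shows "dir_deriv v \<phi> x = 0"
proof -
  have "(\<phi> has_derivative (\<lambda>v. 0)) (at x)"
    by (rule has_derivative_transform_within_open[where s = "-K" and f = "\<lambda>_. 0"]) (use assms in auto)
  then show ?thesis by (rule dir_deriv_eq)
qed

lemma test_functions_dir_deriv:
  assumes "\<phi> \<in> test_functions \<Omega>"
  shows "dir_deriv v \<phi> \<in> test_functions \<Omega>"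
  by (rule test_functionsE[OF assms], rule test_functionsI)
     (auto intro: smooth_dir_deriv dir_deriv_eq_0_outside compact_imp_closed)

lemma test_functions_bounded:
  assumes "\<phi> \<in> test_functions \<Omega>"
  obtains C where "C > 0" "\<And>x. \<bar>\<phi> x\<bar> \<le> C"
proof -
  obtain K where K: "smooth \<phi>" "compact K" "\<And>x. x \<notin> K \<Longrightarrow> \<phi> x = 0"
    using assms by (auto elim: test_functionsE)
  have "bounded (\<phi> ` K)"
    by (intro compact_imp_bounded compact_continuous_image smooth_continuous K)
  then obtain C where "\<forall>x\<in>K. \<bar>\<phi> x\<bar> \<le> C" by (auto simp: bounded_iff)
  then have "\<bar>\<phi> x\<bar> \<le> max C 1" for x
    by (cases "x \<in> K") (auto simp: K)
  then show thesis by (intro that[of "max C 1"]) auto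
qed

lemma smooth_measurable [measurable]: "smooth \<phi> \<Longrightarrow> \<phi> \<in> borel_measurable borel"
  by (intro borel_measurable_continuous_onI smooth_continuous)

section \<open>Weak limits of bounded sequences\<close>

text \<open>A substitute for the convex hull of the tail of a sequence: the parallelogram law uses only
midpoints of pairs.\<close>

inductive midpoint_hull :: "(nat \<Rightarrow> 'a \<Rightarrow> real) \<Rightarrow> nat \<Rightarrow> ('a \<Rightarrow> real) \<Rightarrow> bool" for f n where
  hull_base: "m \<ge> n \<Longrightarrow> midpoint_hull f n (f m)"
| hull_mid: "midpoint_hull f n g \<Longrightarrow> midpoint_hull f n h \<Longrightarrow> midpoint_hull f n (\<lambda>x. (g x + h x) / 2)"

lemma midpoint_hull_mono: "midpoint_hull f n g \<Longrightarrow> m \<le> n \<Longrightarrow> midpoint_hull f m g"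
  by (induction rule: midpoint_hull.induct) (auto intro: midpoint_hull.intros)

text \<open>Weak compactness of bounded sequences, in a form that needs no subsequence: every
convergent sequence of tested integrals has the value predicted by \<open>g\<close>.

Elements of the midpoint hulls of the tails with nearly minimal \<open>L\<^sup>2\<close> norm form a Cauchy sequence by the
parallelogram law, since their midpoints stay in the hull and cannot have a much smaller norm. Its
limit is \<open>g\<close>. If the tested integrals of \<open>f n\<close> converge to \<open>l\<close>, then those of all
elements of the hull of a late tail are close to \<open>l\<close>, and this passes to \<open>g\<close>.\<close>

lemma bounded_weak_limit:
  fixes f :: "nat \<Rightarrow> 'a \<Rightarrow> real"
  assumes "finite_measure M"
    and meas: "\<And>n. f n \<in> borel_measurable M"
    and bds: "\<And>n x. x \<in> space M \<Longrightarrow> a \<le> f n x \<and> f n x \<le> b" and "a \<le> b"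
  obtains g where "g \<in> borel_measurable M" "\<And>x. a \<le> g x" "\<And>x. g x \<le> b"
    "\<And>\<psi> l. integrable M \<psi> \<Longrightarrow> (\<lambda>n. \<integral>x. \<psi> x * f n x \<partial>M) \<longlonglongrightarrow> l \<Longrightarrow> (\<integral>x. \<psi> x * g x \<partial>M) = l"
proof -
  interpret finite_measure M by fact
  define C where "C = \<bar>a\<bar> + \<bar>b\<bar>"
  have C0: "C \<ge> 0" by (simp add: C_def)
  have hm: "g \<in> borel_measurable M" and hb: "x \<in> space M \<Longrightarrow> a \<le> g x \<and> g x \<le> b"
    if "midpoint_hull f n g" for g n x
    using that by (induction) (use meas bds in fastforce)+
  have hC: "\<bar>g x\<bar> \<le> C" if "midpoint_hull f n g" "x \<in> space M" for g n x
    using hb[OF that] unfolding C_def by linarith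
  have h2C: "(g x)^2 \<le> C^2" if "midpoint_hull f n g" "x \<in> space M" for g n x
    using hC[OF that] by (metis abs_ge_zero power2_abs power_mono)
  have int2: "integrable M (\<lambda>x. (g x)^2)" if "midpoint_hull f n g" for g n
    by (rule integrable_const_bound[of _ "C^2"]) (use that hm h2C in auto)
  have int1: "integrable M g" if "midpoint_hull f n g" for g n
    by (rule integrable_const_bound[of _ C]) (use that hm hC in auto)
  have intp: "integrable M (\<lambda>x. \<psi> x * g x)" if "midpoint_hull f n g" "integrable M \<psi>" for g n \<psi>
  proof (rule Bochner_Integration.integrable_bound[of M "\<lambda>x. C * \<psi> x"])
    show "AE x in M. norm (\<psi> x * g x) \<le> norm (C * \<psi> x)"
      using hC[OF that(1)] C0 by (auto intro!: AE_I2 mult_left_mono simp: abs_mult mult.commute[of C])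
  qed (use that hm in auto)
  let ?I = "\<lambda>g. \<integral>x. (g x)^2 \<partial>M"
  define d where "d n = Inf (?I ` Collect (midpoint_hull f n))" for n
  have bdd: "bdd_below (?I ` Collect (midpoint_hull f n))" for n
    by (auto intro!: bdd_belowI[of _ 0])
  have ne: "midpoint_hull f n (f n)" for n by (rule hull_base) simp
  have d_le: "d n \<le> ?I g" if "midpoint_hull f n g" for n g
    unfolding d_def using that by (intro cInf_lower bdd) auto
  have "d m \<le> d n" if "m \<le> n" for m n
    unfolding d_def using that ne by (intro cInf_superset_mono bdd) (auto intro: midpoint_hull_mono)
  then have "incseq d" by (simp add: incseq_def)
  moreover have "d n \<le> measure M (space M) * C^2" for n
  proof -
    have "?I (f n) \<le> (\<integral>x. C^2 \<partial>M)"
      by (intro integral_mono int2[OF ne] h2C[OF ne]) auto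
    with d_le[OF ne, of n] show ?thesis by simp
  qed
  ultimately obtain D where D: "d \<longlonglongrightarrow> D" by (metis incseq_convergent)
  have "\<exists>g. midpoint_hull f n g \<and> ?I g < d n + 1 / (Suc n)" for n
    using cInf_lessD[of "?I ` Collect (midpoint_hull f n)" "d n + 1 / (Suc n)"] ne[of n]
    unfolding d_def by auto
  then obtain G where G: "midpoint_hull f n (G n)" "?I (G n) < d n + 1 / (Suc n)" for n by metis
  have close: "(\<integral>x. (G n x - G m x)^2 \<partial>M) \<le> 2 * (d m - d n) + 2 / Suc n + 2 / Suc m" if "n \<le> m" for n m
  proof -
    have mid: "midpoint_hull f n (\<lambda>x. (G n x + G m x) / 2)"
      using G midpoint_hull_mono that by (intro hull_mid) blast+
    have "(\<integral>x. (G n x - G m x)^2 \<partial>M) = (\<integral>x. 2 * (G n x)^2 + 2 * (G m x)^2 - 4 * ((G n x + G m x) / 2)^2 \<partial>M)"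
      by (intro Bochner_Integration.integral_cong refl) (simp add: power2_eq_square field_simps)
    also have "\<dots> = 2 * ?I (G n) + 2 * ?I (G m) - 4 * ?I (\<lambda>x. (G n x + G m x) / 2)"
      using int2[OF G(1)] int2[OF mid] by simp
    also have "\<dots> \<le> 2 * (d m - d n) + 2 / Suc n + 2 / Suc m"
      using d_le[OF mid] G(2)[of n] G(2)[of m] by (simp add: algebra_simps)
    finally show ?thesis .
  qed
  have sq0: "\<exists>N. \<forall>i\<ge>N. \<forall>j\<ge>N. (\<integral>x. (G i x - G j x)^2 \<partial>M) < e" if "e > 0" for e
  proof -
    obtain N1 where N1: "\<And>n. n \<ge> N1 \<Longrightarrow> \<bar>d n - D\<bar> < e / 8"
      using D[THEN LIMSEQ_D, of "e/8"] \<open>e > 0\<close> unfolding real_norm_def by (metis divide_pos_pos zero_less_numeral)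
    obtain N2 where N2: "8 / e < real N2" using reals_Archimedean2 by blast
    have small: "2 / Suc n < e / 4" if "n \<ge> N2" for n
    proof -
      have "8 / e < real (Suc n)" using N2 that by linarith
      then show ?thesis using \<open>e > 0\<close> by (simp add: field_simps)
    qed
    have *: "(\<integral>x. (G i x - G j x)^2 \<partial>M) < e" if "i \<le> j" "i \<ge> max N1 N2" for i j
    proof -
      have "i \<ge> N1" "i \<ge> N2" "j \<ge> N1" "j \<ge> N2" using that by auto
      then show ?thesis
        using close[OF that(1)] small[of i] small[of j] N1[of i] N1[of j] by argo
    qed
    have "(\<integral>x. (G i x - G j x)^2 \<partial>M) < e" if "j \<ge> max N1 N2" "i \<ge> max N1 N2" for i j
    proof (cases "i \<le> j")
      case False
      then show ?thesis using *[of j i] that by (simp add: power2_commute)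
    qed (use that * in auto)
    then show ?thesis by blast
  qed
  have "\<exists>N. \<forall>i\<ge>N. \<forall>j\<ge>N. (\<integral>x. norm (G i x - G j x) \<partial>M) < e" if "e > 0" for e
  proof -
    define mm where "mm = measure M (space M) + 1"
    define \<delta> where "\<delta> = e / (2 * mm)"
    have mm: "mm > 0" unfolding mm_def by (smt (verit) measure_nonneg)
    then have \<delta>: "\<delta> > 0" using that by (simp add: \<delta>_def)
    obtain N where N: "\<And>i j. i \<ge> N \<Longrightarrow> j \<ge> N \<Longrightarrow> (\<integral>x. (G i x - G j x)^2 \<partial>M) < \<delta> * (e / 2)"
      using sq0[of "\<delta> * (e/2)"] \<delta> \<open>e > 0\<close> by (metis half_gt_zero mult_pos_pos)
    have "(\<integral>x. norm (G i x - G j x) \<partial>M) < e" if ij: "i \<ge> N" "j \<ge> N" for i j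
    proof -
      \<comment> \<open>On a finite measure space this turns the Cauchy property in \<open>L\<^sup>2\<close> into one in \<open>L\<^sup>1\<close>.\<close>
      have pt: "\<bar>t\<bar> \<le> \<delta> + t^2 / \<delta>" for t :: real
      proof (cases "\<bar>t\<bar> \<le> \<delta>")
        case False
        then have "\<bar>t\<bar> * \<delta> \<le> \<bar>t\<bar> * \<bar>t\<bar>" by (intro mult_left_mono) auto
        then have "\<bar>t\<bar> \<le> t^2 / \<delta>" using \<delta> by (simp add: field_simps power2_eq_square)
        then show ?thesis using \<delta> by linarith
      next
        case True
        moreover have "0 \<le> t^2 / \<delta>" using \<delta> by simp
        ultimately show ?thesis by linarith
      qed
      have i2: "integrable M (\<lambda>x. (G i x - G j x)^2)"
        using int2[OF G(1)] intp[OF G(1) int1[OF G(1)]] by (simp add: power2_diff mult.assoc)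
      have "(\<integral>x. norm (G i x - G j x) \<partial>M) \<le> (\<integral>x. \<delta> + (G i x - G j x)^2 / \<delta> \<partial>M)"
        using pt i2 int1[OF G(1)] by (intro integral_mono) auto
      also have "\<dots> = measure M (space M) * \<delta> + (\<integral>x. (G i x - G j x)^2 \<partial>M) / \<delta>"
        using i2 by simp
      also have "measure M (space M) * \<delta> \<le> e / 2"
        using \<delta> mm that by (simp add: \<delta>_def mm_def field_simps)
      also have "(\<integral>x. (G i x - G j x)^2 \<partial>M) / \<delta> < e / 2"
        using N[OF ij] \<delta> by (simp add: field_simps)
      finally show ?thesis by simp
    qed
    then show ?thesis by blast
  qed
  from cauchy_L1_AE_cauchy_subseq[of M G, OF int1[OF G(1)] this]
  obtain r where r: "strict_mono r" "AE x in M. Cauchy (\<lambda>i. G (r i) x)" by blast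
  \<comment> \<open>The truncation only matters on the null set where the sequence fails to converge.\<close>
  define g where "g x = max a (min b (lim (\<lambda>i. G (r i) x)))" for x
  have gm: "g \<in> borel_measurable M"
    unfolding g_def using hm[OF G(1)] by (intro borel_measurable_max borel_measurable_min borel_measurable_lim_metric) auto
  have lim: "AE x in M. (\<lambda>i. G (r i) x) \<longlonglongrightarrow> g x"
    using r(2) AE_space
  proof eventually_elim
    case (elim x)
    then obtain l where l: "(\<lambda>i. G (r i) x) \<longlonglongrightarrow> l" by (metis Cauchy_convergent_iff convergent_def)
    then have "a \<le> l" "l \<le> b"
      using hb[OF G(1)] elim(2) by (auto intro: LIMSEQ_le_const LIMSEQ_le_const2)
    with l show ?case by (simp add: g_def limI max_def min_def)
  qed
  show thesis
  proof
    show "g \<in> borel_measurable M" by (rule gm)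
    show "a \<le> g x" "g x \<le> b" for x using \<open>a \<le> b\<close> by (auto simp: g_def)
    fix \<psi> l assume \<psi>: "integrable M \<psi>" and l: "(\<lambda>n. \<integral>x. \<psi> x * f n x \<partial>M) \<longlonglongrightarrow> l"
    have 1: "(\<lambda>i. \<integral>x. \<psi> x * G (r i) x \<partial>M) \<longlonglongrightarrow> (\<integral>x. \<psi> x * g x \<partial>M)"
    proof (rule integral_dominated_convergence[where w = "\<lambda>x. C * \<bar>\<psi> x\<bar>"])
      show "AE x in M. (\<lambda>i. \<psi> x * G (r i) x) \<longlonglongrightarrow> \<psi> x * g x"
        using lim by eventually_elim (intro tendsto_intros)
      show "AE x in M. norm (\<psi> x * G (r i) x) \<le> C * \<bar>\<psi> x\<bar>" for i
        using hC[OF G(1)] by (auto intro!: AE_I2 mult_left_mono simp: abs_mult mult.commute[of C])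
    qed (use \<psi> gm hm[OF G(1)] in auto)
    have "(\<lambda>n. \<integral>x. \<psi> x * G n x \<partial>M) \<longlonglongrightarrow> l"
    proof (rule LIMSEQ_I)
      fix e :: real assume "e > 0"
      then obtain N where N: "\<And>n. n \<ge> N \<Longrightarrow> \<bar>(\<integral>x. \<psi> x * f n x \<partial>M) - l\<bar> < e"
        using LIMSEQ_D[OF l] by auto
      have "\<bar>(\<integral>x. \<psi> x * g x \<partial>M) - l\<bar> < e" if "midpoint_hull f N g" for g
        using that
      proof induction
        case (hull_mid g h)
        have "(\<integral>x. \<psi> x * ((g x + h x) / 2) \<partial>M) = (\<integral>x. (\<psi> x * g x + \<psi> x * h x) / 2 \<partial>M)"
          by (simp add: distrib_left)
        also have "\<dots> = ((\<integral>x. \<psi> x * g x \<partial>M) + (\<integral>x. \<psi> x * h x \<partial>M)) / 2"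
          using intp[OF _ \<psi>] hull_mid by (subst integral_divide_zero, subst Bochner_Integration.integral_add) auto
        finally have eq: "(\<integral>x. \<psi> x * ((g x + h x) / 2) \<partial>M) = \<dots>" .
        have "\<bar>(A + B) / 2 - l\<bar> < e" if "\<bar>A - l\<bar> < e" "\<bar>B - l\<bar> < e" for A B
          using that unfolding abs_less_iff by (simp add: field_simps)
        then show ?case unfolding eq using hull_mid by blast
      qed (rule N)
      then show "\<exists>N. \<forall>n\<ge>N. norm ((\<integral>x. \<psi> x * G n x \<partial>M) - l) < e"
        using G(1) midpoint_hull_mono by (metis real_norm_def)
    qed
    then have "(\<lambda>i. \<integral>x. \<psi> x * G (r i) x \<partial>M) \<longlonglongrightarrow> l"
      using LIMSEQ_subseq_LIMSEQ[OF _ r(1)] by (fastforce simp: o_def)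
    with 1 show "(\<integral>x. \<psi> x * g x \<partial>M) = l" by (rule LIMSEQ_unique)
  qed
qed

section \<open>Mollification\<close>

lemma lborel_distr_reflect: "distr lborel borel (\<lambda>y. x - y) = (lborel :: 'a::euclidean_space measure)"
  using lborel_affine[of "-1" x] by (simp add: density_1)

lemma lborel_integral_reflect:
  fixes f :: "'a::euclidean_space \<Rightarrow> real"
  assumes [measurable]: "f \<in> borel_measurable borel"
  shows "(LINT y|lborel. f (x - y)) = integral\<^sup>L lborel f"
  by (subst (2) lborel_distr_reflect[of x, symmetric], subst integral_distr) auto

lemma lborel_nn_integral_reflect:
  fixes f :: "'a::euclidean_space \<Rightarrow> ennreal"
  assumes [measurable]: "f \<in> borel_measurable borel"
  shows "(\<integral>\<^sup>+y. f (x - y) \<partial>lborel) = integral\<^sup>N lborel f"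
  by (subst (2) lborel_distr_reflect[of x, symmetric], subst nn_integral_distr) auto

lemma lborel_distr_shift: "distr lborel borel (\<lambda>y. y - x) = (lborel :: 'a::euclidean_space measure)"
  using lborel_affine[of 1 "-x"] by (simp add: density_1)

lemma lborel_integral_shift:
  fixes f :: "'a::euclidean_space \<Rightarrow> real"
  assumes [measurable]: "f \<in> borel_measurable borel"
  shows "(LINT y|lborel. f (y - x)) = integral\<^sup>L lborel f"
  by (subst (2) lborel_distr_shift[of x, symmetric], subst integral_distr) auto

lemma lborel_nn_integral_shift:
  fixes f :: "'a::euclidean_space \<Rightarrow> ennreal"
  assumes [measurable]: "f \<in> borel_measurable borel"
  shows "(\<integral>\<^sup>+y. f (y - x) \<partial>lborel) = integral\<^sup>N lborel f"
  by (subst (2) lborel_distr_shift[of x, symmetric], subst nn_integral_distr) auto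

lemma lborel_integrable_shift:
  fixes f :: "'a::euclidean_space \<Rightarrow> real"
  assumes "integrable lborel f"
  shows "integrable lborel (\<lambda>y. f (y - x))"
proof -
  have [measurable]: "f \<in> borel_measurable borel" using assms by auto
  show ?thesis
    using assms lborel_nn_integral_shift[where f = "\<lambda>y. ennreal (norm (f y))" and x = x]
    unfolding integrable_iff_bounded by auto
qed

lemma L1_translation_indicator_open:
  fixes U :: "'a::euclidean_space set"
  assumes U: "open U" "emeasure lborel U < \<infinity>" and w: "w \<longlonglongrightarrow> 0"
  shows "(\<lambda>n. LINT x|lborel. \<bar>indicat_real U (x - w n) - indicat_real U x\<bar>) \<longlonglongrightarrow> 0"
proof -
  have [measurable]: "U \<in> sets borel" using U by auto
  have iU: "integrable lborel (indicat_real U)" using U by (intro integrable_real_indicator) auto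
  note iUs = lborel_integrable_shift[OF iU]
  \<comment> \<open>Both indicators have the same integral, so the L1 distance is twice that of the positive part.\<close>
  have "(LINT x|lborel. \<bar>indicat_real U (x - v) - indicat_real U x\<bar>)
      = 2 * (LINT x|lborel. max 0 (indicat_real U x - indicat_real U (x - v)))" for v
  proof -
    have "(LINT x|lborel. \<bar>indicat_real U (x - v) - indicat_real U x\<bar>) =
      (LINT x|lborel. 2 * max 0 (indicat_real U x - indicat_real U (x - v)) + (indicat_real U (x - v) - indicat_real U x))"
      by (intro Bochner_Integration.integral_cong) (auto split: split_indicator)
    also have "\<dots> = 2 * (LINT x|lborel. max 0 (indicat_real U x - indicat_real U (x - v))) +
        ((LINT x|lborel. indicat_real U (x - v)) - integral\<^sup>L lborel (indicat_real U))"
      using iU iUs[of v] by (subst Bochner_Integration.integral_add) auto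
    finally show ?thesis by (simp add: lborel_integral_shift)
  qed
  moreover have "(\<lambda>n. LINT x|lborel. max 0 (indicat_real U x - indicat_real U (x - w n))) \<longlonglongrightarrow> (LINT x|(lborel::'a measure). 0)"
  proof (rule integral_dominated_convergence[OF _ _ iU])
    have "(\<lambda>n. max 0 (indicat_real U x - indicat_real U (x - w n))) \<longlonglongrightarrow> 0" for x
    proof (cases "x \<in> U")
      case True
      have "(\<lambda>n. x - w n) \<longlonglongrightarrow> x - 0" by (intro tendsto_intros w)
      then have "\<forall>\<^sub>F n in sequentially. x - w n \<in> U"
        using topological_tendstoD U(1) True by fastforce
      then have "\<forall>\<^sub>F n in sequentially. 0 = max 0 (indicat_real U x - indicat_real U (x - w n))"
        by eventually_elim (use True in auto)
      then show ?thesis by (rule Lim_transform_eventually[OF tendsto_const])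
    qed (auto split: split_indicator intro!: tendsto_eventually always_eventually)
    then show "AE x in lborel. (\<lambda>n. max 0 (indicat_real U x - indicat_real U (x - w n))) \<longlonglongrightarrow> 0" by simp
  qed (auto split: split_indicator)
  ultimately show ?thesis by (auto intro: tendsto_mult_right_zero)
qed

text \<open>Continuity of translations in \<open>L\<^sup>1\<close>, first for indicators of open sets, then by outer regularity for
indicators of Borel sets, and finally by approximation with simple functions.\<close>

lemma L1_translation:
  fixes f :: "'a::euclidean_space \<Rightarrow> real"
  assumes "integrable lborel f" and w: "w \<longlonglongrightarrow> 0"
  shows "(\<lambda>n. LINT x|lborel. \<bar>f (x - w n) - f x\<bar>) \<longlonglongrightarrow> 0"
proof -
  \<comment> \<open>The functions for which the claim holds are closed under L1 limits.\<close>
  have closed: "(\<lambda>n. LINT x|lborel. \<bar>f (x - w n) - f x\<bar>) \<longlonglongrightarrow> 0"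
    if f: "integrable lborel f"
      and approx: "\<And>e. e > 0 \<Longrightarrow> \<exists>g. integrable lborel g \<and> (LINT x|lborel. \<bar>f x - g x\<bar>) \<le> e
          \<and> (\<lambda>n. LINT x|lborel. \<bar>g (x - w n) - g x\<bar>) \<longlonglongrightarrow> 0" for f :: "'a \<Rightarrow> real"
  proof (rule LIMSEQ_I)
    fix e :: real assume "e > 0"
    obtain g where g: "integrable lborel g" "(LINT x|lborel. \<bar>f x - g x\<bar>) \<le> e / 4"
      and lim: "(\<lambda>n. LINT x|lborel. \<bar>g (x - w n) - g x\<bar>) \<longlonglongrightarrow> 0"
      using approx[of "e/4"] \<open>e > 0\<close> by auto
    obtain N where N: "\<And>n. n \<ge> N \<Longrightarrow> \<bar>LINT x|lborel. \<bar>g (x - w n) - g x\<bar>\<bar> < e / 4"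
      using LIMSEQ_D[OF lim, of "e/4"] \<open>e > 0\<close> by auto
    have "(LINT x|lborel. \<bar>f (x - w n) - f x\<bar>) < e" if "n \<ge> N" for n
    proof -
      note i = lborel_integrable_shift[OF f, of "w n"] lborel_integrable_shift[OF g(1), of "w n"] f g(1)
      have [measurable]: "f \<in> borel_measurable borel" "g \<in> borel_measurable borel" using f g by auto
      have "(LINT x|lborel. \<bar>f (x - w n) - f x\<bar>) \<le>
        (LINT x|lborel. \<bar>f (x - w n) - g (x - w n)\<bar> + \<bar>g (x - w n) - g x\<bar> + \<bar>f x - g x\<bar>)"
        using i by (intro integral_mono) auto
      also have "\<dots> = (LINT x|lborel. \<bar>f (x - w n) - g (x - w n)\<bar>) + (LINT x|lborel. \<bar>g (x - w n) - g x\<bar>)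
          + (LINT x|lborel. \<bar>f x - g x\<bar>)"
        using i by simp
      also have "(LINT x|lborel. \<bar>f (x - w n) - g (x - w n)\<bar>) = (LINT x|lborel. \<bar>f x - g x\<bar>)"
        by (rule lborel_integral_shift[where f = "\<lambda>x. \<bar>f x - g x\<bar>"]) simp
      finally show ?thesis using N[OF that] g(2) \<open>e > 0\<close> by linarith
    qed
    moreover have "0 \<le> (LINT x|lborel. \<bar>f (x - w n) - f x\<bar>)" for n by (intro integral_nonneg_AE) auto
    ultimately show "\<exists>N. \<forall>n\<ge>N. norm ((LINT x|lborel. \<bar>f (x - w n) - f x\<bar>) - 0) < e"
      by (metis abs_of_nonneg diff_zero real_norm_def)
  qed
  from assms(1) show ?thesis
  proof (induction rule: integrable_induct)
    case (base A c)
    then have A[measurable]: "A \<in> sets borel" "emeasure lborel A < \<infinity>" by (auto simp: top.not_eq_extremum)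
    have ind: "integrable lborel (\<lambda>x. indicator A x *\<^sub>R c)"
      using A by (intro integrable_scaleR_left integrable_real_indicator) auto
    show ?case
    proof (rule closed[OF ind])
      fix e :: real assume e: "e > 0"
      define \<delta> where "\<delta> = e / (\<bar>c\<bar> + 1)"
      have \<delta>: "\<delta> > 0" "\<delta> * \<bar>c\<bar> \<le> e" using e by (auto simp: \<delta>_def field_simps)
      obtain U where U: "open U" "A \<subseteq> U" "emeasure lborel (U - A) \<le> \<delta>"
        using outer_regular_lborel_le[OF A(1) \<delta>(1)] by blast
      have [measurable]: "U \<in> sets borel" using U by auto
      have "emeasure lborel U \<le> emeasure lborel A + emeasure lborel (U - A)"
        using emeasure_subadditive[of A lborel "U - A"] U(2) by (simp add: Un_absorb1)
      also have "\<dots> < \<infinity>" using A(2) U(3) by (auto simp: less_top[symmetric] top_unique)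
      finally have fU: "emeasure lborel U < \<infinity>" .
      then have iU: "integrable lborel (indicat_real U)" by (intro integrable_real_indicator) auto
      have "(LINT x|lborel. \<bar>indicator A x *\<^sub>R c - indicator U x * c\<bar>) = (LINT x|lborel. indicator (U - A) x * \<bar>c\<bar>)"
        by (intro Bochner_Integration.integral_cong) (use U(2) in \<open>auto split: split_indicator\<close>)
      also have "\<dots> = measure lborel (U - A) * \<bar>c\<bar>" by simp
      also have "\<dots> \<le> \<delta> * \<bar>c\<bar>"
        using U(3) \<delta>(1) by (intro mult_right_mono) (auto simp: measure_def intro!: enn2real_leI)
      finally have "(LINT x|lborel. \<bar>indicator A x *\<^sub>R c - indicator U x * c\<bar>) \<le> e" using \<delta> by linarith
      moreover have "(\<lambda>n. LINT x|lborel. \<bar>indicator U (x - w n) * c - indicator U x * c\<bar>) \<longlonglongrightarrow> 0"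
        using tendsto_mult_left_zero[OF L1_translation_indicator_open[OF U(1) fU w], of "\<bar>c\<bar>"]
        by (simp add: abs_mult flip: left_diff_distrib)
      moreover have "integrable lborel (\<lambda>x. indicator U x * c)"
        using iU by simp
      ultimately show "\<exists>g. integrable lborel g \<and> (LINT x|lborel. \<bar>indicator A x *\<^sub>R c - g x\<bar>) \<le> e
          \<and> (\<lambda>n. LINT x|lborel. \<bar>g (x - w n) - g x\<bar>) \<longlonglongrightarrow> 0" by blast
    qed
  next
    case (add f g)
    have [measurable]: "f \<in> borel_measurable borel" "g \<in> borel_measurable borel" using add by auto
    have "(\<lambda>n. (LINT x|lborel. \<bar>f (x - w n) - f x\<bar>) + (LINT x|lborel. \<bar>g (x - w n) - g x\<bar>)) \<longlonglongrightarrow> 0 + 0"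
      by (intro tendsto_add add)
    then show ?case
    proof (rule Lim_null_comparison[rotated, OF tendsto_eq_rhs], goal_cases)
      case 2
      have "norm (LINT x|lborel. \<bar>f (x - w n) + g (x - w n) - (f x + g x)\<bar>) \<le>
        (LINT x|lborel. \<bar>f (x - w n) - f x\<bar>) + (LINT x|lborel. \<bar>g (x - w n) - g x\<bar>)" for n
      proof -
        note i = add(1,2) lborel_integrable_shift[OF add(1), of "w n"] lborel_integrable_shift[OF add(2), of "w n"]
        have "norm (LINT x|lborel. \<bar>f (x - w n) + g (x - w n) - (f x + g x)\<bar>) =
          (LINT x|lborel. \<bar>f (x - w n) + g (x - w n) - (f x + g x)\<bar>)"
          by simp
        also have "\<dots> \<le> (LINT x|lborel. \<bar>f (x - w n) - f x\<bar> + \<bar>g (x - w n) - g x\<bar>)"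
          using i by (intro integral_mono) auto
        also have "\<dots> = (LINT x|lborel. \<bar>f (x - w n) - f x\<bar>) + (LINT x|lborel. \<bar>g (x - w n) - g x\<bar>)"
          using i by simp
        finally show ?thesis .
      qed
      then show ?case by simp
    qed simp
  next
    case (lim f s)
    show ?case
    proof (rule closed[OF lim(4)])
      fix e :: real assume e: "e > 0"
      have "(\<lambda>i. LINT x|lborel. \<bar>f x - s i x\<bar>) \<longlonglongrightarrow> (LINT x|(lborel::'a measure). 0)"
      proof (rule integral_dominated_convergence[where w = "\<lambda>x. 3 * norm (f x)"])
        show "AE x in lborel. (\<lambda>i. \<bar>f x - s i x\<bar>) \<longlonglongrightarrow> 0"
        proof (rule AE_I2)
          fix x :: 'a
          have "(\<lambda>i. \<bar>f x - s i x\<bar>) \<longlonglongrightarrow> \<bar>f x - f x\<bar>" by (intro tendsto_intros lim(2)) simp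
          then show "(\<lambda>i. \<bar>f x - s i x\<bar>) \<longlonglongrightarrow> 0" by simp
        qed
        show "AE x in lborel. norm \<bar>f x - s i x\<bar> \<le> 3 * norm (f x)" for i
        proof (rule AE_I2)
          fix x :: 'a
          have "\<bar>s i x\<bar> \<le> 2 * \<bar>f x\<bar>" using lim(3)[of x i] by simp
          then show "norm \<bar>f x - s i x\<bar> \<le> 3 * norm (f x)" unfolding real_norm_def by arith
        qed
      qed (use lim in auto)
      then have "(\<lambda>i. LINT x|lborel. \<bar>f x - s i x\<bar>) \<longlonglongrightarrow> 0" by simp
      from LIMSEQ_D[OF this e] obtain i where "\<bar>LINT x|lborel. \<bar>f x - s i x\<bar>\<bar> < e" by auto
      then show "\<exists>g. integrable lborel g \<and> (LINT x|lborel. \<bar>f x - g x\<bar>) \<le> e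
          \<and> (\<lambda>n. LINT x|lborel. \<bar>g (x - w n) - g x\<bar>) \<longlonglongrightarrow> 0"
        using lim(1,5) by (intro exI[of _ "s i"]) auto
    qed
  qed
qed

text \<open>The support shrinks to the origin as \<open>n\<close> grows; \<open>Suc n\<close> keeps the box nonempty for \<open>n = 0\<close>.\<close>

definition mollifier :: "nat \<Rightarrow> 'a::euclidean_space \<Rightarrow> real" where
  "mollifier n x = bump 1 (- (inverse (Suc n) *\<^sub>R One)) (inverse (Suc n) *\<^sub>R One) x /
     integral\<^sup>L lborel (bump 1 (- (inverse (Suc n) *\<^sub>R One)) (inverse (Suc n) *\<^sub>R (One::'a)))"

lemma test_function_integrable:
  assumes "\<phi> \<in> test_functions \<Omega>"
  shows "integrable lborel \<phi>"
proof -
  obtain K where K: "smooth \<phi>" "compact K" "\<And>x. x \<notin> K \<Longrightarrow> \<phi> x = 0"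
    using assms by (auto elim: test_functionsE)
  have "integrable lborel (\<lambda>x. indicator K x *\<^sub>R \<phi> x)"
    by (intro borel_integrable_compact K smooth_continuous)
  also have "(\<lambda>x. indicator K x *\<^sub>R \<phi> x) = \<phi>" using K(3) by (auto simp: indicator_def fun_eq_iff)
  finally show ?thesis .
qed

lemma bump_integral_pos:
  assumes "box a c \<noteq> {}"
  shows "integral\<^sup>L lborel (bump 1 a c) > 0"
proof (rule ccontr)
  assume "\<not> ?thesis"
  moreover have int: "integrable lborel (bump 1 a c)"
    by (rule test_function_integrable[OF bump_test_function[of a c UNIV]]) simp
  ultimately have "integral\<^sup>L lborel (bump 1 a c) = 0"
    by (metis bump_nonneg integral_nonneg_AE AE_I2 linorder_less_linear not_less)
  with int have "AE x in lborel. bump 1 a c x = 0"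
    by (simp add: integral_nonneg_eq_0_iff_AE bump_nonneg)
  then have "AE x in lborel. x \<notin> box a c"
    by eventually_elim (use bump_pos[of 1] in force)
  then have "emeasure lborel (box a c) = 0" by (subst (asm) AE_iff_measurable[OF _ refl]) auto
  moreover have "\<forall>b\<in>Basis. a \<bullet> b < c \<bullet> b" using assms by (simp add: box_ne_empty)
  moreover from this have "(\<Prod>b\<in>Basis. (c - a) \<bullet> b) > 0"
    by (intro prod_pos) (auto simp: inner_diff_left)
  ultimately show False unfolding emeasure_lborel_box_eq
    by (force split: if_splits simp: less_imp_le inner_diff_left)
qed

lemma mollifier_const_pos:
  "integral\<^sup>L lborel (bump 1 (- (inverse (Suc n) *\<^sub>R One)) (inverse (Suc n) *\<^sub>R (One::'a::euclidean_space))) > 0"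
  by (rule bump_integral_pos) (auto simp: box_ne_empty)

lemma smooth_mollifier: "smooth (mollifier n)"
  unfolding mollifier_def[abs_def] divide_inverse by (intro smooth_add_mult smooth_bump smooth_const)

lemma mollifier_nonneg: "0 \<le> mollifier n x"
  unfolding mollifier_def using mollifier_const_pos[of n] bump_nonneg by (intro divide_nonneg_pos) auto

lemma mollifier_integral: "integral\<^sup>L lborel (mollifier n :: 'a::euclidean_space \<Rightarrow> real) = 1"
  unfolding mollifier_def[abs_def] using mollifier_const_pos[where 'a='a, of n] by simp

lemma mollifier_eq_0:
  fixes x :: "'a::euclidean_space"
  assumes "norm x > DIM('a) / Suc n"
  shows "mollifier n x = 0"
proof -
  have "\<not> x \<in> box (- (inverse (Suc n) *\<^sub>R One)) (inverse (Suc n) *\<^sub>R One)"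
  proof
    assume "x \<in> box (- (inverse (Suc n) *\<^sub>R One)) (inverse (Suc n) *\<^sub>R One)"
    then have "\<bar>x \<bullet> b\<bar> \<le> inverse (Suc n)" if "b \<in> Basis" for b using that by (force simp: mem_box)
    then have "(\<Sum>b\<in>Basis. \<bar>x \<bullet> b\<bar>) \<le> DIM('a) * inverse (Suc n)"
      using sum_bounded_above[of "Basis::'a set" "\<lambda>b. \<bar>x \<bullet> b\<bar>" "inverse (Suc n)"] by simp
    then have "norm x \<le> DIM('a) / Suc n" using norm_le_l1[of x] by (simp add: divide_inverse)
    with assms show False by simp
  qed
  then show ?thesis by (simp add: mollifier_def bump_eq_0)
qed

lemma mollifier_test_function: "mollifier n \<in> test_functions UNIV"
  by (rule test_functionsI[OF smooth_mollifier compact_cball[of 0 "DIM('a) / Suc n"]])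
     (auto intro: mollifier_eq_0)

lemma mollifier_measurable [measurable]: "mollifier n \<in> borel_measurable borel"
  by (simp add: smooth_mollifier)

lemma mollifier_integrable: "integrable lborel (mollifier n)"
  by (rule test_function_integrable[OF mollifier_test_function])

lemma integrable_mollifier_reflect: "integrable lborel (\<lambda>y. mollifier n (x - y))"
proof -
  have "(\<lambda>y. mollifier n (x - y)) \<in> test_functions (UNIV :: 'a set)"
  proof (rule test_functionsI[OF smooth_reflect[OF smooth_mollifier] compact_cball[of x "DIM('a) / Suc n"]])
    show "mollifier n (x - y) = 0" if "y \<notin> cball x (DIM('a) / Suc n)" for y
      using that by (intro mollifier_eq_0) (simp add: dist_norm)
  qed simp
  then show ?thesis by (rule test_function_integrable)
qed

lemma mollifier_reflect_integral: "(LINT y|lborel. mollifier n (x - y)) = 1"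
  and mollifier_shift_integral: "(LINT y|lborel. mollifier n (y - x)) = 1"
  by (simp_all add: lborel_integral_reflect lborel_integral_shift mollifier_integral)

lemma mollifier_nn_integral:
  "(\<integral>\<^sup>+y. ennreal (mollifier n (x - y)) \<partial>lborel) = 1" "(\<integral>\<^sup>+y. ennreal (mollifier n (y - x)) \<partial>lborel) = 1"
  "(\<integral>\<^sup>+y. ennreal (mollifier n y) \<partial>lborel) = 1"
proof -
  show *: "(\<integral>\<^sup>+y. ennreal (mollifier n y) \<partial>lborel) = 1"
    using nn_integral_eq_integral[OF mollifier_integrable, of n] by (simp add: mollifier_nonneg mollifier_integral)
  show "(\<integral>\<^sup>+y. ennreal (mollifier n (x - y)) \<partial>lborel) = 1" "(\<integral>\<^sup>+y. ennreal (mollifier n (y - x)) \<partial>lborel) = 1"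
    using * by (simp_all add: lborel_nn_integral_reflect[where f = "\<lambda>y. ennreal (mollifier n y)"]
        lborel_nn_integral_shift[where f = "\<lambda>y. ennreal (mollifier n y)"])
qed

lemma (in pair_sigma_finite) integrable_kernel:
  fixes f :: "'a \<Rightarrow> real" and g :: "'b \<Rightarrow> real"
  assumes f: "integrable M1 f" and g: "integrable M2 g"
    and K: "(\<lambda>(x, y). K x y) \<in> borel_measurable (M1 \<Otimes>\<^sub>M M2)" "\<And>x y. \<bar>K x y\<bar> \<le> C"
  shows "integrable (M1 \<Otimes>\<^sub>M M2) (\<lambda>(x, y). f x * g y * K x y)"
proof -
  have [measurable]: "f \<in> borel_measurable M1" "g \<in> borel_measurable M2" using f g by auto
  have "integrable (M1 \<Otimes>\<^sub>M M2) (\<lambda>(x, y). f x * g y)"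
    by (rule Fubini_integrable) (use f g in \<open>auto simp: abs_mult\<close>)
  then have "integrable (M1 \<Otimes>\<^sub>M M2) (\<lambda>p. (case p of (x, y) \<Rightarrow> f x * g y) * C)" by simp
  then show ?thesis
  proof (rule Bochner_Integration.integrable_bound)
    show "AE p in M1 \<Otimes>\<^sub>M M2. norm (case p of (x, y) \<Rightarrow> f x * g y * K x y)
        \<le> norm ((case p of (x, y) \<Rightarrow> f x * g y) * C)"
      using K(2) order_trans[OF K(2) abs_ge_self]
      by (intro AE_I2) (auto simp: abs_mult split_beta intro!: mult_left_mono)
    show "(\<lambda>(x, y). f x * g y * K x y) \<in> borel_measurable (M1 \<Otimes>\<^sub>M M2)"
      using K(1) by (simp add: split_beta')
  qed
qed

lemma L1_translation_uniform:
  fixes f :: "'a::euclidean_space \<Rightarrow> real"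
  assumes f: "integrable lborel f" and "e > 0"
  obtains \<delta> where "\<delta> > 0" "\<And>w. norm w < \<delta> \<Longrightarrow> (LINT x|lborel. \<bar>f (x - w) - f x\<bar>) < e"
proof -
  let ?I = "\<lambda>w. LINT x|lborel. \<bar>f (x - w) - f x\<bar>"
  have "(?I \<longlongrightarrow> 0) (at 0 within UNIV)"
    unfolding tendsto_at_iff_sequentially o_def using L1_translation[OF f] by blast
  then have "\<forall>\<^sub>F w in at 0. \<bar>?I w\<bar> < e"
    using tendstoD[of ?I 0 "at 0" e] \<open>e > 0\<close> by simp
  then obtain \<delta> where \<delta>: "\<delta> > 0" "\<And>w. w \<noteq> 0 \<Longrightarrow> norm w < \<delta> \<Longrightarrow> \<bar>?I w\<bar> < e"
    by (auto simp: eventually_at)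
  have "?I w < e" if "norm w < \<delta>" for w
    using \<delta>(2)[of w] that \<open>e > 0\<close> by (cases "w = 0") auto
  with \<delta>(1) show thesis by (rule that)
qed

definition mollify :: "nat \<Rightarrow> ('a::euclidean_space \<Rightarrow> real) \<Rightarrow> 'a \<Rightarrow> real" where
  "mollify n g x = (LINT y|lborel. g y * mollifier n (x - y))"

lemma integrable_mult_bounded:
  fixes g :: "'a \<Rightarrow> real"
  assumes "integrable M g" "f \<in> borel_measurable M" "\<And>x. \<bar>f x\<bar> \<le> C"
  shows "integrable M (\<lambda>x. g x * f x)" "integrable M (\<lambda>x. f x * g x)"
proof -
  have "integrable M (\<lambda>x. g x * C)" using assms by simp
  then show "integrable M (\<lambda>x. g x * f x)"
  proof (rule Bochner_Integration.integrable_bound)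
    show "AE x in M. norm (g x * f x) \<le> norm (g x * C)"
      using order_trans[OF assms(3) abs_ge_self] by (auto simp: abs_mult intro!: mult_left_mono)
  qed (use assms in auto)
  then show "integrable M (\<lambda>x. f x * g x)" by (simp add: mult.commute)
qed

lemma mollifier_bounded:
  obtains C where "C > 0" "\<And>x::'a::euclidean_space. \<bar>mollifier n x\<bar> \<le> C"
  using test_functions_bounded[OF mollifier_test_function[of n]] by metis

lemma mollify_integrand_integrable:
  assumes "integrable lborel g"
  shows "integrable lborel (\<lambda>y. g y * mollifier n (x - y))"
proof -
  obtain C where "C > 0" "\<And>x::'a. \<bar>mollifier n x\<bar> \<le> C" using mollifier_bounded[of n] by metis
  then show ?thesis using assms by (intro integrable_mult_bounded(1)[of _ _ _ C]) auto
qed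

lemma mollify_measurable [measurable]:
  assumes [measurable]: "g \<in> borel_measurable borel"
  shows "mollify n g \<in> borel_measurable borel"
  unfolding mollify_def by measurable

lemma mollify_integrable_prod:
  fixes g :: "'a::euclidean_space \<Rightarrow> real"
  assumes g: "integrable lborel g"
  shows "integrable (lborel \<Otimes>\<^sub>M lborel) (\<lambda>(y, x). g y * mollifier n (x - y))"
proof (rule lborel_pair.Fubini_integrable)
  have [measurable]: "g \<in> borel_measurable borel" using g by auto
  show "(\<lambda>(y, x). g y * mollifier n (x - y)) \<in> borel_measurable (lborel \<Otimes>\<^sub>M lborel)" by measurable
  show "AE y in lborel. integrable lborel (\<lambda>x. case (y, x) of (y, x) \<Rightarrow> g y * mollifier n (x - y))"
    by (auto intro!: lborel_integrable_shift mollifier_integrable)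
  show "integrable lborel (\<lambda>y. LINT x|lborel. norm (case (y, x) of (y, x) \<Rightarrow> g y * mollifier n (x - y)))"
    using g by (simp add: abs_mult mollifier_nonneg mollifier_shift_integral)
qed

lemma mollify_integrable: "integrable lborel g \<Longrightarrow> integrable lborel (mollify n g)"
  using lborel_pair.integrable_snd[of "\<lambda>y x. g y * mollifier n (x - y)"] mollify_integrable_prod
  unfolding mollify_def by blast

lemma mollify_integral:
  assumes "integrable lborel g"
  shows "integral\<^sup>L lborel (mollify n g) = integral\<^sup>L lborel g"
proof -
  have "integral\<^sup>L lborel (mollify n g) = (LINT y|lborel. LINT x|lborel. g y * mollifier n (x - y))"
    unfolding mollify_def by (rule lborel_pair.Fubini_integral[OF mollify_integrable_prod[OF assms]])
  then show ?thesis by (simp add: mollifier_shift_integral)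
qed

text \<open>The distance between \<open>g\<close> and its mollification is an average of the distances between \<open>g\<close> and
translates of \<open>g\<close> by small vectors.\<close>

lemma mollify_L1:
  fixes g :: "'a::euclidean_space \<Rightarrow> real"
  assumes g: "integrable lborel g"
  shows "(\<lambda>n. LINT x|lborel. \<bar>mollify n g x - g x\<bar>) \<longlonglongrightarrow> 0"
proof (rule LIMSEQ_I)
  fix e :: real assume "e > 0"
  have [measurable]: "g \<in> borel_measurable borel" using g by auto
  obtain \<delta> where \<delta>: "\<delta> > 0" "\<And>w. norm w < \<delta> \<Longrightarrow> (LINT x|lborel. \<bar>g (x - w) - g x\<bar>) < e / 2"
    using L1_translation_uniform[OF g, of "e/2"] \<open>e > 0\<close> by auto
  obtain N where N: "DIM('a) / \<delta> < real N" using reals_Archimedean2 by blast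
  have "(LINT x|lborel. \<bar>mollify n g x - g x\<bar>) \<le> e / 2" if "n \<ge> N" for n
  proof -
    have supp: "mollifier n w = 0" if "norm w \<ge> \<delta>" for w :: 'a
    proof (rule mollifier_eq_0)
      have "DIM('a) / \<delta> < real (Suc n)" using N \<open>n \<ge> N\<close> by linarith
      then have "DIM('a) / Suc n < \<delta>" using \<delta>(1) by (simp add: field_simps)
      then show "DIM('a) / Suc n < norm w" using that by linarith
    qed
    have pt: "ennreal \<bar>mollify n g x - g x\<bar> \<le> (\<integral>\<^sup>+w. ennreal (\<bar>g (x - w) - g x\<bar> * mollifier n w) \<partial>lborel)" for x
    proof -
      have i: "integrable lborel (\<lambda>y. (g y - g x) * mollifier n (x - y))"
        using mollify_integrand_integrable[OF g, of n x] integrable_mollifier_reflect[of n x]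
        by (simp add: left_diff_distrib)
      have "mollify n g x - g x = (LINT y|lborel. (g y - g x) * mollifier n (x - y))"
        using mollify_integrand_integrable[OF g, of n x] integrable_mollifier_reflect[of n x]
        by (simp add: left_diff_distrib mollify_def mollifier_reflect_integral)
      then have "ennreal \<bar>mollify n g x - g x\<bar> \<le> (\<integral>\<^sup>+y. ennreal (norm ((g y - g x) * mollifier n (x - y))) \<partial>lborel)"
        using integral_norm_bound_ennreal[OF i] by simp
      also have "\<dots> = (\<integral>\<^sup>+y. ennreal (\<bar>g (x - (x - y)) - g x\<bar> * mollifier n (x - y)) \<partial>lborel)"
        by (simp add: abs_mult mollifier_nonneg)
      also have "\<dots> = (\<integral>\<^sup>+w. ennreal (\<bar>g (x - w) - g x\<bar> * mollifier n w) \<partial>lborel)"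
        by (rule lborel_nn_integral_reflect[where f = "\<lambda>w. ennreal (\<bar>g (x - w) - g x\<bar> * mollifier n w)"]) simp
      finally show ?thesis .
    qed
    have "ennreal (LINT x|lborel. \<bar>mollify n g x - g x\<bar>) = (\<integral>\<^sup>+x. ennreal \<bar>mollify n g x - g x\<bar> \<partial>lborel)"
      using mollify_integrable[OF g, of n] g by (intro nn_integral_eq_integral[symmetric]) auto
    also have "\<dots> \<le> (\<integral>\<^sup>+x. (\<integral>\<^sup>+w. ennreal (\<bar>g (x - w) - g x\<bar> * mollifier n w) \<partial>lborel) \<partial>lborel)"
      by (intro nn_integral_mono pt)
    also have "\<dots> = (\<integral>\<^sup>+w. (\<integral>\<^sup>+x. ennreal (\<bar>g (x - w) - g x\<bar> * mollifier n w) \<partial>lborel) \<partial>lborel)"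
      by (rule lborel_pair.Fubini') simp
    also have "\<dots> \<le> (\<integral>\<^sup>+w. ennreal (mollifier n w) * ennreal (e / 2) \<partial>(lborel :: 'a measure))"
    proof (intro nn_integral_mono)
      fix w :: 'a
      have iw: "integrable lborel (\<lambda>x. \<bar>g (x - w) - g x\<bar>)"
        using lborel_integrable_shift[OF g, of w] g by auto
      have "(\<integral>\<^sup>+x. ennreal (\<bar>g (x - w) - g x\<bar> * mollifier n w) \<partial>lborel)
        = (\<integral>\<^sup>+x. ennreal \<bar>g (x - w) - g x\<bar> \<partial>lborel) * ennreal (mollifier n w)"
        by (simp add: ennreal_mult mollifier_nonneg nn_integral_multc)
      also have "(\<integral>\<^sup>+x. ennreal \<bar>g (x - w) - g x\<bar> \<partial>lborel) = ennreal (LINT x|lborel. \<bar>g (x - w) - g x\<bar>)"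
        by (rule nn_integral_eq_integral[OF iw]) simp
      also have "\<dots> * ennreal (mollifier n w) \<le> ennreal (e / 2) * ennreal (mollifier n w)"
      proof (cases "norm w < \<delta>")
        case True
        then show ?thesis using \<delta>(2)[of w] by (intro mult_right_mono ennreal_leI) auto
      qed (use supp[of w] in auto)
      finally show "(\<integral>\<^sup>+x. ennreal (\<bar>g (x - w) - g x\<bar> * mollifier n w) \<partial>lborel)
          \<le> ennreal (mollifier n w) * ennreal (e / 2)" by (simp add: mult.commute)
    qed
    also have "\<dots> = ennreal (e / 2)"
      by (simp add: nn_integral_multc mollifier_nn_integral)
    finally show ?thesis using \<open>e > 0\<close> by (simp add: ennreal_le_iff)
  qed
  moreover have "0 \<le> (LINT x|lborel. \<bar>mollify n g x - g x\<bar>)" for n by (intro integral_nonneg_AE) auto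
  ultimately show "\<exists>N. \<forall>n\<ge>N. norm ((LINT x|lborel. \<bar>mollify n g x - g x\<bar>) - 0) < e"
    using \<open>e > 0\<close> by (intro exI[of _ N]) (auto intro: le_less_trans[of _ "e / 2"])
qed

text \<open>A condition on \<open>F\<close> and \<open>G\<close> under which the integral of \<open>F\<close> against mollifications of \<open>G\<close> converges. It holds for
functions with conjugate exponents, by Young's inequality, and also for bounded \<open>F\<close> and integrable \<open>G\<close>. The large
values of \<open>F\<close> contribute at most \<open>A x + B y\<close> for arbitrary pairs of arguments \<open>x\<close> and \<open>y\<close>, hence
uniformly little, however \<open>G\<close> is translated or averaged.\<close>

definition young_pair :: "('a::euclidean_space \<Rightarrow> real) \<Rightarrow> ('a \<Rightarrow> real) \<Rightarrow> bool" where
  "young_pair F G \<longleftrightarrow> integrable lborel F \<and> integrable lborel G \<and>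
    (\<forall>\<eta>>0. \<exists>K A B. integrable lborel A \<and> integrable lborel B \<and> (\<forall>x. 0 \<le> A x) \<and> (\<forall>x. 0 \<le> B x) \<and>
      (AE x in lborel. \<bar>F x\<bar> > K \<longrightarrow> (\<forall>y. \<bar>F x\<bar> * \<bar>G y\<bar> \<le> A x + B y)) \<and>
      integral\<^sup>L lborel A + integral\<^sup>L lborel B \<le> \<eta>)"

lemma young_pairE:
  assumes "young_pair F G" "\<eta> > 0"
  obtains K A B where "integrable lborel A" "integrable lborel B" "\<And>x. 0 \<le> A x" "\<And>x. 0 \<le> B x"
    "AE x in lborel. \<bar>F x\<bar> > K \<longrightarrow> (\<forall>y. \<bar>F x\<bar> * \<bar>G y\<bar> \<le> A x + B y)"
    "integral\<^sup>L lborel A + integral\<^sup>L lborel B \<le> \<eta>"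
proof -
  have "\<exists>K A B. integrable lborel A \<and> integrable lborel B \<and> (\<forall>x. 0 \<le> A x) \<and> (\<forall>x. 0 \<le> B x) \<and>
      (AE x in lborel. \<bar>F x\<bar> > K \<longrightarrow> (\<forall>y. \<bar>F x\<bar> * \<bar>G y\<bar> \<le> A x + B y)) \<and>
      integral\<^sup>L lborel A + integral\<^sup>L lborel B \<le> \<eta>"
    using assms unfolding young_pair_def by simp
  then show thesis
    by (elim exE conjE) (rule that, auto)
qed

text \<open>If \<open>|F' x|\<close> exceeds \<open>2 a\<close>, then the constant \<open>a\<close> can be absorbed and \<open>|F' x| \<le> 2 c |F x|\<close>.\<close>

lemma young_pair_affine:
  assumes FG: "young_pair F G" and F': "integrable lborel F'"
    and le: "\<And>x. \<bar>F' x\<bar> \<le> a + c * \<bar>F x\<bar>" and c: "c > 0"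
  shows "young_pair F' G"
  unfolding young_pair_def
proof (intro conjI allI impI)
  show "integrable lborel G" using FG by (simp add: young_pair_def)
  show "integrable lborel F'" by fact
  fix \<eta> :: real assume \<eta>: "\<eta> > 0"
  obtain K A B where AB: "integrable lborel A" "integrable lborel B" "\<And>x. 0 \<le> A x" "\<And>x. 0 \<le> B x"
    "AE x in lborel. \<bar>F x\<bar> > K \<longrightarrow> (\<forall>y. \<bar>F x\<bar> * \<bar>G y\<bar> \<le> A x + B y)"
    "integral\<^sup>L lborel A + integral\<^sup>L lborel B \<le> \<eta> / (2 * c)"
    by (rule young_pairE[OF FG, of "\<eta> / (2 * c)"]) (use \<eta> c in auto)
  show "\<exists>K A B. integrable lborel A \<and> integrable lborel B \<and> (\<forall>x. 0 \<le> A x) \<and> (\<forall>x. 0 \<le> B x) \<and>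
      (AE x in lborel. \<bar>F' x\<bar> > K \<longrightarrow> (\<forall>y. \<bar>F' x\<bar> * \<bar>G y\<bar> \<le> A x + B y)) \<and>
      integral\<^sup>L lborel A + integral\<^sup>L lborel B \<le> \<eta>"
  proof (rule exI[of _ "max (2 * a) (2 * c * K)"], rule exI[of _ "\<lambda>x. 2 * c * A x"], rule exI[of _ "\<lambda>x. 2 * c * B x"], intro conjI)
    show "AE x in lborel. \<bar>F' x\<bar> > max (2 * a) (2 * c * K) \<longrightarrow> (\<forall>y. \<bar>F' x\<bar> * \<bar>G y\<bar> \<le> 2 * c * A x + 2 * c * B y)"
      using AB(5)
    proof eventually_elim
      case (elim x)
      show ?case
      proof (intro impI allI)
        fix y assume big: "\<bar>F' x\<bar> > max (2 * a) (2 * c * K)"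
        then have le2: "\<bar>F' x\<bar> \<le> 2 * c * \<bar>F x\<bar>" using le[of x] by simp
        with big have "2 * c * K < 2 * c * \<bar>F x\<bar>" by simp
        then have "\<bar>F x\<bar> * \<bar>G y\<bar> \<le> A x + B y" using c elim by simp
        then have "2 * c * (\<bar>F x\<bar> * \<bar>G y\<bar>) \<le> 2 * c * (A x + B y)" using c by simp
        moreover have "\<bar>F' x\<bar> * \<bar>G y\<bar> \<le> (2 * c * \<bar>F x\<bar>) * \<bar>G y\<bar>" using le2 by (intro mult_right_mono) auto
        ultimately show "\<bar>F' x\<bar> * \<bar>G y\<bar> \<le> 2 * c * A x + 2 * c * B y" by (simp add: algebra_simps)
      qed
    qed
    show "(LINT x|lborel. 2 * c * A x) + (LINT x|lborel. 2 * c * B x) \<le> \<eta>"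
      using AB(6) c by (simp add: field_simps)
  qed (use AB c in auto)
qed

lemma young_pair_mult:
  assumes FG: "young_pair F G" and \<psi>: "\<psi> \<in> borel_measurable borel" "\<And>x. \<bar>\<psi> x\<bar> \<le> C"
  shows "young_pair (\<lambda>x. \<psi> x * F x) G"
proof (rule young_pair_affine[OF FG, of _ 0 "\<bar>C\<bar> + 1"])
  show "integrable lborel (\<lambda>x. \<psi> x * F x)"
    using FG \<psi> by (auto simp: young_pair_def intro!: integrable_mult_bounded(2))
  have "\<bar>\<psi> x\<bar> \<le> \<bar>C\<bar> + 1" for x using \<psi>(2)[of x] by linarith
  then show "\<bar>\<psi> x * F x\<bar> \<le> 0 + (\<bar>C\<bar> + 1) * \<bar>F x\<bar>" for x
    by (simp add: abs_mult mult_right_mono)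
qed simp

lemma young_pair_integrable:
  assumes "young_pair F G"
  shows "integrable lborel (\<lambda>x. F x * G x)"
proof -
  have FG: "integrable lborel F" "integrable lborel G" using assms by (auto simp: young_pair_def)
  then have [measurable]: "F \<in> borel_measurable borel" "G \<in> borel_measurable borel" by auto
  obtain K A B where AB: "integrable lborel A" "integrable lborel B" "\<And>x. 0 \<le> A x" "\<And>x. 0 \<le> B x"
    "AE x in lborel. \<bar>F x\<bar> > K \<longrightarrow> (\<forall>y. \<bar>F x\<bar> * \<bar>G y\<bar> \<le> A x + B y)"
    by (rule young_pairE[OF assms zero_less_one]) auto
  show ?thesis
  proof (rule Bochner_Integration.integrable_bound[of lborel "\<lambda>x. \<bar>K\<bar> * \<bar>G x\<bar> + A x + B x"])
    show "AE x in lborel. norm (F x * G x) \<le> norm (\<bar>K\<bar> * \<bar>G x\<bar> + A x + B x)"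
      using AB(5)
    proof eventually_elim
      case (elim x)
      have *: "0 \<le> \<bar>K\<bar> * \<bar>G x\<bar>" by simp
      show ?case
      proof (cases "\<bar>F x\<bar> > K")
        case True
        then have "\<bar>F x * G x\<bar> \<le> A x + B x" using elim by (simp add: abs_mult)
        then show ?thesis using * AB(3,4)[of x] unfolding real_norm_def by linarith
      next
        case False
        then have "\<bar>F x\<bar> * \<bar>G x\<bar> \<le> \<bar>K\<bar> * \<bar>G x\<bar>" by (intro mult_right_mono) auto
        then have "\<bar>F x * G x\<bar> \<le> \<bar>K\<bar> * \<bar>G x\<bar>" by (simp add: abs_mult)
        then show ?thesis using * AB(3,4)[of x] unfolding real_norm_def by linarith
      qed
    qed
  qed (use AB FG in auto)
qed

text \<open>Where \<open>F\<close> is bounded, \<open>L\<^sup>1\<close> convergence of the mollifications suffices. The rest of \<open>F\<close> contributes little to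
both sides, because mollification preserves the integral of \<open>B\<close>.\<close>

lemma young_pair_mollify:
  assumes "young_pair F G"
  shows "(\<lambda>n. LINT x|lborel. F x * mollify n G x) \<longlonglongrightarrow> (LINT x|lborel. F x * G x)"
proof (rule LIMSEQ_I)
  fix e :: real assume "e > 0"
  have FG: "integrable lborel F" "integrable lborel G" using assms by (auto simp: young_pair_def)
  then have [measurable]: "F \<in> borel_measurable borel" "G \<in> borel_measurable borel" by auto
  obtain K0 A B where AB0: "integrable lborel A" "integrable lborel B" "\<And>x. 0 \<le> A x" "\<And>x. 0 \<le> B x"
    "AE x in lborel. \<bar>F x\<bar> > K0 \<longrightarrow> (\<forall>y. \<bar>F x\<bar> * \<bar>G y\<bar> \<le> A x + B y)"
    "integral\<^sup>L lborel A + integral\<^sup>L lborel B \<le> e / 4"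
    by (rule young_pairE[OF assms, of "e / 4"]) (use \<open>e > 0\<close> in auto)
  define K where "K = \<bar>K0\<bar> + 1"
  have K: "K > 0" by (simp add: K_def)
  have big: "AE x in lborel. \<bar>F x\<bar> > K \<longrightarrow> (\<forall>y. \<bar>F x\<bar> * \<bar>G y\<bar> \<le> A x + B y)"
    using AB0(5) by eventually_elim (auto simp: K_def)
  define F1 where "F1 x = (if \<bar>F x\<bar> \<le> K then F x else 0)" for x
  define F2 where "F2 x = (if \<bar>F x\<bar> \<le> K then 0 else F x)" for x
  have [measurable]: "F1 \<in> borel_measurable borel" "F2 \<in> borel_measurable borel"
    unfolding F1_def F2_def by measurable
  have F1: "\<bar>F1 x\<bar> \<le> K" for x using K by (auto simp: F1_def)
  have F12: "F x = F1 x + F2 x" for x by (auto simp: F1_def F2_def)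
  have F2: "AE x in lborel. \<forall>y. \<bar>F2 x\<bar> * \<bar>G y\<bar> \<le> A x + B y"
    using big by eventually_elim (auto simp: F2_def AB0)
  have iB: "integrable lborel (mollify n B)" for n by (rule mollify_integrable) fact
  have F2n: "AE x in lborel. \<bar>F2 x * mollify n G x\<bar> \<le> A x + mollify n B x" for n
    using F2
  proof eventually_elim
    case (elim x)
    have "\<bar>F2 x * mollify n G x\<bar> = \<bar>LINT y|lborel. F2 x * (G y * mollifier n (x - y))\<bar>"
      by (simp add: mollify_def)
    also have "\<dots> \<le> (LINT y|lborel. A x * mollifier n (x - y) + B y * mollifier n (x - y))"
    proof (rule order_trans[OF integral_abs_bound])
      show "(LINT y|lborel. \<bar>F2 x * (G y * mollifier n (x - y))\<bar>) \<le>
         (LINT y|lborel. A x * mollifier n (x - y) + B y * mollifier n (x - y))"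
      proof (rule integral_mono)
        fix y
        have "\<bar>F2 x\<bar> * \<bar>G y\<bar> * mollifier n (x - y) \<le> (A x + B y) * mollifier n (x - y)"
          using elim by (intro mult_right_mono mollifier_nonneg) auto
        then show "\<bar>F2 x * (G y * mollifier n (x - y))\<bar> \<le> A x * mollifier n (x - y) + B y * mollifier n (x - y)"
          by (simp add: abs_mult mollifier_nonneg algebra_simps)
      qed (intro Bochner_Integration.integrable_add integrable_mult_right integrable_abs
            mollify_integrand_integrable[OF FG(2)] mollify_integrand_integrable[OF AB0(2)]
            integrable_mollifier_reflect)+
    qed
    also have "\<dots> = A x + mollify n B x"
      using mollify_integrand_integrable[OF AB0(2), of n x] integrable_mollifier_reflect[of n x]
      by (simp add: mollify_def mollifier_reflect_integral)
    finally show ?case .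
  qed
  have intF2n: "integrable lborel (\<lambda>x. F2 x * mollify n G x)" for n
    by (rule Bochner_Integration.integrable_bound[of lborel "\<lambda>x. A x + mollify n B x"])
       (use F2n[of n] AB0(1) iB[of n] in \<open>auto elim!: eventually_mono\<close>)
  have bF2n: "\<bar>LINT x|lborel. F2 x * mollify n G x\<bar> \<le> e / 4" for n
  proof -
    have "\<bar>LINT x|lborel. F2 x * mollify n G x\<bar> \<le> (LINT x|lborel. A x + mollify n B x)"
      using F2n[of n] AB0(1) iB[of n] intF2n[of n]
      by (intro order_trans[OF integral_abs_bound] integral_mono_AE) auto
    then show ?thesis using AB0(1,6) iB[of n] mollify_integral[OF AB0(2), of n] by simp
  qed
  have intF2: "integrable lborel (\<lambda>x. F2 x * G x)"
    by (rule Bochner_Integration.integrable_bound[of lborel "\<lambda>x. A x + B x"])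
       (use F2 AB0 in \<open>auto elim!: eventually_mono simp: abs_mult\<close>)
  have bF2: "\<bar>LINT x|lborel. F2 x * G x\<bar> \<le> e / 4"
  proof -
    have "AE x in lborel. \<bar>F2 x * G x\<bar> \<le> A x + B x"
      using F2 by eventually_elim (simp add: abs_mult)
    then have "\<bar>LINT x|lborel. F2 x * G x\<bar> \<le> (LINT x|lborel. A x + B x)"
      using AB0(1,2) intF2
      by (intro order_trans[OF integral_abs_bound] integral_mono_AE integrable_abs) auto
    then show ?thesis using AB0 by simp
  qed
  have intF1n: "integrable lborel (\<lambda>x. F1 x * mollify n G x)" for n
    by (rule integrable_mult_bounded(2)[OF mollify_integrable[OF FG(2)] _ F1]) simp
  have intF1: "integrable lborel (\<lambda>x. F1 x * G x)"
    by (rule integrable_mult_bounded(2)[OF FG(2) _ F1]) simp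
  obtain N where N: "\<And>n. n \<ge> N \<Longrightarrow> (LINT x|lborel. \<bar>mollify n G x - G x\<bar>) < e / (4 * K)"
    using LIMSEQ_D[OF mollify_L1[OF FG(2)], of "e / (4 * K)"] \<open>e > 0\<close> K
    by (auto simp: abs_less_iff)
  have bF1: "\<bar>(LINT x|lborel. F1 x * mollify n G x) - (LINT x|lborel. F1 x * G x)\<bar> < e / 4" if "n \<ge> N" for n
  proof -
    have "\<bar>(LINT x|lborel. F1 x * mollify n G x) - (LINT x|lborel. F1 x * G x)\<bar>
       = \<bar>LINT x|lborel. F1 x * (mollify n G x - G x)\<bar>"
      using intF1 intF1n[of n] by (simp add: right_diff_distrib)
    also have "\<dots> \<le> (LINT x|lborel. K * \<bar>mollify n G x - G x\<bar>)"
    proof (rule order_trans[OF integral_abs_bound])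
      have "integrable lborel (\<lambda>x. F1 x * (mollify n G x - G x))"
        using intF1 intF1n[of n] by (simp add: right_diff_distrib)
      then show "(LINT x|lborel. \<bar>F1 x * (mollify n G x - G x)\<bar>) \<le> (LINT x|lborel. K * \<bar>mollify n G x - G x\<bar>)"
        using mollify_integrable[OF FG(2), of n] FG(2) F1
        by (intro integral_mono integrable_abs) (auto simp: abs_mult intro!: mult_right_mono)
    qed
    also have "\<dots> = K * (LINT x|lborel. \<bar>mollify n G x - G x\<bar>)" by simp
    also have "\<dots> < K * (e / (4 * K))" by (rule mult_strict_left_mono[OF N[OF that] K])
    also have "\<dots> = e / 4" using K by simp
    finally show ?thesis .
  qed
  have "norm ((LINT x|lborel. F x * mollify n G x) - (LINT x|lborel. F x * G x)) < e" if "n \<ge> N" for n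
  proof -
    have "(LINT x|lborel. F x * mollify n G x) = (LINT x|lborel. F1 x * mollify n G x) + (LINT x|lborel. F2 x * mollify n G x)"
      using intF1n[of n] intF2n[of n] by (simp add: F12 distrib_right)
    moreover have "(LINT x|lborel. F x * G x) = (LINT x|lborel. F1 x * G x) + (LINT x|lborel. F2 x * G x)"
      using intF1 intF2 by (simp add: F12 distrib_right)
    ultimately show ?thesis
      using bF1[OF that] bF2n[of n] bF2 \<open>e > 0\<close> unfolding real_norm_def by argo
  qed
  then show "\<exists>N. \<forall>n\<ge>N. norm ((LINT x|lborel. F x * mollify n G x) - (LINT x|lborel. F x * G x)) < e" by blast
qed

lemma young_pair_bounded:
  assumes "integrable lborel F" "integrable lborel G" "AE x in lborel. \<bar>F x\<bar> \<le> C"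
  shows "young_pair F G"
  unfolding young_pair_def
proof (intro conjI allI impI)
  fix \<eta> :: real assume "\<eta> > 0"
  show "\<exists>K A B. integrable lborel A \<and> integrable lborel B \<and> (\<forall>x. 0 \<le> A x) \<and> (\<forall>x. 0 \<le> B x) \<and>
      (AE x in lborel. \<bar>F x\<bar> > K \<longrightarrow> (\<forall>y. \<bar>F x\<bar> * \<bar>G y\<bar> \<le> A x + B y)) \<and>
      integral\<^sup>L lborel A + integral\<^sup>L lborel B \<le> \<eta>"
    using assms(3) \<open>\<eta> > 0\<close>
    by (intro exI[of _ C] exI[of _ "\<lambda>x. 0"]) (auto elim!: eventually_mono)
qed (use assms in auto)

text \<open>Young's inequality is applied to \<open>|F x| / t\<close> and \<open>t |G y|\<close>. First \<open>t\<close> is chosen such that \<open>G\<close> contributes little,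
then the truncation level such that \<open>F\<close> does.\<close>

lemma young_pair_powr:
  assumes F: "integrable lborel F" and G: "integrable lborel G"
    and r: "r > 1" "s > 1" "1 / r + 1 / s = (1::real)"
    and Fr: "integrable lborel (\<lambda>x. \<bar>F x\<bar> powr r)" and Gs: "integrable lborel (\<lambda>x. \<bar>G x\<bar> powr s)"
  shows "young_pair F G"
  unfolding young_pair_def
proof (intro conjI allI impI F G)
  fix \<eta> :: real assume \<eta>: "\<eta> > 0"
  have [measurable]: "F \<in> borel_measurable borel" using F by auto
  define c where "c = integral\<^sup>L lborel (\<lambda>x. \<bar>G x\<bar> powr s) + 1"
  have c: "c > 0" "integral\<^sup>L lborel (\<lambda>x. \<bar>G x\<bar> powr s) \<le> c"
    unfolding c_def by (simp_all add: add_nonneg_pos integral_nonneg_AE)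
  \<comment> \<open>The scaling t makes the contribution of G at most half of the tolerance.\<close>
  define t where "t = (\<eta> / (2 * c)) powr (1 / s)"
  have t: "t > 0" "t powr s = \<eta> / (2 * c)" using \<eta> c r by (auto simp: t_def powr_powr)
  let ?A = "\<lambda>K x. (if \<bar>F x\<bar> > K then \<bar>F x\<bar> powr r else 0) * (1 / t) powr r"
  let ?B = "\<lambda>y. \<bar>G y\<bar> powr s * t powr s"
  have "(\<lambda>K. LINT x|lborel. ?A (real K) x) \<longlonglongrightarrow> (LINT x|(lborel::'a measure). 0 * (1 / t) powr r)"
  proof (rule integral_dominated_convergence[where w = "\<lambda>x. \<bar>F x\<bar> powr r * (1 / t) powr r"
        and f = "\<lambda>x. 0 * (1 / t) powr r" and s = "\<lambda>K. ?A (real K)"])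
    show "AE x in lborel. (\<lambda>K. ?A (real K) x) \<longlonglongrightarrow> 0 * (1 / t) powr r"
    proof (rule AE_I2)
      fix x
      obtain N where "\<bar>F x\<bar> \<le> real N" using real_arch_simple by blast
      then have "\<forall>\<^sub>F K in sequentially. 0 * (1 / t) powr r = ?A (real K) x"
        by (intro eventually_mono[OF eventually_ge_at_top[of N]]) (use \<open>\<bar>F x\<bar> \<le> real N\<close> in auto)
      then show "(\<lambda>K. ?A (real K) x) \<longlonglongrightarrow> 0 * (1 / t) powr r"
        by (rule Lim_transform_eventually[OF tendsto_const])
    qed
  qed (use Fr in auto)
  then have "(\<lambda>K. LINT x|lborel. ?A (real K) x) \<longlonglongrightarrow> 0" by simp
  from LIMSEQ_D[OF this, of "\<eta> / 2"] \<eta> obtain K where K: "\<bar>LINT x|lborel. ?A (real K) x\<bar> < \<eta> / 2" by auto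
  show "\<exists>K A B. integrable lborel A \<and> integrable lborel B \<and> (\<forall>x. 0 \<le> A x) \<and> (\<forall>x. 0 \<le> B x) \<and>
      (AE x in lborel. \<bar>F x\<bar> > K \<longrightarrow> (\<forall>y. \<bar>F x\<bar> * \<bar>G y\<bar> \<le> A x + B y)) \<and>
      integral\<^sup>L lborel A + integral\<^sup>L lborel B \<le> \<eta>"
  proof (rule exI[of _ "real K"], rule exI[of _ "?A (real K)"], rule exI[of _ ?B], intro conjI allI)
    show "integrable lborel (?A (real K))"
      by (rule Bochner_Integration.integrable_bound[of lborel "\<lambda>x. \<bar>F x\<bar> powr r * (1 / t) powr r"]) (use Fr in auto)
    show "AE x in lborel. \<bar>F x\<bar> > real K \<longrightarrow> (\<forall>y. \<bar>F x\<bar> * \<bar>G y\<bar> \<le> ?A (real K) x + ?B y)"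
    proof (intro AE_I2 impI allI)
      fix x y assume "\<bar>F x\<bar> > real K"
      have "\<bar>F x\<bar> * \<bar>G y\<bar> = (\<bar>F x\<bar> * (1 / t)) * (\<bar>G y\<bar> * t)" using t by simp
      also have "\<dots> \<le> (\<bar>F x\<bar> * (1 / t)) powr r / r + (\<bar>G y\<bar> * t) powr s / s"
        using t r by (intro Youngs_inequality) auto
      also have "\<dots> \<le> (\<bar>F x\<bar> * (1 / t)) powr r + (\<bar>G y\<bar> * t) powr s"
        using r by (intro add_mono) (auto simp: divide_le_eq mult_le_cancel_left1)
      also have "\<dots> = ?A (real K) x + ?B y"
        using t \<open>\<bar>F x\<bar> > real K\<close> powr_mult[of "\<bar>F x\<bar>" "1 / t" r] powr_mult[of "\<bar>G y\<bar>" t s] by simp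
      finally show "\<bar>F x\<bar> * \<bar>G y\<bar> \<le> ?A (real K) x + ?B y" .
    qed
    have "integral\<^sup>L lborel ?B = integral\<^sup>L lborel (\<lambda>x. \<bar>G x\<bar> powr s) * (\<eta> / (2 * c))" using t by simp
    also have "\<dots> \<le> c * (\<eta> / (2 * c))" using c \<eta> by (intro mult_right_mono) auto
    also have "\<dots> = \<eta> / 2" using c by simp
    finally show "integral\<^sup>L lborel (?A (real K)) + integral\<^sup>L lborel ?B \<le> \<eta>" using K by linarith
  qed (use Gs in auto)
qed

section \<open>Weak derivatives that are measures with a density\<close>

text \<open>The distributional derivative of \<open>u\<close> in direction \<open>v\<close> on \<open>\<Omega>\<close> is the signed measure with density \<open>f\<close> with
respect to \<open>M\<close>. Taking for \<open>M\<close> Lebesgue measure gives Sobolev derivatives; a measure that dominates several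
derivative measures allows them to be compared.\<close>

definition weak_deriv ::
  "'a::euclidean_space set \<Rightarrow> 'a measure \<Rightarrow> ('a \<Rightarrow> real) \<Rightarrow> 'a \<Rightarrow> ('a \<Rightarrow> real) \<Rightarrow> bool" where
  "weak_deriv \<Omega> M u v f \<longleftrightarrow> integrable M f \<and>
     (\<forall>\<phi>\<in>test_functions \<Omega>. (LINT x|lborel. u x * dir_deriv v \<phi> x) = - (LINT x|M. \<phi> x * f x))"

lemma smooth_line_derivative:
  assumes "smooth \<phi>"
  shows "((\<lambda>t. \<phi> (x + t *\<^sub>R v)) has_real_derivative dir_deriv v \<phi> (x + t *\<^sub>R v)) (at t)"
proof -
  have "((\<lambda>t. \<phi> (x + t *\<^sub>R v)) has_derivative (\<lambda>s. dir_deriv (s *\<^sub>R v) \<phi> (x + t *\<^sub>R v))) (at t)"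
    by (rule has_derivative_compose[of "\<lambda>t. x + t *\<^sub>R v" "\<lambda>s. s *\<^sub>R v", OF _ smooth_has_derivative[OF assms]])
       (auto intro!: derivative_eq_intros)
  moreover have "(\<lambda>s. dir_deriv (s *\<^sub>R v) \<phi> (x + t *\<^sub>R v)) = (\<lambda>s. dir_deriv v \<phi> (x + t *\<^sub>R v) * s)"
    using assms by (auto simp: fun_eq_iff dir_deriv_eq_sum_Basis smooth_differentiable sum_distrib_right
        intro!: sum.cong)
  ultimately show ?thesis by (simp add: has_field_derivative_def)
qed

lemma line_derivative_shift:
  fixes w :: "'a::real_normed_vector \<Rightarrow> real"
  assumes "((\<lambda>t. w ((x + s *\<^sub>R v) + t *\<^sub>R v)) has_real_derivative D) (at 0)"
  shows "((\<lambda>t. w (x + t *\<^sub>R v)) has_real_derivative D) (at s)"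
proof -
  have "((\<lambda>t. w ((x + s *\<^sub>R v) + (t - s) *\<^sub>R v)) has_real_derivative D) (at s)"
    using assms DERIV_at_within_shift[of "\<lambda>t. w ((x + s *\<^sub>R v) + t *\<^sub>R v)" D "-s" s UNIV]
    by (simp add: DERIV_shift[of _ D s "-s", simplified])
  moreover have "(x + s *\<^sub>R v) + (t - s) *\<^sub>R v = x + t *\<^sub>R v" for t by (simp add: algebra_simps)
  ultimately show ?thesis by simp
qed

lemma line_difference_bound:
  fixes w :: "'a::real_normed_vector \<Rightarrow> real"
  assumes "\<And>x. ((\<lambda>t. w (x + t *\<^sub>R v)) has_real_derivative w' x) (at 0)" "\<And>x. \<bar>w' x\<bar> \<le> C"
  shows "\<bar>w (x + t *\<^sub>R v) - w x\<bar> \<le> C * \<bar>t\<bar>"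
proof -
  have "norm (w (x + t *\<^sub>R v) - w (x + 0 *\<^sub>R v)) \<le> C * norm (t - 0)"
  proof (rule field_differentiable_bound[of UNIV "\<lambda>t. w (x + t *\<^sub>R v)" "\<lambda>t. w' (x + t *\<^sub>R v)"])
    show "((\<lambda>t. w (x + t *\<^sub>R v)) has_field_derivative w' (x + s *\<^sub>R v)) (at s within UNIV)" for s
      using line_derivative_shift[OF assms(1)] by simp
  qed (use assms(2) in auto)
  then show ?thesis by simp
qed

lemma test_function_lipschitz:
  fixes \<phi> :: "'a::euclidean_space \<Rightarrow> real"
  assumes "\<phi> \<in> test_functions \<Omega>"
  obtains C where "C > 0" "\<And>x y. \<bar>\<phi> x - \<phi> y\<bar> \<le> C * norm (x - y)"
proof -
  have "\<exists>C. \<forall>x. \<bar>dir_deriv b \<phi> x\<bar> \<le> C" for b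
    using test_functions_bounded[OF test_functions_dir_deriv[OF assms, of b]] by metis
  then obtain C where C: "\<And>b x. \<bar>dir_deriv b \<phi> x\<bar> \<le> C b" by metis
  have C0: "0 \<le> C b" for b using order_trans[OF abs_ge_zero C] by blast
  let ?C = "\<Sum>b\<in>Basis. C b"
  have sm: "smooth \<phi>" by (rule test_functions_smooth) fact
  have "\<bar>\<phi> x - \<phi> y\<bar> \<le> ?C * norm (x - y)" for x y
  proof -
    have "norm (\<phi> x - \<phi> y) \<le> ?C * norm (x - y)"
    proof (rule differentiable_bound[of UNIV _ "\<lambda>x v. dir_deriv v \<phi> x"])
      show "(\<phi> has_derivative (\<lambda>v. dir_deriv v \<phi> x)) (at x within UNIV)" for x
        using smooth_has_derivative[OF sm] by simp
      show "onorm (\<lambda>v. dir_deriv v \<phi> x) \<le> ?C" for x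
      proof (rule onorm_bound)
        fix v
        have "\<bar>dir_deriv v \<phi> x\<bar> \<le> (\<Sum>b\<in>Basis. \<bar>(v \<bullet> b) * dir_deriv b \<phi> x\<bar>)"
          unfolding dir_deriv_eq_sum_Basis[OF smooth_differentiable[OF sm], of v x] by (rule sum_abs)
        also have "\<dots> \<le> (\<Sum>b\<in>Basis. norm v * C b)"
          using C by (auto simp: abs_mult intro!: sum_mono mult_mono Basis_le_norm)
        finally show "norm (dir_deriv v \<phi> x) \<le> ?C * norm v"
          by (simp add: sum_distrib_left mult.commute)
      qed (auto intro: sum_nonneg C0)
    qed auto
    then show ?thesis by simp
  qed
  then have "\<bar>\<phi> x - \<phi> y\<bar> \<le> (?C + 1) * norm (x - y)" for x y
    by (smt (verit) mult_right_mono norm_ge_zero)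
  moreover have "?C + 1 > 0" by (simp add: add_nonneg_pos sum_nonneg C0)
  ultimately show thesis by (intro that)
qed

lemma mollifier_inside_test:
  fixes \<Omega> :: "'a::euclidean_space set"
  assumes "compact K" "K \<subseteq> \<Omega>" "open \<Omega>"
  obtains N where "\<And>n x. n \<ge> N \<Longrightarrow> x \<in> K \<Longrightarrow> (\<lambda>y. mollifier n (x - y)) \<in> test_functions \<Omega>"
proof -
  obtain e where e: "e > 0" "(\<Union>x\<in>K. cball x e) \<subseteq> \<Omega>"
    using compact_subset_open_imp_cball_epsilon_subset[OF assms(1,3,2)] by blast
  obtain N where N: "DIM('a) / e < real N" using reals_Archimedean2 by blast
  have "(\<lambda>y. mollifier n (x - y)) \<in> test_functions \<Omega>" if "n \<ge> N" "x \<in> K" for n x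
  proof (rule test_functionsI[OF smooth_reflect[OF smooth_mollifier] compact_cball[of x e]])
    show "cball x e \<subseteq> \<Omega>" using e that by auto
    fix y assume "y \<notin> cball x e"
    moreover have "DIM('a) / e < real (Suc n)" using N that by linarith
    then have "DIM('a) / Suc n < e" using e by (simp add: field_simps)
    ultimately show "mollifier n (x - y) = 0"
      by (intro mollifier_eq_0) (simp add: dist_norm)
  qed
  then show thesis by (rule that)
qed

text \<open>A difference quotient can be shifted from one factor to the other by translation invariance; dominated
convergence then replaces the quotients by derivatives.\<close>

lemma integration_by_parts:
  fixes \<phi> :: "'a::euclidean_space \<Rightarrow> real"
  assumes \<phi>: "\<phi> \<in> test_functions \<Omega>"
    and [measurable]: "w \<in> borel_measurable borel" "w' \<in> borel_measurable borel"
    and w: "\<And>x. ((\<lambda>t. w (x + t *\<^sub>R v)) has_real_derivative w' x) (at 0)"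
    and bds: "\<And>x. \<bar>w x\<bar> \<le> B" "\<And>x. \<bar>w' x\<bar> \<le> C"
  shows "(LINT x|lborel. w x * dir_deriv v \<phi> x) = - (LINT x|lborel. w' x * \<phi> x)"
proof -
  obtain K where K: "smooth \<phi>" "compact K" "\<And>x. x \<notin> K \<Longrightarrow> \<phi> x = 0"
    using \<phi> by (auto elim: test_functionsE)
  have [measurable]: "\<phi> \<in> borel_measurable borel" "dir_deriv v \<phi> \<in> borel_measurable borel"
    using smooth_measurable[OF K(1)] smooth_measurable[OF smooth_dir_deriv[OF K(1)]] by auto
  obtain C' where C': "C' > 0" "\<And>x. \<bar>dir_deriv v \<phi> x\<bar> \<le> C'"
    using test_functions_bounded[OF test_functions_dir_deriv[OF \<phi>]] by metis
  have \<phi>_line: "((\<lambda>t. \<phi> (x + t *\<^sub>R v)) has_real_derivative dir_deriv v \<phi> x) (at 0)" for x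
    using smooth_line_derivative[OF K(1), of x v 0] by simp
  have \<phi>int: "integrable lborel \<phi>" by (rule test_function_integrable) fact
  define t where "t n = inverse (real (Suc n))" for n
  have t: "t \<longlonglongrightarrow> 0" "t n \<noteq> 0" "\<bar>t n\<bar> \<le> 1" "t n > 0" for n
    unfolding t_def using LIMSEQ_inverse_real_of_nat by (auto simp: field_simps)
  have quot: "(\<lambda>n. (g (x + t n *\<^sub>R v) - g x) / t n) \<longlonglongrightarrow> g' x"
    if "\<And>x. ((\<lambda>t. g (x + t *\<^sub>R v)) has_real_derivative g' x) (at 0)" for g g' :: "'a \<Rightarrow> real" and x
  proof -
    have "((\<lambda>h. (g (x + h *\<^sub>R v) - g x) / h) \<longlongrightarrow> g' x) (at 0)"
      using that[of x] by (simp add: DERIV_def)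
    then show ?thesis
      unfolding tendsto_at_iff_sequentially using t by (auto simp: o_def)
  qed
  obtain R where R: "R > 0" "\<And>x. x \<in> K \<Longrightarrow> norm x \<le> R"
    using compact_imp_bounded[OF K(2)] by (auto simp: bounded_pos)
  define Q where "Q = cball (0::'a) (R + norm v)"
  have Qint: "integrable lborel (indicat_real Q)"
    unfolding Q_def using emeasure_bounded_finite[OF bounded_cball] by (intro integrable_real_indicator) auto
  have dq: "\<bar>(\<phi> (x + s *\<^sub>R v) - \<phi> x) / s\<bar> \<le> C'" if "s \<noteq> 0" for x s
    using line_difference_bound[of \<phi> v "dir_deriv v \<phi>" C' x s, OF \<phi>_line C'(2)] that
    by (simp add: field_simps)
  have supp: "(\<phi> (x + t n *\<^sub>R v) - \<phi> x) / t n = 0" if "x \<notin> Q" for x n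
  proof -
    have nx: "norm x > R + norm v" using that by (simp add: Q_def)
    have "norm (t n *\<^sub>R v) \<le> norm v" using t(3)[of n] by (simp add: mult_left_le_one_le)
    with nx have "norm (x + t n *\<^sub>R v) > R" using norm_diff_ineq[of x "t n *\<^sub>R v"] by linarith
    moreover have "norm x > R" using nx norm_ge_zero[of v] by linarith
    ultimately show ?thesis using K(3) R(2) by (metis diff_self div_0 not_less)
  qed
  have lim1: "(\<lambda>n. LINT x|lborel. w x * ((\<phi> (x + t n *\<^sub>R v) - \<phi> x) / t n)) \<longlonglongrightarrow> (LINT x|lborel. w x * dir_deriv v \<phi> x)"
  proof (rule integral_dominated_convergence[where w = "\<lambda>x. (B * C') * indicat_real Q x"])
    show "AE x in lborel. (\<lambda>n. w x * ((\<phi> (x + t n *\<^sub>R v) - \<phi> x) / t n)) \<longlonglongrightarrow> w x * dir_deriv v \<phi> x"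
      by (intro AE_I2 tendsto_intros quot \<phi>_line)
    show "AE x in lborel. norm (w x * ((\<phi> (x + t n *\<^sub>R v) - \<phi> x) / t n)) \<le> (B * C') * indicat_real Q x" for n
    proof (rule AE_I2)
      fix x :: 'a
      have "B \<ge> 0" using order_trans[OF abs_ge_zero bds(1)] by blast
      show "norm (w x * ((\<phi> (x + t n *\<^sub>R v) - \<phi> x) / t n)) \<le> (B * C') * indicat_real Q x"
      proof (cases "x \<in> Q")
        case True
        have "\<bar>w x\<bar> * \<bar>(\<phi> (x + t n *\<^sub>R v) - \<phi> x) / t n\<bar> \<le> B * C'"
          using bds(1) dq[OF t(2)] \<open>B \<ge> 0\<close> by (intro mult_mono) auto
        then show ?thesis using True by (simp add: abs_mult)
      qed (simp add: supp)
    qed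
  qed (use Qint in auto)
  have eq: "(LINT x|lborel. w x * ((\<phi> (x + t n *\<^sub>R v) - \<phi> x) / t n))
      = (LINT x|lborel. - (\<phi> x * ((w (x + (- t n) *\<^sub>R v) - w x) / (- t n))))" for n
  proof -
    have sh: "integrable lborel (\<lambda>x. w x * \<phi> (x + t n *\<^sub>R v))" "integrable lborel (\<lambda>x. w x * \<phi> x)"
      using lborel_integrable_shift[OF \<phi>int, of "- (t n *\<^sub>R v)"] \<phi>int bds(1)
      by (auto intro!: integrable_mult_bounded(2))
    have sh2: "integrable lborel (\<lambda>x. w (x - t n *\<^sub>R v) * \<phi> x)"
      using \<phi>int bds(1) by (auto intro!: integrable_mult_bounded(2))
    have "(LINT x|lborel. w x * \<phi> (x + t n *\<^sub>R v)) = (LINT x|lborel. w (x - t n *\<^sub>R v) * \<phi> (x - t n *\<^sub>R v + t n *\<^sub>R v))"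
      by (rule lborel_integral_shift[where f = "\<lambda>x. w x * \<phi> (x + t n *\<^sub>R v)", symmetric]) simp
    then have "(LINT x|lborel. w x * \<phi> (x + t n *\<^sub>R v) - w x * \<phi> x) = (LINT x|lborel. w (x - t n *\<^sub>R v) * \<phi> x - w x * \<phi> x)"
      using sh sh2 by simp
    then have "(LINT x|lborel. (w x * \<phi> (x + t n *\<^sub>R v) - w x * \<phi> x) / t n)
      = (LINT x|lborel. (w (x - t n *\<^sub>R v) * \<phi> x - w x * \<phi> x) / t n)"
      by (simp add: integral_divide_zero)
    then show ?thesis
      by (simp add: algebra_simps diff_divide_distrib)
  qed
  have neg: "(\<lambda>n. (w (x + (- t n) *\<^sub>R v) - w x) / (- t n)) \<longlonglongrightarrow> w' x" for x
  proof -
    have "((\<lambda>h. (w (x + h *\<^sub>R v) - w x) / h) \<longlongrightarrow> w' x) (at 0)"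
      using w[of x] by (simp add: DERIV_def)
    moreover have "(\<lambda>n. - t n) \<longlonglongrightarrow> 0" using tendsto_minus[OF t(1)] by simp
    ultimately have "((\<lambda>h. (w (x + h *\<^sub>R v) - w x) / h) \<circ> (\<lambda>n. - t n)) \<longlonglongrightarrow> w' x"
      unfolding tendsto_at_iff_sequentially using t(2) by force
    then show ?thesis unfolding o_def .
  qed
  have "(\<lambda>n. LINT x|lborel. - (\<phi> x * ((w (x + (- t n) *\<^sub>R v) - w x) / (- t n)))) \<longlonglongrightarrow> (LINT x|lborel. - (\<phi> x * w' x))"
  proof (rule integral_dominated_convergence[where w = "\<lambda>x. C * \<bar>\<phi> x\<bar>"])
    show "AE x in lborel. (\<lambda>n. - (\<phi> x * ((w (x + (- t n) *\<^sub>R v) - w x) / (- t n)))) \<longlonglongrightarrow> - (\<phi> x * w' x)"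
      by (intro AE_I2 tendsto_minus tendsto_mult tendsto_const neg)
    show "AE x in lborel. norm (- (\<phi> x * ((w (x + (- t n) *\<^sub>R v) - w x) / (- t n)))) \<le> C * \<bar>\<phi> x\<bar>" for n
    proof (rule AE_I2)
      fix x
      have "\<bar>(w (x + (- t n) *\<^sub>R v) - w x) / (- t n)\<bar> \<le> C"
        using line_difference_bound[of w v w' C x "- t n", OF w bds(2)] t(4)[of n] by (simp add: field_simps)
      then have "\<bar>\<phi> x\<bar> * \<bar>(w (x + (- t n) *\<^sub>R v) - w x) / (- t n)\<bar> \<le> \<bar>\<phi> x\<bar> * C" by (intro mult_left_mono) auto
      then show "norm (- (\<phi> x * ((w (x + (- t n) *\<^sub>R v) - w x) / (- t n)))) \<le> C * \<bar>\<phi> x\<bar>"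
        unfolding real_norm_def abs_minus_cancel abs_mult by (simp only: mult.commute)
    qed
  qed (use \<phi>int in auto)
  with lim1 have "(LINT x|lborel. w x * dir_deriv v \<phi> x) = (LINT x|lborel. - (\<phi> x * w' x))"
    unfolding eq by (rule LIMSEQ_unique)
  then show ?thesis by (simp add: mult.commute)
qed

text \<open>The derivative of the mollification, taken under the integral sign.\<close>

definition mollify_deriv :: "nat \<Rightarrow> 'a::euclidean_space \<Rightarrow> ('a \<Rightarrow> real) \<Rightarrow> 'a \<Rightarrow> real" where
  "mollify_deriv n v g x = (LINT y|lborel. g y * dir_deriv v (mollifier n) (x - y))"

lemma dir_deriv_mollifier_measurable [measurable]: "dir_deriv v (mollifier n) \<in> borel_measurable borel"
  by (simp add: smooth_dir_deriv smooth_mollifier)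

lemma mollify_deriv_measurable [measurable]:
  assumes [measurable]: "g \<in> borel_measurable borel"
  shows "mollify_deriv n v g \<in> borel_measurable borel"
  unfolding mollify_deriv_def by measurable

lemma kernel_integral_bound:
  fixes g :: "'a \<Rightarrow> real"
  assumes "integrable M g" "k \<in> borel_measurable M" "\<And>x. \<bar>k x\<bar> \<le> C"
  shows "\<bar>LINT x|M. g x * k x\<bar> \<le> C * (LINT x|M. \<bar>g x\<bar>)"
proof -
  have "\<bar>LINT x|M. g x * k x\<bar> \<le> (LINT x|M. \<bar>g x\<bar> * C)"
    using assms
    by (intro order_trans[OF integral_abs_bound] integral_mono integrable_abs integrable_mult_bounded(1)[OF assms])
       (auto simp: abs_mult intro!: mult_left_mono)
  then show ?thesis by (simp add: mult.commute)
qed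

lemma mollify_line_derivative:
  fixes g :: "'a::euclidean_space \<Rightarrow> real"
  assumes g: "integrable lborel g"
  shows "((\<lambda>t. mollify n g (x + t *\<^sub>R v)) has_real_derivative mollify_deriv n v g x) (at 0)"
proof -
  have [measurable]: "g \<in> borel_measurable borel" using g by auto
  obtain C where C: "C > 0" "\<And>x::'a. \<bar>dir_deriv v (mollifier n) x\<bar> \<le> C"
    using test_functions_bounded[OF test_functions_dir_deriv[OF mollifier_test_function]] by metis
  have line: "((\<lambda>t. mollifier n (x + t *\<^sub>R v)) has_real_derivative dir_deriv v (mollifier n) x) (at 0)" for x
    using smooth_line_derivative[OF smooth_mollifier, of n x v 0] by simp
  have "((\<lambda>h. (mollify n g (x + h *\<^sub>R v) - mollify n g x) / h) \<longlongrightarrow> mollify_deriv n v g x) (at 0)"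
    unfolding tendsto_at_iff_sequentially o_def
  proof (intro allI impI)
    fix X :: "nat \<Rightarrow> real" assume X: "\<forall>i. X i \<in> UNIV - {0}" "X \<longlonglongrightarrow> 0"
    have "(\<lambda>i. LINT y|lborel. g y * ((mollifier n ((x - y) + X i *\<^sub>R v) - mollifier n (x - y)) / X i)) \<longlonglongrightarrow>
        mollify_deriv n v g x"
      unfolding mollify_deriv_def
    proof (rule integral_dominated_convergence[where w = "\<lambda>y. C * \<bar>g y\<bar>"])
      show "AE y in lborel. (\<lambda>i. g y * ((mollifier n ((x - y) + X i *\<^sub>R v) - mollifier n (x - y)) / X i))
          \<longlonglongrightarrow> g y * dir_deriv v (mollifier n) (x - y)"
      proof (intro AE_I2 tendsto_intros)
        fix y
        have "((\<lambda>h. (mollifier n ((x - y) + h *\<^sub>R v) - mollifier n (x - y)) / h) \<longlongrightarrow> dir_deriv v (mollifier n) (x - y)) (at 0)"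
          using line[of "x - y"] by (simp add: DERIV_def)
        then show "(\<lambda>i. (mollifier n ((x - y) + X i *\<^sub>R v) - mollifier n (x - y)) / X i) \<longlonglongrightarrow> dir_deriv v (mollifier n) (x - y)"
          unfolding tendsto_at_iff_sequentially using X by (auto simp: o_def)
      qed
      show "AE y in lborel. norm (g y * ((mollifier n ((x - y) + X i *\<^sub>R v) - mollifier n (x - y)) / X i)) \<le> C * \<bar>g y\<bar>" for i
      proof (rule AE_I2)
        fix y
        have "X i \<noteq> 0" using X by auto
        then have "\<bar>(mollifier n ((x - y) + X i *\<^sub>R v) - mollifier n (x - y)) / X i\<bar> \<le> C"
          using line_difference_bound[of "mollifier n" v _ C "x - y" "X i", OF line C(2)] by (simp add: field_simps)
        then have "\<bar>g y\<bar> * \<bar>(mollifier n ((x - y) + X i *\<^sub>R v) - mollifier n (x - y)) / X i\<bar> \<le> \<bar>g y\<bar> * C"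
          by (intro mult_left_mono) auto
        then show "norm (g y * ((mollifier n ((x - y) + X i *\<^sub>R v) - mollifier n (x - y)) / X i)) \<le> C * \<bar>g y\<bar>"
          unfolding real_norm_def abs_mult by (simp only: mult.commute)
      qed
    qed (use g in auto)
    moreover have "(LINT y|lborel. g y * ((mollifier n ((x - y) + X i *\<^sub>R v) - mollifier n (x - y)) / X i))
        = (mollify n g (x + X i *\<^sub>R v) - mollify n g x) / X i" for i
    proof -
      have "(mollify n g (x + X i *\<^sub>R v) - mollify n g x) / X i =
        (LINT y|lborel. (g y * mollifier n (x + X i *\<^sub>R v - y) - g y * mollifier n (x - y)) / X i)"
        using mollify_integrand_integrable[OF g] by (simp add: mollify_def integral_divide_zero)
      also have "\<dots> = (LINT y|lborel. g y * ((mollifier n ((x - y) + X i *\<^sub>R v) - mollifier n (x - y)) / X i))"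
        by (intro Bochner_Integration.integral_cong refl) (simp add: algebra_simps diff_divide_distrib)
      finally show ?thesis by (rule sym)
    qed
    ultimately show "(\<lambda>i. (mollify n g (x + X i *\<^sub>R v) - mollify n g x) / X i) \<longlonglongrightarrow> mollify_deriv n v g x"
      by (simp only:)
  qed
  then show ?thesis by (simp add: DERIV_def)
qed

text \<open>At points where the shifted mollifier is supported in \<open>\<Omega>\<close>, differentiating the mollification of \<open>u\<close> amounts to
mollifying the derivative measure of \<open>u\<close>.\<close>

lemma mollify_deriv_weak_deriv:
  assumes "weak_deriv \<Omega> M u v f" "(\<lambda>y. mollifier n (x - y)) \<in> test_functions \<Omega>"
  shows "mollify_deriv n v u x = (LINT y|M. mollifier n (x - y) * f y)"
proof -
  have "(LINT y|lborel. u y * dir_deriv v (\<lambda>y. mollifier n (x - y)) y) = - (LINT y|M. mollifier n (x - y) * f y)"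
    using assms by (simp add: weak_deriv_def)
  then show ?thesis by (simp add: dir_deriv_reflect smooth_mollifier mollify_deriv_def)
qed

text \<open>The average of \<open>T\<close> over \<open>[s, s + d]\<close> is continuously differentiable, and its derivative is a difference quotient of \<open>T\<close>.\<close>

lemma lipschitz_smoothing:
  fixes T :: "real \<Rightarrow> real"
  assumes L: "L-lipschitz_on UNIV T" and "mono T" and "d > 0"
  obtains S where "\<And>s. (S has_real_derivative (T (s + d) - T s) / d) (at s)"
    "\<And>s. \<bar>S s - T s\<bar> \<le> L * d" "\<And>s. 0 \<le> (T (s + d) - T s) / d" "\<And>s. (T (s + d) - T s) / d \<le> L"
proof -
  have cont: "continuous_on UNIV T" by (rule lipschitz_on_continuous_on) fact
  have "\<exists>G. \<forall>x. -\<infinity> < ereal x \<longrightarrow> ereal x < \<infinity> \<longrightarrow> (G has_vector_derivative T x) (at x)"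
    by (rule einterval_antiderivative) (use cont continuous_on_eq_continuous_at in auto)
  then obtain G where G: "\<And>x. (G has_real_derivative T x) (at x)"
    by (auto simp: has_real_derivative_iff_has_vector_derivative)
  have LT: "\<bar>T x - T y\<bar> \<le> L * \<bar>x - y\<bar>" for x y
    using lipschitz_onD[OF L, of x y] by (simp add: dist_real_def)
  define S where "S s = (G (s + d) - G s) / d" for s
  show thesis
  proof
    fix s
    show "(S has_real_derivative (T (s + d) - T s) / d) (at s)"
      unfolding S_def using DERIV_shift[of G "T (s + d)" s d] G
      using \<open>d > 0\<close> by (auto intro!: derivative_eq_intros)
    obtain z where z: "s < z" "z < s + d" "G (s + d) - G s = (s + d - s) * T z"
      using MVT2[of s "s + d" G T] G \<open>d > 0\<close> by auto
    then have "S s = T z" using \<open>d > 0\<close> by (simp add: S_def)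
    moreover have "L * \<bar>z - s\<bar> \<le> L * d"
      using z lipschitz_on_nonneg[OF L] by (intro mult_left_mono) auto
    ultimately show "\<bar>S s - T s\<bar> \<le> L * d" using LT[of z s] by linarith
    show "0 \<le> (T (s + d) - T s) / d" using \<open>mono T\<close> \<open>d > 0\<close> by (simp add: monoD)
    show "(T (s + d) - T s) / d \<le> L" using LT[of "s + d" s] \<open>d > 0\<close> by (simp add: field_simps abs_le_iff)
  qed
qed

text \<open>A test function varies little on the support of the mollifier, so it may be taken out of the integral.\<close>

lemma mollify_test_close:
  fixes \<phi> c :: "'a::euclidean_space \<Rightarrow> real"
  assumes \<phi>: "\<phi> \<in> test_functions \<Omega>" and C: "\<And>x y. \<bar>\<phi> x - \<phi> y\<bar> \<le> C * norm (x - y)" "C > 0"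
    and [measurable]: "c \<in> borel_measurable borel" and c: "\<And>x. \<bar>c x\<bar> \<le> B"
  shows "\<bar>(LINT x|lborel. \<phi> x * c x * mollifier n (x - y)) - \<phi> y * (LINT x|lborel. c x * mollifier n (x - y))\<bar>
    \<le> C * (DIM('a) / Suc n) * B"
proof -
  have [measurable]: "\<phi> \<in> borel_measurable borel" using \<phi> by (simp add: test_functions_smooth)
  have B: "B \<ge> 0" using order_trans[OF abs_ge_zero c] by blast
  obtain D where D: "\<And>x. \<bar>\<phi> x\<bar> \<le> D" using test_functions_bounded[OF \<phi>] by metis
  have i0: "integrable lborel (\<lambda>x. mollifier n (x - y))"
    by (intro lborel_integrable_shift mollifier_integrable)
  have i1: "integrable lborel (\<lambda>x. c x * mollifier n (x - y))"
    by (rule integrable_mult_bounded(2)[OF i0 _ c]) simp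
  have i2: "integrable lborel (\<lambda>x. \<phi> x * (c x * mollifier n (x - y)))"
    by (rule integrable_mult_bounded(2)[OF i1 _ D]) simp
  have "(LINT x|lborel. \<phi> x * c x * mollifier n (x - y)) - \<phi> y * (LINT x|lborel. c x * mollifier n (x - y))
    = (LINT x|lborel. \<phi> x * (c x * mollifier n (x - y)) - \<phi> y * (c x * mollifier n (x - y)))"
    using i1 i2 by (simp add: mult.assoc)
  also have "\<bar>\<dots>\<bar> \<le> (LINT x|lborel. C * (DIM('a) / Suc n) * B * mollifier n (x - y))"
  proof (rule order_trans[OF integral_abs_bound], rule integral_mono)
    show "integrable lborel (\<lambda>x. \<bar>\<phi> x * (c x * mollifier n (x - y)) - \<phi> y * (c x * mollifier n (x - y))\<bar>)"
      using i1 i2 by (intro integrable_abs Bochner_Integration.integrable_diff integrable_mult_right)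
    show "integrable lborel (\<lambda>x. C * (DIM('a) / Suc n) * B * mollifier n (x - y))"
      using i0 by (intro integrable_mult_right)
    fix x
    have "\<bar>\<phi> x - \<phi> y\<bar> * \<bar>c x\<bar> * mollifier n (x - y) \<le> C * (DIM('a) / Suc n) * B * mollifier n (x - y)"
    proof (cases "norm (x - y) > DIM('a) / Suc n")
      case False
      then have "C * norm (x - y) \<le> C * (DIM('a) / Suc n)" using C(2) by (intro mult_left_mono) auto
      then have "\<bar>\<phi> x - \<phi> y\<bar> \<le> C * (DIM('a) / Suc n)" using C(1)[of x y] by linarith
      then show ?thesis using c C(2) by (intro mult_right_mono mult_mono mollifier_nonneg) auto
    qed (simp add: mollifier_eq_0)
    then show "\<bar>\<phi> x * (c x * mollifier n (x - y)) - \<phi> y * (c x * mollifier n (x - y))\<bar>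
      \<le> C * (DIM('a) / Suc n) * B * mollifier n (x - y)"
      by (simp only: left_diff_distrib[symmetric] abs_mult mult.assoc abs_of_nonneg[OF mollifier_nonneg])
  qed
  also have "\<dots> = C * (DIM('a) / Suc n) * B" by (simp add: mollifier_shift_integral)
  finally show ?thesis .
qed

lemma tendsto_DIM_over_Suc: "(\<lambda>n. c * (real d / real (Suc n)) * b) \<longlonglongrightarrow> 0"
proof -
  have "(\<lambda>n. c * (real d * inverse (real (Suc n))) * b) \<longlonglongrightarrow> c * (real d * 0) * b"
    by (intro tendsto_intros LIMSEQ_inverse_real_of_nat)
  then show ?thesis by (simp add: divide_inverse)
qed

text \<open>The chain rule for measure derivatives. What matters is that a single scalar factor \<open>h\<close> serves all directions \<open>v\<close>:
it is a weak limit of functions \<open>h n\<close> that are built from \<open>u\<close> and \<open>T\<close> alone.\<close>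

theorem weak_deriv_lipschitz_chain:
  fixes u :: "'a::euclidean_space \<Rightarrow> real"
  assumes \<Omega>: "open \<Omega>" and u: "integrable lborel u"
    and M: "finite_measure M" "sets M = sets borel"
    and T: "L-lipschitz_on UNIV T" "mono T"
  obtains h where "h \<in> borel_measurable borel" "\<And>x. 0 \<le> h x" "\<And>x. h x \<le> L"
    "\<And>v f. weak_deriv \<Omega> M u v f \<Longrightarrow> weak_deriv \<Omega> M (\<lambda>x. T (u x)) v (\<lambda>x. h x * f x)"
proof -
  interpret finite_measure M by fact
  interpret P: pair_sigma_finite lborel M ..
  have [measurable_cong]: "sets M = sets borel" by fact
  have [measurable]: "u \<in> borel_measurable borel" using u by auto
  have L: "L \<ge> 0" by (rule lipschitz_on_nonneg[OF T(1)])
  have LT: "\<bar>T x - T y\<bar> \<le> L * \<bar>x - y\<bar>" for x y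
    using lipschitz_onD[OF T(1), of x y] by (simp add: dist_real_def)
  have contT: "continuous_on UNIV T" by (rule lipschitz_on_continuous_on) fact
  have [measurable]: "T \<in> borel_measurable borel" by (rule borel_measurable_continuous_onI) fact
  define d where "d n = inverse (real (Suc n))" for n
  have d: "d n > 0" for n by (simp add: d_def)
  have "\<exists>S. \<forall>s. (S has_real_derivative (T (s + d n) - T s) / d n) (at s) \<and> \<bar>S s - T s\<bar> \<le> L * d n" for n
    by (rule lipschitz_smoothing[OF T d[of n]]) blast
  then obtain S where S: "\<And>n s. (S n has_real_derivative (T (s + d n) - T s) / d n) (at s)"
    "\<And>n s. \<bar>S n s - T s\<bar> \<le> L * d n" by metis
  define T' where "T' n s = (T (s + d n) - T s) / d n" for n s
  have T': "0 \<le> T' n s" "T' n s \<le> L" for n s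
    using T(2) d[of n] LT[of "s + d n" s] by (auto simp: T'_def monoD field_simps abs_le_iff)
  have T'a: "\<bar>T' n s\<bar> \<le> L" for n s using T'[of n s] by simp
  have [measurable]: "T' n \<in> borel_measurable borel" for n unfolding T'_def[abs_def] by measurable
  have contS: "continuous_on UNIV (S n)" for n
    by (intro continuous_at_imp_continuous_on ballI DERIV_isCont[OF S(1)])
  have [measurable]: "S n \<in> borel_measurable borel" for n by (rule borel_measurable_continuous_onI) fact
  let ?u = "\<lambda>n. mollify n u"
  define h where "h n y = (LINT x|lborel. T' n (?u n x) * mollifier n (x - y))" for n y
  have hm[measurable]: "h n \<in> borel_measurable borel" for n unfolding h_def[abs_def] by measurable
  have hb: "0 \<le> h n y \<and> h n y \<le> L" for n y
  proof
    show "0 \<le> h n y" unfolding h_def by (intro integral_nonneg_AE AE_I2 mult_nonneg_nonneg T' mollifier_nonneg)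
    have i0: "integrable lborel (\<lambda>x. mollifier n (x - y))"
      by (intro lborel_integrable_shift mollifier_integrable)
    have "h n y \<le> (LINT x|lborel. L * mollifier n (x - y))"
      unfolding h_def
    proof (rule integral_mono)
      show "integrable lborel (\<lambda>x. T' n (?u n x) * mollifier n (x - y))"
        by (rule integrable_mult_bounded(2)[OF i0 _ T'a]) simp
    qed (use i0 in \<open>auto intro!: mult_right_mono T' mollifier_nonneg\<close>)
    then show "h n y \<le> L" by (simp add: mollifier_shift_integral)
  qed
  obtain g where g: "g \<in> borel_measurable M" "\<And>x. 0 \<le> g x" "\<And>x. g x \<le> L"
    "\<And>\<psi> l. integrable M \<psi> \<Longrightarrow> (\<lambda>n. LINT x|M. \<psi> x * h n x) \<longlonglongrightarrow> l \<Longrightarrow> (LINT x|M. \<psi> x * g x) = l"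
  proof (rule bounded_weak_limit[of M h 0 L])
    show "h n \<in> borel_measurable M" for n by measurable
  qed (use hb L M in auto)
  have "weak_deriv \<Omega> M (\<lambda>x. T (u x)) v (\<lambda>x. g x * f x)" if f: "weak_deriv \<Omega> M u v f" for v f
  proof -
    have fi: "integrable M f" using f by (simp add: weak_deriv_def)
    have [measurable]: "f \<in> borel_measurable M" using fi by auto
    have "(LINT x|lborel. T (u x) * dir_deriv v \<phi> x) = - (LINT x|M. \<phi> x * (g x * f x))"
      if \<phi>: "\<phi> \<in> test_functions \<Omega>" for \<phi>
    proof -
      obtain K where K: "smooth \<phi>" "compact K" "K \<subseteq> \<Omega>" "\<And>x. x \<notin> K \<Longrightarrow> \<phi> x = 0"
        using \<phi> by (auto elim: test_functionsE)
      have [measurable]: "\<phi> \<in> borel_measurable borel" "dir_deriv v \<phi> \<in> borel_measurable borel"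
        using smooth_measurable[OF K(1)] smooth_measurable[OF smooth_dir_deriv[OF K(1)]] by auto
      obtain D where D: "D > 0" "\<And>x. \<bar>\<phi> x\<bar> \<le> D" using test_functions_bounded[OF \<phi>] by metis
      obtain D' where D': "D' > 0" "\<And>x. \<bar>dir_deriv v \<phi> x\<bar> \<le> D'"
        using test_functions_bounded[OF test_functions_dir_deriv[OF \<phi>]] by metis
      obtain C where C: "C > 0" "\<And>x y. \<bar>\<phi> x - \<phi> y\<bar> \<le> C * norm (x - y)"
        using test_function_lipschitz[OF \<phi>] by metis
      have \<phi>i: "integrable lborel \<phi>" and \<phi>'i: "integrable lborel (dir_deriv v \<phi>)"
        using \<phi> test_functions_dir_deriv by (auto intro: test_function_integrable)
      obtain N where N: "\<And>n x. n \<ge> N \<Longrightarrow> x \<in> K \<Longrightarrow> (\<lambda>y. mollifier n (x - y)) \<in> test_functions \<Omega>"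
        using mollifier_inside_test[OF K(2,3) \<Omega>] by metis
      define I where "I n = (LINT x|lborel. S n (?u n x) * dir_deriv v \<phi> x)" for n
      \<comment> \<open>Integrate by parts, insert the measure derivative of u, and interchange the integrals.\<close>
      have parts: "I n = - (LINT y|M. f y * (LINT x|lborel. \<phi> x * T' n (?u n x) * mollifier n (x - y)))"
        if n: "n \<ge> N" for n
      proof -
        obtain c where c: "c > 0" "\<And>x::'a. \<bar>mollifier n x\<bar> \<le> c" using mollifier_bounded[of n] by metis
        obtain c' where c': "c' > 0" "\<And>x::'a. \<bar>dir_deriv v (mollifier n) x\<bar> \<le> c'"
          using test_functions_bounded[OF test_functions_dir_deriv[OF mollifier_test_function]] by metis
        let ?U = "LINT x|lborel. \<bar>u x\<bar>"
        have ub: "\<bar>?u n x\<bar> \<le> c * ?U" for x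
          unfolding mollify_def by (rule kernel_integral_bound) (use u c in auto)
        have u'b: "\<bar>mollify_deriv n v u x\<bar> \<le> c' * ?U" for x
          unfolding mollify_deriv_def by (rule kernel_integral_bound) (use u c' in auto)
        have "compact (S n ` {-(c * ?U)..c * ?U})"
          by (intro compact_continuous_image compact_Icc continuous_on_subset[OF contS]) auto
        then obtain B where B: "\<forall>s\<in>{-(c * ?U)..c * ?U}. \<bar>S n s\<bar> \<le> B"
          by (auto dest!: compact_imp_bounded simp: bounded_iff)
        have "I n = - (LINT x|lborel. (T' n (?u n x) * mollify_deriv n v u x) * \<phi> x)"
          unfolding I_def
        proof (rule integration_by_parts[OF \<phi>])
          show "\<bar>S n (?u n x)\<bar> \<le> B" for x using ub[of x] by (intro B[rule_format]) auto
          show "((\<lambda>t. S n (?u n (x + t *\<^sub>R v))) has_real_derivative T' n (?u n x) * mollify_deriv n v u x) (at 0)" for x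
          proof -
            have "(S n has_real_derivative T' n (?u n x)) (at (?u n (x + 0 *\<^sub>R v)))"
              using S(1)[of n] by (simp add: T'_def)
            then show ?thesis by (rule DERIV_chain2) (rule mollify_line_derivative[OF u])
          qed
          show "\<bar>T' n (?u n x) * mollify_deriv n v u x\<bar> \<le> L * (c' * ?U)" for x
            unfolding abs_mult using T'a u'b L by (intro mult_mono) auto
        qed auto
        also have "(LINT x|lborel. (T' n (?u n x) * mollify_deriv n v u x) * \<phi> x)
          = (LINT x|lborel. (LINT y|M. \<phi> x * f y * (T' n (?u n x) * mollifier n (x - y))))"
        proof (intro Bochner_Integration.integral_cong refl)
          fix x
          show "(T' n (?u n x) * mollify_deriv n v u x) * \<phi> x = (LINT y|M. \<phi> x * f y * (T' n (?u n x) * mollifier n (x - y)))"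
          proof (cases "x \<in> K")
            case True
            then have "mollify_deriv n v u x = (LINT y|M. mollifier n (x - y) * f y)"
              using mollify_deriv_weak_deriv[OF f N[OF n]] by blast
            then have "(T' n (?u n x) * mollify_deriv n v u x) * \<phi> x
              = (LINT y|M. (T' n (?u n x) * \<phi> x) * (mollifier n (x - y) * f y))" by simp
            then show ?thesis by (simp add: mult_ac)
          qed (simp add: K)
        qed
        also have "\<dots> = (LINT y|M. (LINT x|lborel. \<phi> x * f y * (T' n (?u n x) * mollifier n (x - y))))"
        proof (rule P.Fubini_integral[symmetric])
          have "\<bar>T' n (?u n x) * mollifier n (x - y)\<bar> \<le> L * c" for x y
            unfolding abs_mult using T'a c L by (intro mult_mono) auto
          then show "integrable (lborel \<Otimes>\<^sub>M M) (\<lambda>(x, y). \<phi> x * f y * (T' n (?u n x) * mollifier n (x - y)))"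
            by (intro P.integrable_kernel[where C = "L * c"] \<phi>i fi) measurable
        qed
        also have "\<dots> = (LINT y|M. f y * (LINT x|lborel. \<phi> x * T' n (?u n x) * mollifier n (x - y)))"
          by (simp add: mult_ac flip: integral_mult_right_zero)
        finally show ?thesis .
      qed
      have lim1: "I \<longlonglongrightarrow> (LINT x|lborel. T (u x) * dir_deriv v \<phi> x)"
      proof -
        define E where "E n = D' * L * (LINT x|lborel. \<bar>?u n x - u x\<bar>) + L * d n * (LINT x|lborel. \<bar>dir_deriv v \<phi> x\<bar>)" for n
        have "d \<longlonglongrightarrow> 0" unfolding d_def by (rule LIMSEQ_inverse_real_of_nat)
        then have "E \<longlonglongrightarrow> D' * L * 0 + L * 0 * (LINT x|lborel. \<bar>dir_deriv v \<phi> x\<bar>)"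
          unfolding E_def by (intro tendsto_intros mollify_L1 u)
        then have E0: "E \<longlonglongrightarrow> 0" by simp
        have Tu: "integrable lborel (\<lambda>x. T (u x) * dir_deriv v \<phi> x)"
          if "integrable lborel u" for u :: "'a \<Rightarrow> real"
        proof (rule Bochner_Integration.integrable_bound[of lborel "\<lambda>x. \<bar>T 0\<bar> * \<bar>dir_deriv v \<phi> x\<bar> + L * D' * \<bar>u x\<bar>"])
          show "AE x in lborel. norm (T (u x) * dir_deriv v \<phi> x) \<le> norm (\<bar>T 0\<bar> * \<bar>dir_deriv v \<phi> x\<bar> + L * D' * \<bar>u x\<bar>)"
          proof (rule AE_I2)
            fix x :: 'a
            have "\<bar>T (u x)\<bar> \<le> \<bar>T 0\<bar> + L * \<bar>u x\<bar>" using LT[of "u x" 0] by (simp add: abs_le_iff) (smt (verit))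
            then have "\<bar>T (u x)\<bar> * \<bar>dir_deriv v \<phi> x\<bar> \<le> (\<bar>T 0\<bar> + L * \<bar>u x\<bar>) * \<bar>dir_deriv v \<phi> x\<bar>"
              by (intro mult_right_mono) auto
            also have "\<dots> = \<bar>T 0\<bar> * \<bar>dir_deriv v \<phi> x\<bar> + (L * \<bar>u x\<bar>) * \<bar>dir_deriv v \<phi> x\<bar>" by (simp add: algebra_simps)
            also have "(L * \<bar>u x\<bar>) * \<bar>dir_deriv v \<phi> x\<bar> \<le> (L * \<bar>u x\<bar>) * D'"
              using D' L by (intro mult_left_mono) auto
            finally have "\<bar>T (u x) * dir_deriv v \<phi> x\<bar> \<le> \<bar>T 0\<bar> * \<bar>dir_deriv v \<phi> x\<bar> + L * D' * \<bar>u x\<bar>"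
              by (simp add: abs_mult mult_ac)
            then show "norm (T (u x) * dir_deriv v \<phi> x) \<le> norm (\<bar>T 0\<bar> * \<bar>dir_deriv v \<phi> x\<bar> + L * D' * \<bar>u x\<bar>)"
              unfolding real_norm_def by linarith
          qed
        qed (use that \<phi>'i in auto)
        have "norm (I n - (LINT x|lborel. T (u x) * dir_deriv v \<phi> x)) \<le> E n" for n
        proof -
          have ui: "integrable lborel (?u n)" by (rule mollify_integrable[OF u])
          have bd: "\<bar>S n (?u n x) * dir_deriv v \<phi> x - T (u x) * dir_deriv v \<phi> x\<bar>
              \<le> D' * L * \<bar>?u n x - u x\<bar> + L * d n * \<bar>dir_deriv v \<phi> x\<bar>" for x
          proof -
            have "\<bar>S n (?u n x) - T (u x)\<bar> \<le> L * d n + L * \<bar>?u n x - u x\<bar>"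
              using S(2)[of n "?u n x"] LT[of "?u n x" "u x"] by linarith
            then have "\<bar>S n (?u n x) - T (u x)\<bar> * \<bar>dir_deriv v \<phi> x\<bar> \<le> (L * d n + L * \<bar>?u n x - u x\<bar>) * \<bar>dir_deriv v \<phi> x\<bar>"
              by (intro mult_right_mono) auto
            also have "\<dots> = L * d n * \<bar>dir_deriv v \<phi> x\<bar> + (L * \<bar>?u n x - u x\<bar>) * \<bar>dir_deriv v \<phi> x\<bar>"
              by (simp add: algebra_simps)
            also have "(L * \<bar>?u n x - u x\<bar>) * \<bar>dir_deriv v \<phi> x\<bar> \<le> (L * \<bar>?u n x - u x\<bar>) * D'"
              using D' L by (intro mult_left_mono) auto
            finally have "\<bar>(S n (?u n x) - T (u x)) * dir_deriv v \<phi> x\<bar>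
                \<le> D' * L * \<bar>?u n x - u x\<bar> + L * d n * \<bar>dir_deriv v \<phi> x\<bar>"
              by (simp add: abs_mult mult_ac)
            then show ?thesis by (simp only: left_diff_distrib)
          qed
          have i2: "integrable lborel (\<lambda>x. D' * L * \<bar>?u n x - u x\<bar> + L * d n * \<bar>dir_deriv v \<phi> x\<bar>)"
            using ui u \<phi>'i by auto
          have i3: "integrable lborel (\<lambda>x. S n (?u n x) * dir_deriv v \<phi> x - T (u x) * dir_deriv v \<phi> x)"
            by (rule Bochner_Integration.integrable_bound[OF i2])
               (use bd in \<open>auto intro!: AE_I2 intro: order_trans[OF _ abs_ge_self]\<close>)
          have "integrable lborel (\<lambda>x. S n (?u n x) * dir_deriv v \<phi> x)"
            using Bochner_Integration.integrable_add[OF i3 Tu[OF u]] by simp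
          then have "I n - (LINT x|lborel. T (u x) * dir_deriv v \<phi> x)
            = (LINT x|lborel. S n (?u n x) * dir_deriv v \<phi> x - T (u x) * dir_deriv v \<phi> x)"
            using Tu[OF u] by (simp add: I_def)
          also have "norm \<dots> \<le> (LINT x|lborel. D' * L * \<bar>?u n x - u x\<bar> + L * d n * \<bar>dir_deriv v \<phi> x\<bar>)"
            unfolding real_norm_def
            by (rule order_trans[OF integral_abs_bound integral_mono[OF integrable_abs[OF i3] i2 bd]])
          also have "\<dots> = E n"
            using ui u \<phi>'i by (simp add: E_def)
          finally show ?thesis .
        qed
        then show ?thesis
          by (intro LIM_zero_cancel[OF Lim_null_comparison[OF _ E0]]) simp
      qed
      \<comment> \<open>Replacing \<open>\<phi> x\<close> by \<open>\<phi> y\<close> in the inner integral turns it into \<open>\<phi> y * h n y\<close>.\<close>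
      have close: "\<bar>(LINT y|M. (\<phi> y * f y) * h n y) + I n\<bar> \<le> (LINT y|M. \<bar>f y\<bar>) * (C * (DIM('a) / Suc n) * L)"
        if "n \<ge> N" for n
      proof -
        let ?p = "\<lambda>y. LINT x|lborel. \<phi> x * T' n (?u n x) * mollifier n (x - y)"
        let ?e = "C * (DIM('a) / Suc n) * L"
        have pc: "\<bar>\<phi> y * h n y - ?p y\<bar> \<le> ?e" for y
          using mollify_test_close[OF \<phi> C(2,1), where c = "\<lambda>x. T' n (?u n x)" and B = L and n = n and y = y] T'a
          by (simp add: h_def abs_minus_commute)
        have b1: "\<bar>\<phi> y * h n y\<bar> \<le> D * L" for y
          unfolding abs_mult using D hb[of n y] by (intro mult_mono) auto
        have i1: "integrable M (\<lambda>y. f y * (\<phi> y * h n y))"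
          by (rule integrable_mult_bounded(1)[OF fi _ b1]) simp
        have i2: "integrable M (\<lambda>y. f y * (\<phi> y * h n y - ?p y))"
          by (rule integrable_mult_bounded(1)[OF fi _ pc]) simp
        have "integrable M (\<lambda>y. f y * ?p y)"
          using Bochner_Integration.integrable_diff[OF i1 i2] by (simp add: algebra_simps)
        then have "(LINT y|M. (\<phi> y * f y) * h n y) + I n = (LINT y|M. f y * (\<phi> y * h n y - ?p y))"
          using i1 parts[OF that] by (simp add: right_diff_distrib mult_ac)
        also have "\<bar>\<dots>\<bar> \<le> ?e * (LINT y|M. \<bar>f y\<bar>)"
          by (rule kernel_integral_bound[OF fi _ pc]) simp
        finally show ?thesis by (simp add: mult.commute)
      qed
      have "(\<lambda>n. (LINT y|M. (\<phi> y * f y) * h n y) + I n) \<longlonglongrightarrow> 0"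
      proof (rule Lim_null_comparison)
        show "\<forall>\<^sub>F n in sequentially. norm ((LINT y|M. (\<phi> y * f y) * h n y) + I n) \<le> (LINT y|M. \<bar>f y\<bar>) * (C * (DIM('a) / Suc n) * L)"
          using eventually_ge_at_top[of N] by eventually_elim (use close in simp)
        show "(\<lambda>n. (LINT y|M. \<bar>f y\<bar>) * (C * (DIM('a) / Suc n) * L)) \<longlonglongrightarrow> 0"
          by (rule tendsto_mult_right_zero[OF tendsto_DIM_over_Suc])
      qed
      from tendsto_diff[OF this lim1]
      have "(\<lambda>n. LINT y|M. (\<phi> y * f y) * h n y) \<longlonglongrightarrow> - (LINT x|lborel. T (u x) * dir_deriv v \<phi> x)" by simp
      moreover have "integrable M (\<lambda>y. \<phi> y * f y)"
        by (rule integrable_mult_bounded(2)[OF fi _ D(2)]) simp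
      ultimately have "(LINT y|M. (\<phi> y * f y) * g y) = - (LINT x|lborel. T (u x) * dir_deriv v \<phi> x)"
        by (intro g(4))
      then show ?thesis by (simp add: mult_ac)
    qed
    moreover have "integrable M (\<lambda>x. g x * f x)"
    proof (rule integrable_mult_bounded(2)[OF fi g(1)])
      show "\<bar>g x\<bar> \<le> L" for x using g(2,3)[of x] by simp
    qed
    ultimately show ?thesis by (simp add: weak_deriv_def)
  qed
  moreover have "g \<in> borel_measurable borel" using g(1) by simp
  ultimately show thesis by (intro that[of g] g(2,3)) auto
qed

section \<open>Test functions determine densities\<close>

lemma AE_on_open_if_on_boxes:
  fixes \<Omega> :: "'a::euclidean_space set"
  assumes \<Omega>: "open \<Omega>" and on_box: "\<And>a c. cbox a c \<subseteq> \<Omega> \<Longrightarrow> AE x in M. x \<in> box a c \<longrightarrow> P x"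
  shows "AE x in M. x \<in> \<Omega> \<longrightarrow> P x"
proof -
  let ?\<F> = "{box a c | a c. cbox a c \<subseteq> \<Omega>}"
  obtain \<F>' where F': "\<F>' \<subseteq> ?\<F>" "countable \<F>'" "\<Union>\<F>' = \<Union>?\<F>"
    using Lindelof_openin[of ?\<F> UNIV] by auto
  have "AE x in M. \<forall>B\<in>\<F>'. x \<in> B \<longrightarrow> P x"
    using F'(1,2) on_box by (subst AE_ball_countable) auto
  moreover have "\<Omega> \<subseteq> \<Union>\<F>'"
  proof
    fix x assume "x \<in> \<Omega>"
    then obtain a c where "cbox a c \<subseteq> \<Omega>" "x \<in> box a c" using open_contains_cbox[OF \<Omega>] by metis
    then show "x \<in> \<Union>\<F>'" unfolding F'(3) by auto
  qed
  ultimately show ?thesis by (auto elim!: eventually_mono)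
qed

text \<open>Bump functions converge boundedly to indicators of boxes, so the integral of \<open>f\<close> over every box with closure in \<open>\<Omega>\<close>
vanishes. The boxes inside a fixed one are stable under intersections and generate its Borel sets, hence
\<open>f\<close> vanishes almost everywhere there; countably many boxes cover \<open>\<Omega>\<close>.\<close>

theorem fundamental_lemma:
  fixes \<Omega> :: "'a::euclidean_space set" and f :: "'a \<Rightarrow> real"
  assumes \<Omega>: "open \<Omega>" and "sigma_finite_measure M" and M[measurable_cong]: "sets M = sets borel"
    and f[measurable]: "f \<in> borel_measurable borel"
    and int: "\<And>a c. cbox a c \<subseteq> \<Omega> \<Longrightarrow> integrable M (\<lambda>x. indicator (cbox a c) x * f x)"
    and test: "\<And>\<phi>. \<phi> \<in> test_functions \<Omega> \<Longrightarrow> (LINT x|M. \<phi> x * f x) = 0"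
  shows "AE x in M. x \<in> \<Omega> \<longrightarrow> f x = 0"
proof -
  have borel_boxes: "(sets borel :: 'a set set) = sigma_sets UNIV (range (\<lambda>(a, b). box a b))"
    by (subst borel_eq_box) simp
  have box0: "(LINT x|M. indicat_real (box a c) x * f x) = 0" if "cbox a c \<subseteq> \<Omega>" for a c
  proof -
    have "(\<lambda>n. LINT x|M. bump n a c x * f x) \<longlonglongrightarrow> (LINT x|M. indicat_real (box a c) x * f x)"
    proof (rule integral_dominated_convergence[where w = "\<lambda>x. \<bar>indicator (cbox a c) x * f x\<bar>"])
      show "AE x in M. (\<lambda>n. bump n a c x * f x) \<longlonglongrightarrow> indicat_real (box a c) x * f x"
        by (intro AE_I2 tendsto_intros bump_tendsto_indicator)
      show "AE x in M. norm (bump n a c x * f x) \<le> \<bar>indicator (cbox a c) x * f x\<bar>" for n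
      proof (rule AE_I2)
        fix x
        have "\<bar>bump n a c x\<bar> \<le> indicator (cbox a c) x"
          using bump_le_1[of n a c x] bump_nonneg[of n a c x] bump_eq_0[of x a c n] box_subset_cbox[of a c]
          by (auto split: split_indicator)
        then have "\<bar>bump n a c x\<bar> * \<bar>f x\<bar> \<le> indicator (cbox a c) x * \<bar>f x\<bar>" by (intro mult_right_mono) auto
        then show "norm (bump n a c x * f x) \<le> \<bar>indicator (cbox a c) x * f x\<bar>" by (simp add: abs_mult)
      qed
      have [measurable]: "bump n a c \<in> borel_measurable borel" for n by (simp add: smooth_bump)
      show "(\<lambda>x. bump n a c x * f x) \<in> borel_measurable M" for n by measurable
    qed (use int[OF that] in auto)
    then show ?thesis using test[OF bump_test_function[OF that]] by (simp add: LIMSEQ_const_iff)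
  qed
  have on_box: "AE x in M. x \<in> box a c \<longrightarrow> f x = 0" if ac: "cbox a c \<subseteq> \<Omega>" for a c
  proof -
    let ?F = "\<lambda>x. indicat_real (box a c) x * f x"
    have F: "integrable M ?F"
      by (rule Bochner_Integration.integrable_bound[OF int[OF ac]])
         (use box_subset_cbox[of a c] in \<open>auto intro!: AE_I2 split: split_indicator\<close>)
    have "set_lebesgue_integral M B ?F = 0" if "B \<in> sets M" for B
    proof -
      have ind: "integrable M (\<lambda>x. indicat_real B x *\<^sub>R ?F x)" if "B \<in> sets M" for B
        using F that by (rule integrable_mult_indicator[rotated])
      have "Int_stable (range (\<lambda>(a, b). box a b :: 'a set))"
        by (auto simp: Int_stable_def box_Int_box)
      moreover have "range (\<lambda>(a, b). box a b :: 'a set) \<subseteq> Pow UNIV" by simp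
      moreover have "B \<in> sigma_sets UNIV (range (\<lambda>(a, b). box a b))"
        using that M borel_boxes by simp
      ultimately show ?thesis
      proof (induction rule: sigma_sets_induct_disjoint)
        case (basic A)
        then obtain a' c' where A: "A = box a' c'" by auto
        obtain a'' c'' where i: "A \<inter> box a c = box a'' c''" unfolding A box_Int_box by blast
        have eq: "set_lebesgue_integral M A ?F = (LINT x|M. indicat_real (box a'' c'') x * f x)"
          unfolding set_lebesgue_integral_def i[symmetric] by (simp add: indicator_inter_arith mult.assoc)
        show ?case
        proof (cases "box a'' c'' = {}")
          case False
          then have "cbox a'' c'' \<subseteq> cbox a c"
            using i by (metis Int_lower2 box_subset_cbox closure_box closure_minimal closed_cbox order_trans)
          then show ?thesis unfolding eq using ac by (intro box0) auto
        qed (simp add: eq)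
      next
        case (compl A)
        have A: "A \<in> sets M" using compl(1) M borel_boxes by simp
        have "set_lebesgue_integral M (UNIV - A) ?F = (LINT x|M. ?F x - indicat_real A x *\<^sub>R ?F x)"
          unfolding set_lebesgue_integral_def
          by (intro Bochner_Integration.integral_cong) (auto split: split_indicator)
        also have "\<dots> = (LINT x|M. ?F x) - set_lebesgue_integral M A ?F"
          unfolding set_lebesgue_integral_def by (rule Bochner_Integration.integral_diff[OF F ind[OF A]])
        finally show ?case using compl box0[OF ac] by simp
      next
        case (union A)
        have A: "A i \<in> sets M" for i using union(2) M borel_boxes by auto
        have "set_lebesgue_integral M (\<Union>i. A i) ?F = (\<Sum>i. set_lebesgue_integral M (A i) ?F)"
        proof (rule lebesgue_integral_countable_add)
          show "A i \<inter> A j = {}" if "i \<noteq> j" for i j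
            using union(1) that by (auto simp: disjoint_family_on_def)
          show "set_integrable M (\<Union>i. A i) ?F"
            unfolding set_integrable_def using A by (intro ind) auto
        qed (rule A)
        then show ?case using union by simp
      qed (simp add: set_lebesgue_integral_def)
    qed
    then have "AE x in M. ?F x = 0"
      by (rule sigma_finite_measure.density_zero[OF \<open>sigma_finite_measure M\<close> F])
    then show ?thesis
      by eventually_elim (auto split: split_indicator)
  qed
  show ?thesis by (rule AE_on_open_if_on_boxes[OF \<Omega> on_box])
qed

section \<open>Measures with a density\<close>

lemma sum_of_two_measures:
  fixes M N :: "'a::topological_space measure"
  assumes M: "finite_measure M" "sets M = sets borel" and N: "finite_measure N" "sets N = sets borel"
  obtains S where "finite_measure S" "sets S = sets borel"
    "\<And>A. emeasure S A = emeasure M A + emeasure N A"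
proof -
  define S where "S = measure_of UNIV (sets borel) (\<lambda>A. emeasure M A + emeasure N A)"
  have sets: "sets S = sets borel" by (simp add: S_def sets.sigma_algebra_axioms flip: space_borel)
  have sp: "space S = UNIV" by (simp add: S_def)
  have em: "emeasure S A = emeasure M A + emeasure N A" for A
  proof (cases "A \<in> sets borel")
    case True
    show ?thesis
      unfolding S_def
    proof (rule emeasure_measure_of_sigma)
      show "sigma_algebra UNIV (sets borel)" using sets.sigma_algebra_axioms[of borel] by simp
      show "positive (sets borel) (\<lambda>A. emeasure M A + emeasure N A)" by (simp add: positive_def)
      show "countably_additive (sets borel) (\<lambda>A. emeasure M A + emeasure N A)"
        unfolding countably_additive_def
      proof (intro allI impI)
        fix A :: "nat \<Rightarrow> 'a set" assume A: "range A \<subseteq> sets borel" "disjoint_family A" "\<Union> (range A) \<in> sets borel"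
        have "(\<Sum>i. emeasure M (A i) + emeasure N (A i)) = (\<Sum>i. emeasure M (A i)) + (\<Sum>i. emeasure N (A i))"
          by (rule suminf_add[symmetric]) auto
        also have "\<dots> = emeasure M (\<Union> (range A)) + emeasure N (\<Union> (range A))"
          using A M N by (simp add: suminf_emeasure)
        finally show "(\<Sum>i. emeasure M (A i) + emeasure N (A i)) = emeasure M (\<Union> (range A)) + emeasure N (\<Union> (range A))" .
      qed
      show "A \<in> sets borel" by fact
    qed
  qed (use M N sets in \<open>simp add: emeasure_notin_sets\<close>)
  show thesis
  proof (rule that[OF _ sets em])
    show "finite_measure S"
      using finite_measure.emeasure_finite[OF M(1), of UNIV] finite_measure.emeasure_finite[OF N(1), of UNIV]
      by (intro finite_measureI) (simp add: em sp)
  qed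
qed

text \<open>The sum of the measures dominates each of them.\<close>

lemma dominating_measure:
  fixes N :: "'i \<Rightarrow> 'a::topological_space measure"
  assumes "finite I" "\<And>i. i \<in> I \<Longrightarrow> finite_measure (N i)" "\<And>i. i \<in> I \<Longrightarrow> sets (N i) = sets borel"
  obtains M where "finite_measure M" "sets M = sets borel" "\<And>i. i \<in> I \<Longrightarrow> absolutely_continuous M (N i)"
proof -
  have "\<exists>M. finite_measure M \<and> sets M = sets borel \<and> (\<forall>i\<in>I. absolutely_continuous M (N i))"
    using assms
  proof (induction)
    case empty
    have "finite_measure (null_measure borel :: 'a measure)" by (intro finite_measureI) simp
    then show ?case by (intro exI[of _ "null_measure borel"]) simp
  next
    case (insert i I)
    then obtain M where M: "finite_measure M" "sets M = sets borel" "\<forall>i\<in>I. absolutely_continuous M (N i)" by auto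
    obtain S where S: "finite_measure S" "sets S = sets borel" "\<And>A. emeasure S A = emeasure M A + emeasure (N i) A"
      using sum_of_two_measures[OF M(1,2) insert.prems(1)[of i] insert.prems(2)[of i]] by auto
    have "absolutely_continuous S (N j)" if "j \<in> insert i I" for j
    proof (cases "j = i")
      case True
      then show ?thesis
        using S insert.prems(2)[of i] by (auto simp: absolutely_continuous_def null_sets_def)
    next
      case False
      then have "absolutely_continuous M (N j)" using that M by auto
      then show ?thesis
        using S M(2) by (auto simp: absolutely_continuous_def null_sets_def)
    qed
    then show ?case using S by blast
  qed
  then show thesis using that by blast
qed

lemma finite_density:
  fixes M N :: "'a::topological_space measure"
  assumes M: "finite_measure M" "sets M = sets borel" and N: "finite_measure N" "sets N = sets borel"
    and ac: "absolutely_continuous M N"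
  obtains f where "f \<in> borel_measurable borel" "\<And>x. (0::real) \<le> f x" "integrable M f"
    "N = density M (\<lambda>x. ennreal (f x))"
proof -
  interpret finite_measure M by fact
  obtain D where D: "D \<in> borel_measurable M" "AE x in M. RN_deriv M N x = ennreal (D x)" "\<And>x. 0 \<le> D x"
    by (rule real_RN_deriv[OF N(1) ac]) (use M N in auto)
  have "density M (RN_deriv M N) = N" by (rule density_RN_deriv) (use ac M N in auto)
  moreover have "density M (RN_deriv M N) = density M (\<lambda>x. ennreal (D x))"
    using D by (intro density_cong) auto
  ultimately have eq: "N = density M (\<lambda>x. ennreal (D x))" by simp
  have "emeasure N (space N) < \<infinity>" using finite_measure.emeasure_finite[OF N(1)] by (simp add: less_top)
  then have "(\<integral>\<^sup>+x. ennreal (D x) \<partial>M) < \<infinity>" using D(1) unfolding eq by (simp add: emeasure_density cong: nn_integral_cong)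
  then have "integrable M D" using D by (intro integrableI_nonneg) auto
  then show thesis using D M eq by (intro that[of D]) auto
qed

section \<open>The total variation of a vector measure with a density\<close>

text \<open>Balls around a countable dense set, made disjoint.\<close>

lemma countable_small_partition:
  assumes "\<epsilon> > 0"
  obtains d :: "nat \<Rightarrow> 'b::euclidean_space" and C :: "nat \<Rightarrow> 'b set" where
    "\<And>i. C i \<in> sets borel" "disjoint_family C" "(\<Union>i. C i) = UNIV" "\<And>i y. y \<in> C i \<Longrightarrow> norm (y - d i) \<le> \<epsilon>"
proof -
  obtain D :: "'b set" where D: "countable D" "\<And>X. open X \<Longrightarrow> X \<noteq> {} \<Longrightarrow> \<exists>d\<in>D. d \<in> X"
    by (rule countable_dense_setE) blast
  have "D \<noteq> {}" using D(2)[of UNIV] by auto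
  define d where "d = from_nat_into D"
  define C where "C = disjointed (\<lambda>i. ball (d i) \<epsilon>)"
  show thesis
  proof
    have "range C \<subseteq> sets borel"
      unfolding C_def by (rule sets.range_disjointed_sets) auto
    then show "C i \<in> sets borel" for i by auto
    show "disjoint_family C" unfolding C_def by (rule disjoint_family_disjointed)
    have "y \<in> (\<Union>i. ball (d i) \<epsilon>)" for y
    proof -
      obtain e where "e \<in> D" "e \<in> ball y \<epsilon>" using D(2)[of "ball y \<epsilon>"] assms by auto
      then obtain i where "d i = e" unfolding d_def using from_nat_into_surj[OF D(1)] by metis
      then show ?thesis using \<open>e \<in> ball y \<epsilon>\<close> by (auto simp: dist_commute)
    qed
    then show "(\<Union>i. C i) = UNIV" unfolding C_def UN_disjointed_eq by auto
    show "norm (y - d i) \<le> \<epsilon>" if "y \<in> C i" for i y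
      using that disjointed_subset[of "\<lambda>i. ball (d i) \<epsilon>" i] by (auto simp: C_def dist_norm norm_minus_commute)
  qed
qed

text \<open>The integral of \<open>norm S\<close> is an upper bound by the triangle inequality. It is attained in the limit of fine partitions
of the values of \<open>S\<close>, because there is little cancellation within a set on which \<open>S\<close> is nearly constant.\<close>

lemma sup_partitions_eq:
  fixes S :: "'a::euclidean_space \<Rightarrow> 'b::euclidean_space"
  assumes M: "finite_measure M" "sets M = sets borel" and S: "integrable M S"
    and \<Omega>: "\<Omega> \<in> sets borel" and B: "B \<in> sets (restrict_space borel \<Omega>)"
    and D: "\<And>B. B \<in> sets (restrict_space borel \<Omega>) \<Longrightarrow> D B = set_lebesgue_integral M B S"
  shows "(SUP A\<in>{A :: nat \<Rightarrow> 'a set. range A \<subseteq> sets (restrict_space borel \<Omega>) \<and>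
                    disjoint_family A \<and> (\<Union>i. A i) = B}. \<Sum>i. ennreal (norm (D (A i))))
     = emeasure (density M (\<lambda>x. ennreal (norm (S x)))) B" (is "(SUP A\<in>?P. ?v A) = emeasure ?N B")
proof (rule antisym)
  interpret finite_measure M by fact
  have Sm[measurable]: "S \<in> borel_measurable M" using S by auto
  have setsR: "A \<in> sets M" if "A \<in> sets (restrict_space borel \<Omega>)" for A
    using that \<Omega> M by (auto simp: sets_restrict_space)
  have iA: "set_integrable M A S" if "A \<in> sets M" for A
    unfolding set_integrable_def using S that by (rule integrable_mult_indicator[rotated])
  have N: "emeasure ?N A = ennreal (LINT x:A|M. norm (S x))" if A: "A \<in> sets M" for A
  proof -
    have "emeasure ?N A = (\<integral>\<^sup>+x. ennreal (indicator A x *\<^sub>R norm (S x)) \<partial>M)"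
      using A by (subst emeasure_density) (auto intro!: nn_integral_cong split: split_indicator)
    also have "\<dots> = ennreal (LINT x:A|M. norm (S x))"
      unfolding set_lebesgue_integral_def
      using S A by (intro nn_integral_eq_integral integrable_mult_indicator) auto
    finally show ?thesis .
  qed
  have normD: "ennreal (norm (D A)) \<le> emeasure ?N A" if "A \<in> sets (restrict_space borel \<Omega>)" for A
  proof -
    have "norm (D A) \<le> (LINT x:A|M. norm (S x))"
      unfolding D[OF that] by (rule set_integral_norm_bound[OF iA[OF setsR[OF that]]])
    then show ?thesis unfolding N[OF setsR[OF that]] by (rule ennreal_leI)
  qed
  have sN: "(\<Sum>i. emeasure ?N (A i)) = emeasure ?N B" if "A \<in> ?P" for A
    using that setsR by (subst suminf_emeasure) (auto simp: image_subset_iff)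
  show "(SUP A\<in>?P. ?v A) \<le> emeasure ?N B"
  proof (rule SUP_least)
    fix A assume A: "A \<in> ?P"
    have "?v A \<le> (\<Sum>i. emeasure ?N (A i))"
      using A by (intro suminf_le normD) auto
    then show "?v A \<le> emeasure ?N B" using sN[OF A] by simp
  qed
  show "emeasure ?N B \<le> (SUP A\<in>?P. ?v A)"
  proof (rule ennreal_le_epsilon)
    fix e :: real assume "0 < e"
    define m where "m = measure M B + 1"
    have m: "m > 0" by (simp add: m_def add_nonneg_pos)
    define \<epsilon> where "\<epsilon> = e / (2 * m)"
    have \<epsilon>: "\<epsilon> > 0" "2 * \<epsilon> * measure M B \<le> e"
      using \<open>0 < e\<close> m by (auto simp: \<epsilon>_def m_def field_simps)
    obtain d :: "nat \<Rightarrow> 'b" and C where C: "\<And>i. C i \<in> sets borel" "disjoint_family C" "(\<Union>i. C i) = UNIV"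
      "\<And>i y. y \<in> C i \<Longrightarrow> norm (y - d i) \<le> \<epsilon>"
      by (rule countable_small_partition[OF \<epsilon>(1)]) blast
    define A where "A i = B \<inter> (S -` C i)" for i
    have spM: "space M = UNIV" using sets_eq_imp_space_eq[OF M(2)] by simp
    have SC: "S -` C i \<in> sets borel" for i
      using measurable_sets[OF Sm C(1), of i] M spM by simp
    have A1: "A i \<in> sets (restrict_space borel \<Omega>)" for i
    proof -
      obtain B' where B': "B' \<in> sets borel" "B = \<Omega> \<inter> B'" using B by (auto simp: sets_restrict_space)
      then have "A i = \<Omega> \<inter> (B' \<inter> S -` C i)" by (auto simp: A_def)
      then show ?thesis using B'(1) SC[of i] by (auto simp: sets_restrict_space)
    qed
    have "disjoint_family A"
      unfolding disjoint_family_on_def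
    proof (intro ballI impI)
      fix i j :: nat assume "i \<noteq> j"
      then have "C i \<inter> C j = {}" using C(2) by (simp add: disjoint_family_on_def)
      then show "A i \<inter> A j = {}" by (auto simp: A_def)
    qed
    moreover have "(\<Union>i. A i) = B"
    proof -
      have "(\<Union>i. A i) = B \<inter> S -` (\<Union>i. C i)" by (auto simp: A_def)
      then show ?thesis unfolding C(3) by simp
    qed
    moreover have "range A \<subseteq> sets (restrict_space borel \<Omega>)" using A1 by blast
    ultimately have AP: "A \<in> ?P" by simp
    \<comment> \<open>On each cell S is nearly constant, so the norm of its integral is nearly the integral of its norm.\<close>
    have cell: "(LINT x:(A i)|M. norm (S x)) \<le> norm (D (A i)) + 2 * \<epsilon> * measure M (A i)" for i
    proof -
      have Ai: "A i \<in> sets M" by (rule setsR[OF A1])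
      have ci: "set_integrable M (A i) (\<lambda>x. d i)" "set_integrable M (A i) (\<lambda>x. \<epsilon>)" "set_integrable M (A i) (\<lambda>x. norm (d i))"
        using Ai integrable_real_indicator[OF Ai] unfolding set_integrable_def by (auto simp: less_top[symmetric])
      have "(LINT x:(A i)|M. norm (S x)) \<le> (LINT x:(A i)|M. norm (d i) + \<epsilon>)"
      proof (rule set_integral_mono)
        show "set_integrable M (A i) (\<lambda>x. norm (S x))" using iA[OF Ai] by (rule set_integrable_norm)
        show "set_integrable M (A i) (\<lambda>x. norm (d i) + \<epsilon>)" using ci by (intro set_integral_add(1))
        fix x assume "x \<in> A i"
        then have "norm (S x - d i) \<le> \<epsilon>" using C(4) by (auto simp: A_def)
        then show "norm (S x) \<le> norm (d i) + \<epsilon>" using norm_triangle_sub[of "S x" "d i"] by linarith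
      qed
      also have "\<dots> = measure M (A i) * norm (d i) + \<epsilon> * measure M (A i)"
        using Ai by (subst set_integral_add(2)[OF ci(3,2)]) (simp add: set_lebesgue_integral_def)
      finally have upper: "(LINT x:(A i)|M. norm (S x)) \<le> measure M (A i) * norm (d i) + \<epsilon> * measure M (A i)" .
      have "norm ((LINT x:(A i)|M. d i) - (LINT x:(A i)|M. S x)) = norm (LINT x:(A i)|M. d i - S x)"
        using set_integral_diff(2)[OF ci(1) iA[OF Ai]] by simp
      also have "\<dots> \<le> (LINT x:(A i)|M. norm (d i - S x))"
        by (rule set_integral_norm_bound[OF set_integral_diff(1)[OF ci(1) iA[OF Ai]]])
      also have "\<dots> \<le> (LINT x:(A i)|M. \<epsilon>)"
      proof (rule set_integral_mono)
        show "set_integrable M (A i) (\<lambda>x. norm (d i - S x))"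
          by (rule set_integrable_norm[OF set_integral_diff(1)[OF ci(1) iA[OF Ai]]])
        show "norm (d i - S x) \<le> \<epsilon>" if "x \<in> A i" for x
          using that C(4)[of "S x" i] by (auto simp: A_def norm_minus_commute)
      qed (rule ci)
      also have "\<dots> = \<epsilon> * measure M (A i)" using Ai by (simp add: set_lebesgue_integral_def)
      finally have "norm ((LINT x:(A i)|M. d i) - D (A i)) \<le> \<epsilon> * measure M (A i)"
        unfolding D[OF A1] .
      moreover have "(LINT x:(A i)|M. d i) = measure M (A i) *\<^sub>R d i"
        using integrable_real_indicator[OF Ai] Ai
        by (simp add: set_lebesgue_integral_def less_top[symmetric])
      ultimately have "norm (measure M (A i) *\<^sub>R d i - D (A i)) \<le> \<epsilon> * measure M (A i)" by simp
      then have "measure M (A i) * norm (d i) \<le> norm (D (A i)) + \<epsilon> * measure M (A i)"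
        using norm_triangle_sub[of "measure M (A i) *\<^sub>R d i" "D (A i)"] by simp
      with upper show ?thesis by linarith
    qed
    have "emeasure ?N B = (\<Sum>i. emeasure ?N (A i))" using sN[OF AP] by simp
    also have "\<dots> \<le> (\<Sum>i. ennreal (norm (D (A i))) + ennreal (2 * \<epsilon>) * emeasure M (A i))"
    proof (intro suminf_le)
      fix i
      have "emeasure ?N (A i) \<le> ennreal (norm (D (A i)) + 2 * \<epsilon> * measure M (A i))"
        unfolding N[OF setsR[OF A1]] by (rule ennreal_leI[OF cell])
      then show "emeasure ?N (A i) \<le> ennreal (norm (D (A i))) + ennreal (2 * \<epsilon>) * emeasure M (A i)"
        using \<epsilon>(1) by (simp add: ennreal_plus ennreal_mult emeasure_eq_measure)
    qed auto
    also have "\<dots> = ?v A + ennreal (2 * \<epsilon>) * (\<Sum>i. emeasure M (A i))"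
      by (subst suminf_add[symmetric]) auto
    also have "(\<Sum>i. emeasure M (A i)) = emeasure M B"
      using AP setsR by (subst suminf_emeasure) (auto simp: image_subset_iff)
    finally have total: "emeasure ?N B \<le> ?v A + ennreal (2 * \<epsilon>) * emeasure M B" .
    have error: "ennreal (2 * \<epsilon>) * emeasure M B \<le> ennreal e"
      using \<epsilon> by (simp add: emeasure_eq_measure ennreal_leI flip: ennreal_mult)
    have "?v A \<le> (SUP A\<in>?P. ?v A)" by (rule SUP_upper[OF AP])
    from order_trans[OF total add_mono[OF this error]]
    show "emeasure ?N B \<le> (SUP A\<in>?P. ?v A) + ennreal e" .
  qed
qed

theorem total_variation_density:
  fixes S :: "'a::euclidean_space \<Rightarrow> 'b::euclidean_space"
  assumes M: "finite_measure M" "sets M = sets borel" and S: "integrable M S"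
    and \<Omega>: "\<Omega> \<in> sets borel"
    and D: "\<And>B. B \<in> sets (restrict_space borel \<Omega>) \<Longrightarrow> D B = set_lebesgue_integral M B S"
  shows "total_variation \<Omega> D = restrict_space (density M (\<lambda>x. ennreal (norm (S x)))) \<Omega>"
proof -
  let ?N = "density M (\<lambda>x. ennreal (norm (S x)))"
  let ?R = "restrict_space ?N \<Omega>"
  have sR: "sets ?R = sets (restrict_space borel \<Omega>)"
    using M by (intro sets_restrict_space_cong) simp
  have spR: "space ?R = \<Omega>" using sets_eq_imp_space_eq[OF M(2)] by (simp add: space_restrict_space)
  have "total_variation \<Omega> D = measure_of \<Omega> (sets (restrict_space borel \<Omega>)) (emeasure ?R)"
    unfolding total_variation_def
  proof (rule measure_of_eq)
    show sub: "sets (restrict_space borel \<Omega>) \<subseteq> Pow \<Omega>" by (auto simp: sets_restrict_space)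
    fix B assume "B \<in> sigma_sets \<Omega> (sets (restrict_space borel \<Omega>))"
    then have B: "B \<in> sets (restrict_space borel \<Omega>)"
      using sets.sigma_sets_eq[of "restrict_space borel \<Omega>"] by (simp add: space_restrict_space)
    then have "B \<subseteq> \<Omega>" using sub by auto
    then have eq: "emeasure ?R B = emeasure ?N B"
      using \<Omega> M sets_eq_imp_space_eq[OF M(2)] by (intro emeasure_restrict_space) auto
    show "(SUP A\<in>{A :: nat \<Rightarrow> 'a set. range A \<subseteq> sets (restrict_space borel \<Omega>) \<and>
                    disjoint_family A \<and> (\<Union>i. A i) = B}. \<Sum>i. ennreal (norm (D (A i)))) = emeasure ?R B"
      unfolding eq by (rule sup_partitions_eq[OF M S \<Omega> B D])
  qed
  also have "\<dots> = ?R"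
    using measure_of_of_measure[of ?R] by (simp add: sR spR)
  finally show ?thesis .
qed

section \<open>The pairing as a limit of mollified pairings\<close>

lemma smooth_shift:
  assumes "smooth f"
  shows "smooth (\<lambda>x. f (x - y))" "dir_deriv v (\<lambda>x. f (x - y)) x = dir_deriv v f (x - y)"
proof -
  note g = smooth_reflect[OF assms, of 0]
  show "smooth (\<lambda>x. f (x - y))" using smooth_reflect[OF g, of y] by simp
  show "dir_deriv v (\<lambda>x. f (x - y)) x = dir_deriv v f (x - y)"
    using dir_deriv_reflect[OF g, of v y x] dir_deriv_reflect[OF assms, of v 0 "y - x"] by simp
qed

text \<open>For fixed \<open>y\<close>, the function \<open>\<phi> x * \<rho>\<^sub>n (x - y)\<close> of \<open>x\<close> is a test function, to which the definition of the weak
derivative applies. The derivative of its second factor falls on \<open>\<zeta>\<close> after the integrals are interchanged, so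
neither \<open>u\<close> nor the mollification of \<open>\<zeta>\<close> is ever differentiated.\<close>

lemma mollified_pairing_identity:
  fixes \<phi> u \<zeta> :: "'a::euclidean_space \<Rightarrow> real"
  assumes \<phi>: "\<phi> \<in> test_functions \<Omega>"
    and M: "sigma_finite_measure M" "sets M = sets borel"
    and f: "weak_deriv \<Omega> M u v f" and u: "integrable lborel u" and \<zeta>: "integrable lborel \<zeta>"
  shows "(LINT x|M. \<phi> x * f x * mollify n \<zeta> x) =
     - (LINT x|lborel. u x * dir_deriv v \<phi> x * mollify n \<zeta> x) - (LINT x|lborel. u x * \<phi> x * mollify_deriv n v \<zeta> x)"
proof -
  interpret sigma_finite_measure M by fact
  interpret P: pair_sigma_finite M lborel ..
  have [measurable_cong]: "sets M = sets borel" by fact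
  have fi: "integrable M f" using f by (simp add: weak_deriv_def)
  have sm: "smooth \<phi>" using \<phi> by (rule test_functions_smooth)
  have [measurable]: "\<phi> \<in> borel_measurable borel" "dir_deriv v \<phi> \<in> borel_measurable borel"
    using smooth_measurable[OF sm] smooth_measurable[OF smooth_dir_deriv[OF sm]] by auto
  obtain D where D: "D > 0" "\<And>x. \<bar>\<phi> x\<bar> \<le> D" using test_functions_bounded[OF \<phi>] by metis
  obtain D' where D': "D' > 0" "\<And>x. \<bar>dir_deriv v \<phi> x\<bar> \<le> D'"
    using test_functions_bounded[OF test_functions_dir_deriv[OF \<phi>]] by metis
  obtain c where c: "c > 0" "\<And>x::'a. \<bar>mollifier n x\<bar> \<le> c" using mollifier_bounded[of n] by metis
  obtain c' where c': "c' > 0" "\<And>x::'a. \<bar>dir_deriv v (mollifier n) x\<bar> \<le> c'"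
    using test_functions_bounded[OF test_functions_dir_deriv[OF mollifier_test_function]] by metis
  have b0: "\<bar>\<phi> x * mollifier n (x - y)\<bar> \<le> D * c" for x y
    unfolding abs_mult using D c by (intro mult_mono) auto
  have b1: "\<bar>dir_deriv v \<phi> x * mollifier n (x - y)\<bar> \<le> D' * c" for x y
    unfolding abs_mult using D' c by (intro mult_mono) auto
  have b2: "\<bar>\<phi> x * dir_deriv v (mollifier n) (x - y)\<bar> \<le> D * c'" for x y
    unfolding abs_mult using D c' by (intro mult_mono) auto
  have k0: "integrable (M \<Otimes>\<^sub>M lborel) (\<lambda>(x, y). f x * \<zeta> y * (\<phi> x * mollifier n (x - y)))"
    by (rule P.integrable_kernel[OF fi \<zeta> _ b0]) measurable
  have k1: "integrable (lborel \<Otimes>\<^sub>M lborel) (\<lambda>(x, y). u x * \<zeta> y * (dir_deriv v \<phi> x * mollifier n (x - y)))"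
    by (rule lborel_pair.integrable_kernel[OF u \<zeta> _ b1]) measurable
  have k2: "integrable (lborel \<Otimes>\<^sub>M lborel) (\<lambda>(x, y). u x * \<zeta> y * (\<phi> x * dir_deriv v (mollifier n) (x - y)))"
    by (rule lborel_pair.integrable_kernel[OF u \<zeta> _ b2]) measurable
  \<comment> \<open>For fixed y, the product of the test function with the shifted mollifier is again a test function.\<close>
  have inner: "(LINT x|M. f x * (\<phi> x * mollifier n (x - y))) =
     - (LINT x|lborel. u x * (dir_deriv v \<phi> x * mollifier n (x - y))) - (LINT x|lborel. u x * (\<phi> x * dir_deriv v (mollifier n) (x - y)))" for y
  proof -
    let ?\<rho> = "\<lambda>x. mollifier n (x - y)"
    have \<rho>: "smooth ?\<rho>" by (rule smooth_shift(1)[OF smooth_mollifier])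
    have "(LINT x|lborel. u x * dir_deriv v (\<lambda>x. \<phi> x * ?\<rho> x) x) = - (LINT x|M. (\<phi> x * ?\<rho> x) * f x)"
      using f test_functions_mult[OF \<phi> \<rho>] by (simp add: weak_deriv_def)
    moreover have "dir_deriv v (\<lambda>x. \<phi> x * ?\<rho> x) x = \<phi> x * dir_deriv v (mollifier n) (x - y) + dir_deriv v \<phi> x * ?\<rho> x" for x
      by (subst dir_deriv_mult) (auto intro!: smooth_differentiable sm \<rho> simp: smooth_shift(2)[OF smooth_mollifier])
    ultimately have "(LINT x|M. f x * (\<phi> x * ?\<rho> x)) =
      - (LINT x|lborel. u x * (dir_deriv v \<phi> x * ?\<rho> x) + u x * (\<phi> x * dir_deriv v (mollifier n) (x - y)))"
      by (simp add: algebra_simps)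
    also have "(LINT x|lborel. u x * (dir_deriv v \<phi> x * ?\<rho> x) + u x * (\<phi> x * dir_deriv v (mollifier n) (x - y))) =
        (LINT x|lborel. u x * (dir_deriv v \<phi> x * ?\<rho> x)) + (LINT x|lborel. u x * (\<phi> x * dir_deriv v (mollifier n) (x - y)))"
    proof (rule Bochner_Integration.integral_add)
      show "integrable lborel (\<lambda>x. u x * (dir_deriv v \<phi> x * ?\<rho> x))"
        by (rule integrable_mult_bounded(1)[OF u _ b1]) simp
      show "integrable lborel (\<lambda>x. u x * (\<phi> x * dir_deriv v (mollifier n) (x - y)))"
        by (rule integrable_mult_bounded(1)[OF u _ b2]) simp
    qed
    finally show ?thesis by simp
  qed
  have "(LINT x|M. \<phi> x * f x * mollify n \<zeta> x) = (LINT x|M. (LINT y|lborel. f x * \<zeta> y * (\<phi> x * mollifier n (x - y))))"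
    unfolding mollify_def by (simp add: mult_ac flip: integral_mult_right_zero)
  also have "\<dots> = (LINT y|lborel. (LINT x|M. f x * \<zeta> y * (\<phi> x * mollifier n (x - y))))"
    by (rule P.Fubini_integral[OF k0, symmetric])
  also have "\<dots> = (LINT y|lborel. \<zeta> y * (LINT x|M. f x * (\<phi> x * mollifier n (x - y))))"
    by (simp add: mult_ac flip: integral_mult_right_zero)
  also have "\<dots> = (LINT y|lborel. - (LINT x|lborel. u x * \<zeta> y * (dir_deriv v \<phi> x * mollifier n (x - y)))
      - (LINT x|lborel. u x * \<zeta> y * (\<phi> x * dir_deriv v (mollifier n) (x - y))))"
    unfolding inner by (simp add: mult_ac right_diff_distrib flip: integral_mult_right_zero)
  also have "\<dots> = - (LINT y|lborel. (LINT x|lborel. u x * \<zeta> y * (dir_deriv v \<phi> x * mollifier n (x - y))))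
      - (LINT y|lborel. (LINT x|lborel. u x * \<zeta> y * (\<phi> x * dir_deriv v (mollifier n) (x - y))))"
    using lborel_pair.integrable_snd[OF k1] lborel_pair.integrable_snd[OF k2] by simp
  also have "(LINT y|lborel. (LINT x|lborel. u x * \<zeta> y * (dir_deriv v \<phi> x * mollifier n (x - y))))
      = (LINT x|lborel. (LINT y|lborel. u x * \<zeta> y * (dir_deriv v \<phi> x * mollifier n (x - y))))"
    by (rule lborel_pair.Fubini_integral[OF k1])
  also have "\<dots> = (LINT x|lborel. u x * dir_deriv v \<phi> x * mollify n \<zeta> x)"
    unfolding mollify_def by (simp add: mult_ac flip: integral_mult_right_zero)
  also have "(LINT y|lborel. (LINT x|lborel. u x * \<zeta> y * (\<phi> x * dir_deriv v (mollifier n) (x - y))))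
      = (LINT x|lborel. (LINT y|lborel. u x * \<zeta> y * (\<phi> x * dir_deriv v (mollifier n) (x - y))))"
    by (rule lborel_pair.Fubini_integral[OF k2])
  also have "\<dots> = (LINT x|lborel. u x * \<phi> x * mollify_deriv n v \<zeta> x)"
    unfolding mollify_deriv_def by (simp add: mult_ac flip: integral_mult_right_zero)
  finally show ?thesis .
qed

lemma mollify_bounded_by:
  assumes g: "integrable lborel g" and C: "\<And>x. \<bar>g x\<bar> \<le> C"
  shows "\<bar>mollify n g x\<bar> \<le> C"
proof -
  have "\<bar>mollify n g x\<bar> \<le> (LINT y|lborel. C * mollifier n (x - y))"
    unfolding mollify_def
  proof (rule order_trans[OF integral_abs_bound integral_mono])
    show "integrable lborel (\<lambda>y. \<bar>g y * mollifier n (x - y)\<bar>)"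
      by (intro integrable_abs mollify_integrand_integrable g)
    show "integrable lborel (\<lambda>y. C * mollifier n (x - y))"
      by (intro integrable_mult_right integrable_mollifier_reflect)
    show "\<bar>g y * mollifier n (x - y)\<bar> \<le> C * mollifier n (x - y)" for y
      by (simp add: abs_mult mollifier_nonneg mult_right_mono C)
  qed
  then show ?thesis by (simp add: mollifier_reflect_integral)
qed

lemma mollify_bounded:
  assumes "integrable lborel \<zeta>"
  obtains C where "\<And>x::'a::euclidean_space. \<bar>mollify n \<zeta> x\<bar> \<le> C"
proof -
  obtain c where c: "c > 0" "\<And>x::'a. \<bar>mollifier n x\<bar> \<le> c" using mollifier_bounded[of n] by metis
  have "\<bar>mollify n \<zeta> x\<bar> \<le> c * (LINT x|lborel. \<bar>\<zeta> x\<bar>)" for x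
    unfolding mollify_def by (rule kernel_integral_bound) (use assms c in auto)
  then show thesis by (rule that)
qed

lemma mollify_deriv_bounded:
  assumes "integrable lborel \<zeta>"
  obtains C where "\<And>x::'a::euclidean_space. \<bar>mollify_deriv n v \<zeta> x\<bar> \<le> C"
proof -
  obtain c where c: "c > 0" "\<And>x::'a. \<bar>dir_deriv v (mollifier n) x\<bar> \<le> c"
    using test_functions_bounded[OF test_functions_dir_deriv[OF mollifier_test_function]] by metis
  have "\<bar>mollify_deriv n v \<zeta> x\<bar> \<le> c * (LINT x|lborel. \<bar>\<zeta> x\<bar>)" for x
    unfolding mollify_deriv_def by (rule kernel_integral_bound) (use assms c in auto)
  then show thesis by (rule that)
qed

text \<open>The function \<open>y \<mapsto> \<rho>\<^sub>n (x - y)\<close> is used as a test function for the divergence; its gradient in \<open>y\<close> is minus the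
gradient of \<open>\<rho>\<^sub>n\<close> at \<open>x - y\<close>.\<close>

lemma mollify_weak_divergence:
  fixes z :: "'a::euclidean_space \<Rightarrow> 'a \<Rightarrow> real"
  assumes z: "\<And>b. b \<in> Basis \<Longrightarrow> integrable lborel (z b)"
    and div: "\<And>\<psi>. \<psi> \<in> test_functions \<Omega> \<Longrightarrow>
      (LINT x|lborel. (\<Sum>b\<in>Basis. z b x * dir_deriv b \<psi> x)) = - (LINT x|lborel. d x * \<psi> x)"
    and x: "(\<lambda>y. mollifier n (x - y)) \<in> test_functions \<Omega>"
  shows "(\<Sum>b\<in>Basis. mollify_deriv n b (z b) x) = mollify n d x"
proof -
  have i: "integrable lborel (\<lambda>y. z b y * dir_deriv b (mollifier n) (x - y))" if "b \<in> Basis" for b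
  proof -
    obtain c where c: "c > 0" "\<And>x::'a. \<bar>dir_deriv b (mollifier n) x\<bar> \<le> c"
      using test_functions_bounded[OF test_functions_dir_deriv[OF mollifier_test_function]] by metis
    show ?thesis by (rule integrable_mult_bounded(1)[OF z[OF that] _ c(2)]) simp
  qed
  have "(\<Sum>b\<in>Basis. mollify_deriv n b (z b) x) = (LINT y|lborel. (\<Sum>b\<in>Basis. z b y * dir_deriv b (mollifier n) (x - y)))"
    unfolding mollify_deriv_def using i by (subst Bochner_Integration.integral_sum) auto
  also have "\<dots> = - (LINT y|lborel. (\<Sum>b\<in>Basis. z b y * dir_deriv b (\<lambda>y. mollifier n (x - y)) y))"
    by (simp add: dir_deriv_reflect smooth_mollifier sum_negf)
  also have "\<dots> = mollify n d x" unfolding div[OF x] mollify_def by simp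
  finally show ?thesis .
qed

text \<open>The directions in \<open>I\<close> are those in which the derivative of \<open>u\<close> is a measure, the directions in \<open>J\<close> those in which it is a
function. Summing \<open>mollified_pairing_identity\<close> over all directions, the last terms combine to the mollified
divergence, and everything except the integral against \<open>M\<close> converges because of the conjugate exponents.\<close>

theorem mollified_pairing_limit:
  fixes u :: "'a::euclidean_space \<Rightarrow> real" and z f g :: "'a \<Rightarrow> 'a \<Rightarrow> real"
  assumes \<Omega>: "open \<Omega>" and \<phi>: "\<phi> \<in> test_functions \<Omega>"
    and M: "finite_measure M" "sets M = sets borel"
    and Basis: "Basis = I \<union> J" "I \<inter> J = {}"
    and u: "integrable lborel u"
    and f: "\<And>b. b \<in> I \<Longrightarrow> weak_deriv \<Omega> M u b (f b)"
    and g: "\<And>b. b \<in> J \<Longrightarrow> weak_deriv \<Omega> lborel u b (g b)"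
    and div: "\<And>\<psi>. \<psi> \<in> test_functions \<Omega> \<Longrightarrow>
      (LINT x|lborel. (\<Sum>b\<in>Basis. z b x * dir_deriv b \<psi> x)) = - (LINT x|lborel. d x * \<psi> x)"
    and uz: "\<And>b. b \<in> Basis \<Longrightarrow> young_pair u (z b)" and ud: "young_pair u d"
    and gz: "\<And>b. b \<in> J \<Longrightarrow> young_pair (g b) (z b)"
  shows "(\<lambda>n. LINT x|M. \<phi> x * (\<Sum>b\<in>I. f b x * mollify n (z b) x)) \<longlonglongrightarrow>
    - (LINT x|lborel. u x * \<phi> x * d x) - (\<Sum>b\<in>Basis. LINT x|lborel. u x * (z b x * dir_deriv b \<phi> x))
    - (\<Sum>b\<in>J. LINT x|lborel. \<phi> x * (z b x * g b x))"
proof -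
  interpret finite_measure M by fact
  have [measurable_cong]: "sets M = sets borel" by fact
  have fin: "finite I" "finite J" using finite_Basis[where 'a='a] unfolding Basis(1) by auto
  have z: "integrable lborel (z b)" if "b \<in> Basis" for b using uz[OF that] by (simp add: young_pair_def)
  obtain K where K: "smooth \<phi>" "compact K" "K \<subseteq> \<Omega>" "\<And>x. x \<notin> K \<Longrightarrow> \<phi> x = 0"
    using \<phi> by (auto elim: test_functionsE)
  have [measurable]: "\<phi> \<in> borel_measurable borel" using smooth_measurable[OF K(1)] .
  have d\<phi>m: "dir_deriv v \<phi> \<in> borel_measurable borel" for v
    using smooth_measurable[OF smooth_dir_deriv[OF K(1)]] .
  obtain D where D: "D > 0" "\<And>x. \<bar>\<phi> x\<bar> \<le> D" using test_functions_bounded[OF \<phi>] by metis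
  have d\<phi>b: "\<exists>C. \<forall>x. \<bar>dir_deriv v \<phi> x\<bar> \<le> C" for v
    using test_functions_bounded[OF test_functions_dir_deriv[OF \<phi>]] by metis
  obtain N where N: "\<And>n x. n \<ge> N \<Longrightarrow> x \<in> K \<Longrightarrow> (\<lambda>y. mollifier n (x - y)) \<in> test_functions \<Omega>"
    using mollifier_inside_test[OF K(2,3) \<Omega>] by metis
  let ?R = "\<lambda>n. - (LINT x|lborel. \<phi> x * u x * mollify n d x)
      - (\<Sum>b\<in>Basis. LINT x|lborel. dir_deriv b \<phi> x * u x * mollify n (z b) x)
      - (\<Sum>b\<in>J. LINT x|lborel. \<phi> x * g b x * mollify n (z b) x)"
  have yd: "young_pair (\<lambda>x. dir_deriv b \<phi> x * u x) (z b)" if "b \<in> Basis" for b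
    using d\<phi>b[of b] young_pair_mult[OF uz[OF that] d\<phi>m] by blast
  have lim: "?R \<longlonglongrightarrow> - (LINT x|lborel. (\<phi> x * u x) * d x)
      - (\<Sum>b\<in>Basis. LINT x|lborel. (dir_deriv b \<phi> x * u x) * z b x)
      - (\<Sum>b\<in>J. LINT x|lborel. (\<phi> x * g b x) * z b x)"
    by (intro tendsto_diff tendsto_minus tendsto_sum young_pair_mollify yd
        young_pair_mult[OF ud _ D(2)] young_pair_mult[OF gz _ D(2)]) auto
  have "(LINT x|M. \<phi> x * (\<Sum>b\<in>I. f b x * mollify n (z b) x)) = ?R n" if n: "n \<ge> N" for n
  proof -
    have I: "b \<in> Basis" if "b \<in> I" for b using that Basis by auto
    have J: "b \<in> Basis" if "b \<in> J" for b using that Basis by auto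
    have fi: "integrable M (f b)" if "b \<in> I" for b using f[OF that] by (simp add: weak_deriv_def)
    have zm: "mollify n (z b) \<in> borel_measurable borel" if "b \<in> Basis" for b
      using z[OF that] by (auto intro!: mollify_measurable)
    have i1: "integrable M (\<lambda>x. \<phi> x * f b x * mollify n (z b) x)" if b: "b \<in> I" for b
    proof -
      obtain C where C: "\<And>x. \<bar>mollify n (z b) x\<bar> \<le> C" using mollify_bounded[OF z[OF I[OF b]]] by metis
      have "integrable M (\<lambda>x. \<phi> x * f b x)" by (rule integrable_mult_bounded(2)[OF fi[OF that] _ D(2)]) simp
      then show ?thesis by (rule integrable_mult_bounded(1)[OF _ _ C]) (use zm[OF I[OF that]] M in simp)
    qed
    have "(LINT x|M. \<phi> x * (\<Sum>b\<in>I. f b x * mollify n (z b) x)) = (\<Sum>b\<in>I. LINT x|M. \<phi> x * f b x * mollify n (z b) x)"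
      using i1 by (subst Bochner_Integration.integral_sum[symmetric]) (auto simp: sum_distrib_left mult_ac)
    also have "\<dots> = (\<Sum>b\<in>I. - (LINT x|lborel. u x * dir_deriv b \<phi> x * mollify n (z b) x)
        - (LINT x|lborel. u x * \<phi> x * mollify_deriv n b (z b) x))"
      using f z I by (intro sum.cong refl mollified_pairing_identity[OF \<phi> sigma_finite_measure_axioms M(2) _ u]) auto
    finally have 1: "(LINT x|M. \<phi> x * (\<Sum>b\<in>I. f b x * mollify n (z b) x)) = \<dots>" .
    have 2: "(\<Sum>b\<in>J. LINT x|lborel. \<phi> x * g b x * mollify n (z b) x) = (\<Sum>b\<in>J. - (LINT x|lborel. u x * dir_deriv b \<phi> x * mollify n (z b) x)
        - (LINT x|lborel. u x * \<phi> x * mollify_deriv n b (z b) x))"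
      using g z J by (intro sum.cong refl mollified_pairing_identity[OF \<phi> lborel.sigma_finite_measure_axioms _ _ u]) auto
    have i2: "integrable lborel (\<lambda>x. u x * \<phi> x * mollify_deriv n b (z b) x)" if b: "b \<in> Basis" for b
    proof -
      obtain C where C: "\<And>x. \<bar>mollify_deriv n b (z b) x\<bar> \<le> C" using mollify_deriv_bounded[OF z[OF b]] by metis
      have "integrable lborel (\<lambda>x. u x * \<phi> x)" by (rule integrable_mult_bounded(1)[OF u _ D(2)]) simp
      then show ?thesis
        by (rule integrable_mult_bounded(1)[OF _ _ C]) (use z[OF that] in \<open>auto intro!: mollify_deriv_measurable\<close>)
    qed
    have "(\<Sum>b\<in>Basis. LINT x|lborel. u x * \<phi> x * mollify_deriv n b (z b) x)
        = (LINT x|lborel. u x * \<phi> x * (\<Sum>b\<in>Basis. mollify_deriv n b (z b) x))"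
      using i2 by (subst Bochner_Integration.integral_sum[symmetric]) (auto simp: sum_distrib_left)
    also have "\<dots> = (LINT x|lborel. \<phi> x * u x * mollify n d x)"
    proof (intro Bochner_Integration.integral_cong refl)
      fix x
      show "u x * \<phi> x * (\<Sum>b\<in>Basis. mollify_deriv n b (z b) x) = \<phi> x * u x * mollify n d x"
      proof (cases "x \<in> K")
        case True
        then have "(\<Sum>b\<in>Basis. mollify_deriv n b (z b) x) = mollify n d x"
          by (intro mollify_weak_divergence[OF z div N[OF n]]) auto
        then show ?thesis by simp
      qed (simp add: K)
    qed
    finally have 3: "(\<Sum>b\<in>Basis. LINT x|lborel. u x * \<phi> x * mollify_deriv n b (z b) x) = \<dots>" .
    have split: "(\<Sum>b\<in>Basis. F b) = (\<Sum>b\<in>I. F b) + (\<Sum>b\<in>J. F b)" for F :: "'a \<Rightarrow> real"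
      unfolding Basis(1) using fin Basis(2) by (rule sum.union_disjoint)
    have "(LINT x|M. \<phi> x * (\<Sum>b\<in>I. f b x * mollify n (z b) x)) + (\<Sum>b\<in>J. LINT x|lborel. \<phi> x * g b x * mollify n (z b) x)
       = - (\<Sum>b\<in>Basis. LINT x|lborel. u x * dir_deriv b \<phi> x * mollify n (z b) x)
         - (\<Sum>b\<in>Basis. LINT x|lborel. u x * \<phi> x * mollify_deriv n b (z b) x)"
      unfolding 1 2 split by (simp add: sum_subtractf sum_negf)
    then show ?thesis unfolding 3 by (simp add: mult.commute[of "u _"])
  qed
  then have "\<forall>\<^sub>F n in sequentially. ?R n = (LINT x|M. \<phi> x * (\<Sum>b\<in>I. f b x * mollify n (z b) x))"
    by (intro eventually_mono[OF eventually_ge_at_top[of N]]) simp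
  from Lim_transform_eventually[OF lim this] show ?thesis by (simp add: mult_ac)
qed

text \<open>The weak limit \<open>\<theta>\<close> is taken once, for the functions \<open>(\<Sum>b\<in>I. f b * \<rho>\<^sub>n * z b) / N\<close>, which involve only the direction of the
vector \<open>f\<close>. It then yields the pairing for every function whose derivative is a scalar multiple \<open>h\<close> of \<open>f\<close>.\<close>

theorem pairing_densities:
  fixes u uT :: "'a::euclidean_space \<Rightarrow> real" and z f g :: "'a \<Rightarrow> 'a \<Rightarrow> real"
  assumes \<Omega>: "open \<Omega>"
    and M: "finite_measure M" "sets M = sets borel"
    and Basis: "Basis = I \<union> J" "I \<inter> J = {}"
    and div: "\<And>\<psi>. \<psi> \<in> test_functions \<Omega> \<Longrightarrow>
      (LINT x|lborel. (\<Sum>b\<in>Basis. z b x * dir_deriv b \<psi> x)) = - (LINT x|lborel. d x * \<psi> x)"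
    and z: "\<And>b. b \<in> I \<Longrightarrow> integrable lborel (z b)"
    and fm: "\<And>b. b \<in> I \<Longrightarrow> f b \<in> borel_measurable borel"
    and bounded: "\<And>b x. b \<in> I \<Longrightarrow> \<bar>z b x\<bar> \<le> C"
    and N: "integrable M N" "\<And>x. 0 \<le> N x" "\<And>b x. b \<in> I \<Longrightarrow> \<bar>f b x\<bar> \<le> N x"
  obtains \<theta> C' where "\<theta> \<in> borel_measurable borel" "\<And>x. \<bar>\<theta> x\<bar> \<le> C'"
    "\<And>u g h \<phi> L. \<phi> \<in> test_functions \<Omega> \<Longrightarrow> h \<in> borel_measurable borel \<Longrightarrow> (\<And>x. \<bar>h x\<bar> \<le> L) \<Longrightarrow>
      integrable lborel u \<Longrightarrow>
      (\<And>b. b \<in> I \<Longrightarrow> weak_deriv \<Omega> M u b (\<lambda>x. h x * f b x)) \<Longrightarrow>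
      (\<And>b. b \<in> J \<Longrightarrow> weak_deriv \<Omega> lborel u b (g b)) \<Longrightarrow>
      (\<And>b. b \<in> Basis \<Longrightarrow> young_pair u (z b)) \<Longrightarrow> young_pair u d \<Longrightarrow>
      (\<And>b. b \<in> J \<Longrightarrow> young_pair (g b) (z b)) \<Longrightarrow>
      - (LINT x|lborel. u x * \<phi> x * d x) - (\<Sum>b\<in>Basis. LINT x|lborel. u x * (z b x * dir_deriv b \<phi> x))
      - (\<Sum>b\<in>J. LINT x|lborel. \<phi> x * (z b x * g b x)) = (LINT x|M. \<phi> x * (h x * N x) * \<theta> x)"
proof -
  have [measurable_cong]: "sets M = sets borel" by fact
  define c where "c = card I * \<bar>C\<bar>"
  have c0: "c \<ge> 0" by (simp add: c_def)
  define k where "k n x = (\<Sum>b\<in>I. f b x * mollify n (z b) x) / N x" for n x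
  \<comment> \<open>Where \<open>N\<close> vanishes, so does every \<open>f b\<close>, and the default value \<open>0\<close> of the quotient is the right one.\<close>
  have k_mult: "N x * k n x = (\<Sum>b\<in>I. f b x * mollify n (z b) x)" for n x
    using N(3)[of _ x] by (cases "N x = 0") (auto simp: k_def)
  have kb: "\<bar>k n x\<bar> \<le> c" for n x
  proof (cases "N x = 0")
    case False
    then have pos: "N x > 0" using N(2)[of x] by simp
    have "\<bar>\<Sum>b\<in>I. f b x * mollify n (z b) x\<bar> \<le> (\<Sum>b\<in>I. N x * \<bar>C\<bar>)"
    proof (rule order_trans[OF sum_abs sum_mono])
      fix b assume b: "b \<in> I"
      have "\<bar>mollify n (z b) x\<bar> \<le> \<bar>C\<bar>"
        using mollify_bounded_by[OF z[OF b] bounded[OF b], of n x] by linarith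
      then show "\<bar>f b x * mollify n (z b) x\<bar> \<le> N x * \<bar>C\<bar>"
        unfolding abs_mult using N(2,3)[of x] N(3)[OF b] by (intro mult_mono) auto
    qed
    also have "\<dots> = c * N x" by (simp add: c_def)
    finally show ?thesis using pos by (simp add: k_def field_simps)
  qed (simp add: k_def c0)
  have km: "k n \<in> borel_measurable M" for n
  proof -
    have [measurable]: "N \<in> borel_measurable borel" using borel_measurable_integrable[OF N(1)] M by simp
    have "(\<lambda>x. f b x * mollify n (z b) x) \<in> borel_measurable borel" if "b \<in> I" for b
      using fm[OF that] z[OF that] by (auto intro!: borel_measurable_times mollify_measurable)
    then show ?thesis unfolding k_def[abs_def] by measurable
  qed
  obtain \<theta> where \<theta>: "\<theta> \<in> borel_measurable M" "\<And>x. - c \<le> \<theta> x" "\<And>x. \<theta> x \<le> c"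
    "\<And>\<psi> l. integrable M \<psi> \<Longrightarrow> (\<lambda>n. LINT x|M. \<psi> x * k n x) \<longlonglongrightarrow> l \<Longrightarrow> (LINT x|M. \<psi> x * \<theta> x) = l"
  proof (rule bounded_weak_limit[where f = k and a = "- c" and b = c, OF M(1)])
    show "k n \<in> borel_measurable M" for n by (rule km)
    show "- c \<le> k n x \<and> k n x \<le> c" for n x using kb[of n x] by (simp add: abs_le_iff)
  qed (use c0 in auto)
  show thesis
  proof (rule that[of \<theta> c])
    show "\<theta> \<in> borel_measurable borel" using \<theta>(1) M by simp
    show "\<bar>\<theta> x\<bar> \<le> c" for x using \<theta>(2,3)[of x] by (simp add: abs_le_iff)
    fix u g h \<phi> L
    assume \<phi>: "\<phi> \<in> test_functions \<Omega>" and h: "h \<in> borel_measurable borel" "\<And>x. \<bar>h x\<bar> \<le> L"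
      and u: "integrable lborel u"
      and f: "\<And>b. b \<in> I \<Longrightarrow> weak_deriv \<Omega> M u b (\<lambda>x. h x * f b x)"
      and g: "\<And>b. b \<in> J \<Longrightarrow> weak_deriv \<Omega> lborel u b (g b)"
      and y: "\<And>b. b \<in> Basis \<Longrightarrow> young_pair u (z b)" "young_pair u d" "\<And>b. b \<in> J \<Longrightarrow> young_pair (g b) (z b)"
    have \<phi>m: "\<phi> \<in> borel_measurable borel" using \<phi> by (simp add: test_functions_smooth)
    obtain D where D: "D > 0" "\<And>x. \<bar>\<phi> x\<bar> \<le> D" using test_functions_bounded[OF \<phi>] by metis
    have "integrable M (\<lambda>x. h x * N x)"
      by (rule integrable_mult_bounded(2)[OF N(1) _ h(2)]) (use h(1) in simp)
    then have "integrable M (\<lambda>x. \<phi> x * (h x * N x))"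
      by (rule integrable_mult_bounded(2)[OF _ _ D(2)]) (use \<phi>m in simp)
    moreover have "(\<lambda>n. LINT x|M. \<phi> x * (h x * N x) * k n x) \<longlonglongrightarrow>
      - (LINT x|lborel. u x * \<phi> x * d x) - (\<Sum>b\<in>Basis. LINT x|lborel. u x * (z b x * dir_deriv b \<phi> x))
      - (\<Sum>b\<in>J. LINT x|lborel. \<phi> x * (z b x * g b x))"
    proof -
      have eq: "\<phi> x * (h x * N x) * k n x = \<phi> x * (\<Sum>b\<in>I. h x * f b x * mollify n (z b) x)" for n x
        using k_mult[of x n] by (simp add: mult.assoc flip: sum_distrib_left)
      show ?thesis
        unfolding eq by (rule mollified_pairing_limit[OF \<Omega> \<phi> M Basis u f g div y])
    qed
    ultimately show "- (LINT x|lborel. u x * \<phi> x * d x) - (\<Sum>b\<in>Basis. LINT x|lborel. u x * (z b x * dir_deriv b \<phi> x))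
      - (\<Sum>b\<in>J. LINT x|lborel. \<phi> x * (z b x * g b x)) = (LINT x|M. \<phi> x * (h x * N x) * \<theta> x)"
      using \<theta>(4) by presburger
  qed
qed

section \<open>Borel representatives and Lebesgue exponents\<close>

lemma borel_representative:
  fixes f :: "'a::euclidean_space \<Rightarrow> real"
  assumes \<Omega>: "\<Omega> \<in> sets borel" and f: "f \<in> borel_measurable (lebesgue_on \<Omega>)"
  obtains g where "g \<in> borel_measurable borel" "\<And>x. x \<notin> \<Omega> \<Longrightarrow> g x = 0" "AE x in lborel. x \<in> \<Omega> \<longrightarrow> g x = f x"
proof -
  have "(\<lambda>x. indicator \<Omega> x *\<^sub>R f x) \<in> borel_measurable lebesgue"
    using f \<Omega> by (subst (asm) borel_measurable_restrict_space_iff) auto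
  then obtain g where g: "g \<in> borel_measurable lborel" "AE x in lborel. indicator \<Omega> x *\<^sub>R f x = g x"
    using completion_ex_borel_measurable_real by blast
  show thesis
  proof (rule that[of "\<lambda>x. indicator \<Omega> x * g x"])
    show "(\<lambda>x. indicator \<Omega> x * g x) \<in> borel_measurable borel" using g(1) \<Omega> by auto
    show "AE x in lborel. x \<in> \<Omega> \<longrightarrow> indicator \<Omega> x * g x = f x"
      using g(2) by eventually_elim auto
  qed auto
qed

lemma lebesgue_on_representative:
  fixes F G :: "'a::euclidean_space \<Rightarrow> real"
  assumes \<Omega>: "\<Omega> \<in> sets borel" and G: "G \<in> borel_measurable borel" "\<And>x. x \<notin> \<Omega> \<Longrightarrow> G x = 0"
    and eq: "AE x in lborel. x \<in> \<Omega> \<longrightarrow> G x = F x"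
  shows "integrable (lebesgue_on \<Omega>) F \<longleftrightarrow> integrable lborel G"
    and "(LINT x|lebesgue_on \<Omega>. F x) = (LINT x|lborel. G x)"
proof -
  let ?F = "\<lambda>x. indicator \<Omega> x *\<^sub>R F x"
  have AE: "AE x in lebesgue. G x = ?F x"
    by (rule AE_completion) (use eq G(2) in \<open>auto elim!: eventually_mono split: split_indicator\<close>)
  have Gm: "G \<in> borel_measurable lebesgue" using G(1) by (intro measurable_completion) simp
  have Fm: "?F \<in> borel_measurable lebesgue" using borel_measurable_AE[OF Gm AE] .
  have "integrable (lebesgue_on \<Omega>) F \<longleftrightarrow> integrable lebesgue ?F"
    using \<Omega> by (intro integrable_restrict_space) auto
  also have "\<dots> \<longleftrightarrow> integrable lebesgue G"
    using AE Fm Gm by (intro integrable_cong_AE) auto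
  also have "\<dots> \<longleftrightarrow> integrable lborel G"
    using G(1) by (intro integrable_completion) simp
  finally show "integrable (lebesgue_on \<Omega>) F \<longleftrightarrow> integrable lborel G" .
  have "(LINT x|lebesgue_on \<Omega>. F x) = (LINT x|lebesgue. ?F x)"
    using \<Omega> by (intro integral_restrict_space) auto
  also have "\<dots> = (LINT x|lebesgue. G x)"
    using AE Fm Gm by (intro integral_cong_AE) auto
  also have "\<dots> = (LINT x|lborel. G x)"
    using G(1) by (intro integral_completion) simp
  finally show "(LINT x|lebesgue_on \<Omega>. F x) = (LINT x|lborel. G x)" .
qed

lemma AE_lebesgue_on_iff:
  assumes "\<Omega> \<in> sets borel"
  shows "(AE x in lebesgue_on \<Omega>. P x) \<longleftrightarrow> (AE x in lborel. x \<in> \<Omega> \<longrightarrow> P x)"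
  using assms by (subst AE_restrict_space_iff) (auto simp: AE_completion_iff)

text \<open>Membership in \<open>L\<^sup>r\<close> for Borel functions on the whole space. For \<open>r = \<infinity>\<close> the bound is required everywhere, which a
suitable representative satisfies.\<close>

definition power_integrable :: "ennreal \<Rightarrow> ('a::euclidean_space \<Rightarrow> real) \<Rightarrow> bool" where
  "power_integrable r g \<longleftrightarrow>
     (if r = \<infinity> then \<exists>C. \<forall>x. \<bar>g x\<bar> \<le> C else integrable lborel (\<lambda>x. \<bar>g x\<bar> powr enn2real r))"

lemma Lspace_component_representative:
  fixes F :: "'a::euclidean_space \<Rightarrow> 'b::euclidean_space"
  assumes \<Omega>: "\<Omega> \<in> sets borel" and F: "F \<in> Lspace r \<Omega>" and w: "norm w \<le> 1"
  obtains g where "g \<in> borel_measurable borel" "\<And>x. x \<notin> \<Omega> \<Longrightarrow> g x = 0"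
    "AE x in lborel. x \<in> \<Omega> \<longrightarrow> g x = F x \<bullet> w" "power_integrable r g"
proof -
  have Fm: "F \<in> borel_measurable (lebesgue_on \<Omega>)" using F by (simp add: Lspace_def)
  then have Fwm: "(\<lambda>x. F x \<bullet> w) \<in> borel_measurable (lebesgue_on \<Omega>)" by simp
  have le: "\<bar>F x \<bullet> w\<bar> \<le> norm (F x)" for x
    using Cauchy_Schwarz_ineq2[of "F x" w] mult_left_mono[OF w norm_ge_zero[of "F x"]] by simp
  obtain g where g: "g \<in> borel_measurable borel" "\<And>x. x \<notin> \<Omega> \<Longrightarrow> g x = 0" "AE x in lborel. x \<in> \<Omega> \<longrightarrow> g x = F x \<bullet> w"
    by (rule borel_representative[OF \<Omega> Fwm]) blast
  show thesis
  proof (cases "r = \<infinity>")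
    case True
    obtain C where "AE x in lebesgue_on \<Omega>. norm (F x) \<le> C" using F True by (auto simp: Lspace_def)
    then have C: "AE x in lborel. x \<in> \<Omega> \<longrightarrow> norm (F x) \<le> C" using \<Omega> by (simp add: AE_lebesgue_on_iff)
    let ?g = "\<lambda>x. if \<bar>g x\<bar> \<le> C then g x else 0"
    show thesis
    proof (rule that[of ?g])
      show "?g \<in> borel_measurable borel" using g(1) by measurable
      show "AE x in lborel. x \<in> \<Omega> \<longrightarrow> ?g x = F x \<bullet> w"
        using C g(3)
      proof eventually_elim
        case (elim x)
        then show ?case using le[of x] by auto
      qed
      have "\<bar>?g x\<bar> \<le> max C 0" for x by auto
      then have "\<exists>C. \<forall>x. \<bar>?g x\<bar> \<le> C" by blast
      then show "power_integrable r ?g" by (simp only: power_integrable_def True if_True simp_thms)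
    qed (use g in auto)
  next
    case False
    have i: "integrable (lebesgue_on \<Omega>) (\<lambda>x. norm (F x) powr enn2real r)" using F False by (simp add: Lspace_def)
    have "integrable (lebesgue_on \<Omega>) (\<lambda>x. \<bar>F x \<bullet> w\<bar> powr enn2real r)"
      by (rule Bochner_Integration.integrable_bound[OF i]) (use le Fm in \<open>auto intro!: AE_I2 powr_mono2\<close>)
    moreover have "integrable (lebesgue_on \<Omega>) (\<lambda>x. \<bar>F x \<bullet> w\<bar> powr enn2real r) \<longleftrightarrow> integrable lborel (\<lambda>x. \<bar>g x\<bar> powr enn2real r)"
      by (rule lebesgue_on_representative(1)[OF \<Omega>]) (use g in \<open>auto elim!: eventually_mono\<close>)
    ultimately have "power_integrable r g" using False by (simp add: power_integrable_def)
    from that[OF g this] show thesis .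
  qed
qed

lemma power_integrable_lower:
  assumes g: "g \<in> borel_measurable borel" "\<And>x. x \<notin> \<Omega> \<Longrightarrow> g x = 0"
    and \<Omega>: "\<Omega> \<in> sets borel" "emeasure lborel \<Omega> < \<infinity>"
    and r: "power_integrable r g" and t: "0 < t" "ennreal t \<le> r"
  shows "integrable lborel (\<lambda>x. \<bar>g x\<bar> powr t)"
proof -
  have i\<Omega>: "integrable lborel (indicat_real \<Omega>)" using \<Omega> by (intro integrable_real_indicator) auto
  show ?thesis
  proof (cases "r = \<infinity>")
    case True
    then obtain C where C: "\<And>x. \<bar>g x\<bar> \<le> C" using r by (auto simp: power_integrable_def)
    show ?thesis
    proof (rule Bochner_Integration.integrable_bound[of lborel "\<lambda>x. C powr t * indicat_real \<Omega> x"])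
      show "AE x in lborel. norm (\<bar>g x\<bar> powr t) \<le> norm (C powr t * indicat_real \<Omega> x)"
        using g(2) C t by (auto intro!: AE_I2 powr_mono2 split: split_indicator)
    qed (use i\<Omega> g in auto)
  next
    case False
    then obtain r' where r': "r = ennreal r'" "0 \<le> r'" by (cases r) auto
    have i: "integrable lborel (\<lambda>x. \<bar>g x\<bar> powr r')" using r False r' by (simp add: power_integrable_def)
    have "t \<le> r'" using t r' by simp
    show ?thesis
    proof (rule Bochner_Integration.integrable_bound[of lborel "\<lambda>x. indicat_real \<Omega> x + \<bar>g x\<bar> powr r'"])
      show "AE x in lborel. norm (\<bar>g x\<bar> powr t) \<le> norm (indicat_real \<Omega> x + \<bar>g x\<bar> powr r')"
      proof (rule AE_I2)
        fix x
        show "norm (\<bar>g x\<bar> powr t) \<le> norm (indicat_real \<Omega> x + \<bar>g x\<bar> powr r')"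
        proof (cases "x \<in> \<Omega>")
          case True
          show ?thesis
          proof (cases "\<bar>g x\<bar> \<le> 1")
            case True
            then have "\<bar>g x\<bar> powr t \<le> 1" using t by (intro powr_le1) auto
            then show ?thesis using \<open>x \<in> \<Omega>\<close> by (simp add: add_increasing2)
          next
            case False
            then have "\<bar>g x\<bar> powr t \<le> \<bar>g x\<bar> powr r'" using \<open>t \<le> r'\<close> by (intro powr_mono) auto
            then show ?thesis using \<open>x \<in> \<Omega>\<close> by (simp add: add_increasing)
          qed
        qed (simp add: g(2))
      qed
    qed (use i\<Omega> i g in auto)
  qed
qed

lemma power_integrable_integrable:
  assumes g: "g \<in> borel_measurable borel" "\<And>x. x \<notin> \<Omega> \<Longrightarrow> g x = 0"
    and \<Omega>: "\<Omega> \<in> sets borel" "emeasure lborel \<Omega> < \<infinity>" and r: "power_integrable r g" "1 \<le> r"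
  shows "integrable lborel g"
proof -
  have "integrable lborel (\<lambda>x. \<bar>g x\<bar>)" using power_integrable_lower[OF g \<Omega> r(1), of 1] r(2) by simp
  then show ?thesis using g(1) by (simp add: integrable_abs_iff)
qed

lemma conj_exp_1: "conj_exp 1 = \<infinity>"
  by (simp add: conj_exp_def)

lemma conj_exp_real:
  assumes "1 < p"
  shows "conj_exp (ennreal p) = ennreal (p / (p - 1))"
proof -
  have "1 - inverse (ennreal p) = ennreal (1 - inverse p)"
    using assms by (simp add: inverse_ennreal ennreal_minus flip: ennreal_1)
  then have "conj_exp (ennreal p) = ennreal (inverse (1 - inverse p))"
    using assms by (simp add: conj_exp_def inverse_ennreal field_simps)
  also have "inverse (1 - inverse p) = p / (p - 1)" using assms by (simp add: field_simps)
  finally show ?thesis .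
qed

lemma conj_exp_ge_1: "1 \<le> q \<Longrightarrow> 1 \<le> conj_exp q"
proof (cases q)
  case (real r)
  assume "1 \<le> q"
  then consider "q = 1" | "1 < r" using real by (force simp: ennreal_1[symmetric] simp del: ennreal_1)
  then show ?thesis
  proof cases
    case 2
    then have "1 \<le> r / (r - 1)" by (simp add: field_simps)
    then show ?thesis using 2 real by (simp add: conj_exp_real flip: ennreal_1)
  qed (simp add: conj_exp_1)
qed (simp add: conj_exp_def)

lemma young_pair_exponents:
  assumes F: "F \<in> borel_measurable borel" "\<And>x. x \<notin> \<Omega> \<Longrightarrow> F x = 0"
    and G: "G \<in> borel_measurable borel" "\<And>x. x \<notin> \<Omega> \<Longrightarrow> G x = 0"
    and \<Omega>: "\<Omega> \<in> sets borel" "emeasure lborel \<Omega> < \<infinity>"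
    and p: "1 < p" and r: "power_integrable r F" "ennreal p \<le> r"
    and s: "power_integrable s G" "conj_exp (ennreal p) \<le> s"
  shows "young_pair F G"
proof (rule young_pair_powr)
  have p': "1 < p / (p - 1)" using p by (simp add: field_simps)
  have ps: "ennreal (p / (p - 1)) \<le> s" using s(2) p by (simp add: conj_exp_real)
  have "1 \<le> ennreal p" "1 \<le> ennreal (p / (p - 1))" using p p' by (simp_all flip: ennreal_1)
  from this(1) r(2) this(2) ps have "1 \<le> r" "1 \<le> s" by - (erule (1) order_trans)+
  then show "integrable lborel F" "integrable lborel G"
    using power_integrable_integrable[OF F \<Omega> r(1)] power_integrable_integrable[OF G \<Omega> s(1)] by auto
  show "1 < p" "1 < p / (p - 1)" "1 / p + 1 / (p / (p - 1)) = 1" using p p' by (auto simp: field_simps)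
  show "integrable lborel (\<lambda>x. \<bar>F x\<bar> powr p)" using p r(2) by (intro power_integrable_lower[OF F \<Omega> r(1)]) auto
  show "integrable lborel (\<lambda>x. \<bar>G x\<bar> powr (p / (p - 1)))" using p' ps by (intro power_integrable_lower[OF G \<Omega> s(1)]) auto
qed

text \<open>For \<open>q = 1\<close> the function \<open>G\<close> is bounded and the exponent \<open>p\<close> takes the role of \<open>q\<close>; for \<open>q = \<infinity>\<close> the function \<open>F\<close> is bounded.\<close>

lemma young_pair_max_exponents:
  assumes F: "F \<in> borel_measurable borel" "\<And>x. x \<notin> \<Omega> \<Longrightarrow> F x = 0"
    and G: "G \<in> borel_measurable borel" "\<And>x. x \<notin> \<Omega> \<Longrightarrow> G x = 0"
    and \<Omega>: "\<Omega> \<in> sets borel" "emeasure lborel \<Omega> < \<infinity>"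
    and p: "1 < p" and q: "1 \<le> q" and r: "power_integrable (max (ennreal p) q) F" and s: "power_integrable (conj_exp q) G"
  shows "young_pair F G"
proof (cases q)
  case top
  then obtain C where C: "\<And>x. \<bar>F x\<bar> \<le> C" using r by (auto simp: power_integrable_def max_def top_unique)
  have "1 \<le> max (ennreal p) q" using q by (simp add: le_max_iff_disj)
  then show ?thesis
    using power_integrable_integrable[OF F \<Omega> r] power_integrable_integrable[OF G \<Omega> s conj_exp_ge_1[OF q]] C
    by (intro young_pair_bounded[of F G C]) auto
next
  case (real q')
  then consider "q = 1" | "1 < q'" using q by (force simp: ennreal_1[symmetric] simp del: ennreal_1)
  then show ?thesis
  proof cases
    case 1
    show ?thesis by (rule young_pair_exponents[OF F G \<Omega> p r _ s]) (simp_all add: 1 conj_exp_1)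
  next
    case 2
    show ?thesis by (rule young_pair_exponents[OF F G \<Omega> 2 r _ s]) (simp_all add: real)
  qed
qed

section \<open>Uniqueness of weak derivatives and of representing measures\<close>

lemma locally_integrable_unique:
  fixes f f' :: "'a::euclidean_space \<Rightarrow> 'b::euclidean_space"
  assumes \<Omega>: "open \<Omega>" and f: "locally_integrable \<Omega> f" "locally_integrable \<Omega> f'"
    and eq: "\<And>\<phi> w. \<phi> \<in> test_functions \<Omega> \<Longrightarrow> w \<in> Basis \<Longrightarrow>
      (LINT x|lebesgue_on \<Omega>. (f x \<bullet> w) * \<phi> x) = (LINT x|lebesgue_on \<Omega>. (f' x \<bullet> w) * \<phi> x)"
  shows "AE x in lborel. x \<in> \<Omega> \<longrightarrow> f x = f' x"
proof (rule AE_on_open_if_on_boxes[OF \<Omega>])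
  fix a c assume ac: "cbox a c \<subseteq> \<Omega>"
  have ex: "\<exists>g. integrable lborel g \<and> (\<forall>x. x \<notin> cbox a c \<longrightarrow> g x = 0) \<and>
      (AE x in lborel. x \<in> cbox a c \<longrightarrow> g x = h x \<bullet> w)"
    if h: "locally_integrable \<Omega> h" for h :: "'a \<Rightarrow> 'b" and w
  proof -
    have "integrable lebesgue (\<lambda>x. indicator (cbox a c) x *\<^sub>R h x)"
      using h ac compact_cbox unfolding locally_integrable_def set_integrable_def by blast
    then have "integrable (lebesgue_on (cbox a c)) h"
      by (subst integrable_restrict_space) auto
    then have i: "integrable (lebesgue_on (cbox a c)) (\<lambda>x. h x \<bullet> w)" by simp
    obtain g where g: "g \<in> borel_measurable borel" "\<And>x. x \<notin> cbox a c \<Longrightarrow> g x = 0"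
      "AE x in lborel. x \<in> cbox a c \<longrightarrow> g x = h x \<bullet> w"
      by (rule borel_representative[OF _ borel_measurable_integrable[OF i]]) auto
    have "integrable lborel g"
      using lebesgue_on_representative(1)[OF _ g] i by simp
    then show ?thesis using g by blast
  qed
  have "AE x in lborel. x \<in> box a c \<longrightarrow> f x \<bullet> w = f' x \<bullet> w" if w: "w \<in> Basis" for w
  proof -
    obtain g where g: "integrable lborel g" "\<And>x. x \<notin> cbox a c \<Longrightarrow> g x = 0" "AE x in lborel. x \<in> cbox a c \<longrightarrow> g x = f x \<bullet> w"
      using ex[OF f(1)] by blast
    obtain g' where g': "integrable lborel g'" "\<And>x. x \<notin> cbox a c \<Longrightarrow> g' x = 0" "AE x in lborel. x \<in> cbox a c \<longrightarrow> g' x = f' x \<bullet> w"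
      using ex[OF f(2)] by blast
    have "AE x in lborel. x \<in> box a c \<longrightarrow> g x - g' x = 0"
    proof (rule fundamental_lemma[OF open_box lborel.sigma_finite_measure_axioms sets_lborel])
      show "(\<lambda>x. g x - g' x) \<in> borel_measurable borel" using g g' by auto
      show "integrable lborel (\<lambda>x. indicat_real (cbox a' c') x * (g x - g' x))" for a' c'
        using integrable_mult_indicator[of "cbox a' c'" lborel "\<lambda>x. g x - g' x"] g g' by simp
      fix \<phi> assume \<phi>: "\<phi> \<in> test_functions (box a c)"
      have \<phi>0: "\<phi> x = 0" if "x \<notin> cbox a c" for x
        using test_functions_outside[OF \<phi>, of x] that box_subset_cbox[of a c] by auto
      have "\<phi> \<in> test_functions \<Omega>"
        using \<phi> ac box_subset_cbox[of a c] unfolding test_functions_def by blast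
      moreover have \<phi>m: "\<phi> \<in> borel_measurable borel" using \<phi> by (simp add: test_functions_smooth)
      have "(LINT x|lebesgue_on \<Omega>. (f x \<bullet> w) * \<phi> x) = (LINT x|lborel. g x * \<phi> x)"
      proof (rule lebesgue_on_representative(2))
        show "AE x in lborel. x \<in> \<Omega> \<longrightarrow> g x * \<phi> x = (f x \<bullet> w) * \<phi> x"
          using g(3) by eventually_elim (use \<phi>0 in auto)
      qed (use \<Omega> g \<phi>m ac in auto)
      moreover have "(LINT x|lebesgue_on \<Omega>. (f' x \<bullet> w) * \<phi> x) = (LINT x|lborel. g' x * \<phi> x)"
      proof (rule lebesgue_on_representative(2))
        show "AE x in lborel. x \<in> \<Omega> \<longrightarrow> g' x * \<phi> x = (f' x \<bullet> w) * \<phi> x"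
          using g'(3) by eventually_elim (use \<phi>0 in auto)
      qed (use \<Omega> g' \<phi>m ac in auto)
      ultimately have "(LINT x|lborel. g x * \<phi> x) = (LINT x|lborel. g' x * \<phi> x)"
        using eq w by metis
      moreover obtain C where C: "\<And>x. \<bar>\<phi> x\<bar> \<le> C" using test_functions_bounded[OF \<phi>] by metis
      have "integrable lborel (\<lambda>x. g x * \<phi> x)" "integrable lborel (\<lambda>x. g' x * \<phi> x)"
        using integrable_mult_bounded(1)[OF g(1) _ C] integrable_mult_bounded(1)[OF g'(1) _ C] \<phi>m by auto
      ultimately show "(LINT x|lborel. \<phi> x * (g x - g' x)) = 0"
        by (simp add: right_diff_distrib mult.commute[of "\<phi> _"])
    qed
    then show ?thesis
      using g(3) g'(3) by eventually_elim (use box_subset_cbox[of a c] in auto)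
  qed
  then have "AE x in lborel. \<forall>w\<in>Basis. x \<in> box a c \<longrightarrow> f x \<bullet> w = f' x \<bullet> w"
    by (intro AE_finite_allI) auto
  then show "AE x in lborel. x \<in> box a c \<longrightarrow> f x = f' x"
    by eventually_elim (auto intro: euclidean_eqI)
qed

lemma common_densities:
  fixes N :: "'i \<Rightarrow> 'a::topological_space measure"
  assumes "finite I" "\<And>i. i \<in> I \<Longrightarrow> finite_measure (N i)" "\<And>i. i \<in> I \<Longrightarrow> sets (N i) = sets borel"
  obtains M m where "finite_measure M" "sets M = sets borel"
    "\<And>i. i \<in> I \<Longrightarrow> m i \<in> borel_measurable borel" "\<And>i x. i \<in> I \<Longrightarrow> (0::real) \<le> m i x"
    "\<And>i. i \<in> I \<Longrightarrow> integrable M (m i)" "\<And>i. i \<in> I \<Longrightarrow> N i = density M (\<lambda>x. ennreal (m i x))"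
proof -
  obtain M where M: "finite_measure M" "sets M = sets borel" "\<And>i. i \<in> I \<Longrightarrow> absolutely_continuous M (N i)"
    by (rule dominating_measure[OF assms]) auto
  have "\<exists>f. f \<in> borel_measurable borel \<and> (\<forall>x. (0::real) \<le> f x) \<and> integrable M f \<and> N i = density M (\<lambda>x. ennreal (f x))"
    if i: "i \<in> I" for i
    by (rule finite_density[OF M(1,2) assms(2,3)[OF i] M(3)[OF i]]) auto
  then obtain m where "\<forall>i\<in>I. m i \<in> borel_measurable borel \<and> (\<forall>x. (0::real) \<le> m i x) \<and> integrable M (m i) \<and>
      N i = density M (\<lambda>x. ennreal (m i x))" by metis
  with M show thesis by (intro that[of M m]) auto
qed

lemma extend_to_borel:
  fixes P :: "'a::topological_space measure"
  assumes P: "finite_measure P" "sets P = sets (restrict_space borel \<Omega>)" and \<Omega>: "\<Omega> \<in> sets borel"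
  obtains Q where "finite_measure Q" "sets Q = sets borel"
    "\<And>B. B \<in> sets (restrict_space borel \<Omega>) \<Longrightarrow> measure Q B = measure P B"
    "\<And>\<phi>. \<phi> \<in> borel_measurable borel \<Longrightarrow> (LINT x|Q. \<phi> x) = (LINT x|P. (\<phi> x :: real))"
proof -
  have id: "(\<lambda>x. x) \<in> measurable P borel"
    unfolding measurable_cong_sets[OF P(2) refl] by (rule measurable_restrict_space1) simp
  have spP: "space P = \<Omega>" using sets_eq_imp_space_eq[OF P(2)] by (simp add: space_restrict_space)
  show thesis
  proof (rule that[of "distr P borel (\<lambda>x. x)"])
    show "finite_measure (distr P borel (\<lambda>x. x))" by (rule finite_measure.finite_measure_distr[OF P(1) id])
    show "sets (distr P borel (\<lambda>x. x)) = sets borel" by simp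
    fix B assume B: "B \<in> sets (restrict_space borel \<Omega>)"
    then have "B \<in> sets borel" "B \<subseteq> \<Omega>" using \<Omega> by (auto simp: sets_restrict_space)
    then show "measure (distr P borel (\<lambda>x. x)) B = measure P B"
      by (subst measure_distr[OF id]) (auto simp: spP Int_absorb2)
  qed (rule integral_distr[OF id])
qed

lemma set_integral_density:
  fixes f :: "'a::topological_space \<Rightarrow> real"
  assumes M: "sets M = sets borel" and m: "m \<in> borel_measurable borel" "\<And>x. (0::real) \<le> m x"
    and f: "f \<in> borel_measurable borel" and B: "B \<in> sets borel"
  shows "(LINT x:B|density M (\<lambda>x. ennreal (m x)). f x) = (LINT x:B|M. m x * f x)"
proof -
  have [measurable_cong]: "sets M = sets borel" by fact
  have "(LINT x|density M (\<lambda>x. ennreal (m x)). indicator B x *\<^sub>R f x) = (LINT x|M. m x *\<^sub>R (indicator B x *\<^sub>R f x))"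
    using m f B by (intro integral_density) auto
  then show ?thesis by (simp add: set_lebesgue_integral_def mult_ac)
qed

lemma restrict_borel_subset:
  "\<Omega> \<in> sets borel \<Longrightarrow> B \<in> sets (restrict_space borel \<Omega>) \<Longrightarrow> B \<in> sets borel \<and> B \<subseteq> \<Omega>"
  by (auto simp: sets_restrict_space)

text \<open>The measures in the definition of \<open>represents\<close> and \<open>M\<close> get densities with respect to a common measure; the fundamental lemma
compares these.\<close>

theorem represents_eq_density:
  fixes f :: "'a::euclidean_space \<Rightarrow> real"
  assumes \<Omega>: "open \<Omega>" and rep: "represents \<Omega> \<nu> L"
    and M: "finite_measure M" "sets M = sets borel" and f: "integrable M f"
    and L: "\<And>\<phi>. \<phi> \<in> test_functions \<Omega> \<Longrightarrow> L \<phi> = (LINT x|M. \<phi> x * f x)"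
    and B: "B \<in> sets (restrict_space borel \<Omega>)"
  shows "\<nu> B = (LINT x:B|M. f x)"
proof -
  have \<Omega>b: "\<Omega> \<in> sets borel" using \<Omega> by simp
  have fm: "f \<in> borel_measurable borel" using borel_measurable_integrable[OF f] M by simp
  obtain P Q where PQ: "finite_measure P" "sets P = sets (restrict_space borel \<Omega>)"
     "finite_measure Q" "sets Q = sets (restrict_space borel \<Omega>)"
     "\<And>B. B\<in>sets (restrict_space borel \<Omega>) \<Longrightarrow> \<nu> B = measure P B - measure Q B"
     "\<And>\<phi>. \<phi>\<in>test_functions \<Omega> \<Longrightarrow> L \<phi> = (LINT x|P. \<phi> x) - (LINT x|Q. \<phi> x)"
    using rep unfolding represents_def by blast
  obtain P' where P': "finite_measure P'" "sets P' = sets borel"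
    "\<And>B. B \<in> sets (restrict_space borel \<Omega>) \<Longrightarrow> measure P' B = measure P B"
    "\<And>\<phi>. \<phi> \<in> borel_measurable borel \<Longrightarrow> (LINT x|P'. \<phi> x) = (LINT x|P. (\<phi> x :: real))"
    by (rule extend_to_borel[OF PQ(1,2) \<Omega>b]) blast
  obtain Q' where Q': "finite_measure Q'" "sets Q' = sets borel"
    "\<And>B. B \<in> sets (restrict_space borel \<Omega>) \<Longrightarrow> measure Q' B = measure Q B"
    "\<And>\<phi>. \<phi> \<in> borel_measurable borel \<Longrightarrow> (LINT x|Q'. \<phi> x) = (LINT x|Q. (\<phi> x :: real))"
    by (rule extend_to_borel[OF PQ(3,4) \<Omega>b]) blast
  \<comment> \<open>The three measures are indexed by 0, 1 and 2.\<close>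
  define N where "N i = (if i = 0 then M else if i = 1 then P' else Q')" for i :: nat
  have Nf: "finite_measure (N i)" "sets (N i) = sets borel" for i using M P' Q' by (auto simp: N_def)
  obtain K m where K: "finite_measure K" "sets K = sets borel"
    "\<And>i. i \<in> {0, 1, 2} \<Longrightarrow> m i \<in> borel_measurable borel" "\<And>i x. i \<in> {0, 1, 2} \<Longrightarrow> (0::real) \<le> m i x"
    "\<And>i. i \<in> {0, 1, 2} \<Longrightarrow> integrable K (m i)" "\<And>i. i \<in> {0, 1, 2} \<Longrightarrow> N i = density K (\<lambda>x. ennreal (m i x))"
    by (rule common_densities[of "{0, 1, 2}" N]) (use Nf in auto)
  have [measurable_cong]: "sets K = sets borel" by fact
  have mm[measurable]: "m 0 \<in> borel_measurable borel" "m 1 \<in> borel_measurable borel" "m 2 \<in> borel_measurable borel"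
    using K(3) by auto
  note [measurable] = mm(2)[unfolded One_nat_def]
  have m0: "0 \<le> m 0 x" "0 \<le> m 1 x" "0 \<le> m 2 x" for x using K(4) by auto
  have mi: "integrable K (m 1)" "integrable K (m 2)" using K(5) by auto
  have MPQ: "M = density K (\<lambda>x. ennreal (m 0 x))" "P' = density K (\<lambda>x. ennreal (m 1 x))" "Q' = density K (\<lambda>x. ennreal (m 2 x))"
    using K(6)[of 0] K(6)[of 1] K(6)[of 2] by (auto simp: N_def)
  have mf: "integrable K (\<lambda>x. m 0 x * f x)"
    using f fm m0 unfolding MPQ(1) by (subst (asm) integrable_density) auto
  let ?F = "\<lambda>x. m 0 x * f x - (m 1 x - m 2 x)"
  have Fi: "integrable K ?F" using mf mi by auto
  have zero: "AE x in K. x \<in> \<Omega> \<longrightarrow> ?F x = 0"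
  proof (rule fundamental_lemma[OF \<Omega> _ K(2)])
    show "sigma_finite_measure K" using K(1) by (simp add: finite_measure.axioms(1))
    show "?F \<in> borel_measurable borel" using fm by measurable
    show "integrable K (\<lambda>x. indicat_real (cbox a c) x * ?F x)" for a c
      using integrable_mult_indicator[OF _ Fi, of "cbox a c"] K(2) by simp
    fix \<phi> assume \<phi>: "\<phi> \<in> test_functions \<Omega>"
    have \<phi>m[measurable]: "\<phi> \<in> borel_measurable borel" using \<phi> by (simp add: test_functions_smooth)
    obtain C where C: "\<And>x. \<bar>\<phi> x\<bar> \<le> C" using test_functions_bounded[OF \<phi>] by metis
    have i: "integrable K (\<lambda>x. \<phi> x * (m 0 x * f x))" "integrable K (\<lambda>x. \<phi> x * m 1 x)" "integrable K (\<lambda>x. \<phi> x * m 2 x)"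
      using integrable_mult_bounded(2)[OF mf _ C] integrable_mult_bounded(2)[OF mi(1) _ C]
        integrable_mult_bounded(2)[OF mi(2) _ C] by auto
    have "(LINT x|M. \<phi> x * f x) = (LINT x|K. \<phi> x * (m 0 x * f x))"
      unfolding MPQ(1) using m0 fm by (subst integral_density) (auto simp: mult_ac)
    moreover have "(LINT x|P. \<phi> x) = (LINT x|K. \<phi> x * m 1 x)"
      unfolding P'(4)[OF \<phi>m, symmetric] MPQ(2) using m0 by (subst integral_density) (auto simp: mult_ac)
    moreover have "(LINT x|Q. \<phi> x) = (LINT x|K. \<phi> x * m 2 x)"
      unfolding Q'(4)[OF \<phi>m, symmetric] MPQ(3) using m0 by (subst integral_density) (auto simp: mult_ac)
    ultimately have "(LINT x|K. \<phi> x * (m 0 x * f x)) = (LINT x|K. \<phi> x * m 1 x) - (LINT x|K. \<phi> x * m 2 x)"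
      using L[OF \<phi>] PQ(6)[OF \<phi>] by simp
    then show "(LINT x|K. \<phi> x * ?F x) = 0"
      using i by (simp add: right_diff_distrib)
  qed
  have B': "B \<in> sets borel" "B \<subseteq> \<Omega>" using restrict_borel_subset[OF \<Omega>b B] by auto
  have "(LINT x:B|M. f x) = (LINT x:B|K. m 0 x * f x)"
    unfolding MPQ(1) by (rule set_integral_density[OF K(2) mm(1) m0(1) fm B'(1)])
  also have "\<dots> = (LINT x:B|K. m 1 x - m 2 x)"
    unfolding set_lebesgue_integral_def
    by (rule integral_cong_AE) (use zero B' fm in \<open>auto elim!: eventually_mono split: split_indicator\<close>)
  also have "\<dots> = (LINT x:B|K. m 1 x) - (LINT x:B|K. m 2 x)"
    using integrable_mult_indicator[OF _ mi(1), of B] integrable_mult_indicator[OF _ mi(2), of B] B' K(2)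
    by (intro set_integral_diff) (auto simp: set_integrable_def)
  also have "(LINT x:B|K. m 1 x) = measure P' B"
    using set_integral_density[OF K(2) mm(2) m0(2), of "\<lambda>x. 1" B] B' by (simp add: MPQ(2) set_lebesgue_integral_def)
  also have "(LINT x:B|K. m 2 x) = measure Q' B"
    using set_integral_density[OF K(2) mm(3) m0(3), of "\<lambda>x. 1" B] B' by (simp add: MPQ(3) set_lebesgue_integral_def)
  finally show ?thesis using PQ(5)[OF B] P'(3)[OF B] Q'(3)[OF B] by simp
qed

text \<open>The positive and the negative part of \<open>f\<close> are the densities of the two finite measures.\<close>

lemma represents_density:
  fixes f :: "'a::euclidean_space \<Rightarrow> real"
  assumes \<Omega>: "open \<Omega>" and M: "finite_measure M" "sets M = sets borel" and f: "integrable M f"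
    and L: "\<And>\<phi>. \<phi> \<in> test_functions \<Omega> \<Longrightarrow> L \<phi> = (LINT x|M. \<phi> x * f x)"
  shows "represents \<Omega> (\<lambda>B. LINT x:B|M. f x) L"
proof -
  have \<Omega>b: "\<Omega> \<in> sets borel" using \<Omega> by simp
  have [measurable_cong]: "sets M = sets borel" by fact
  have spM: "space M = UNIV" using sets_eq_imp_space_eq[OF M(2)] by simp
  have fm[measurable]: "f \<in> borel_measurable borel" using borel_measurable_integrable[OF f] M by simp
  define R where "R h = restrict_space (density M (\<lambda>x. ennreal (h x))) \<Omega>" for h :: "'a \<Rightarrow> real"
  have R: "finite_measure (R h)" "sets (R h) = sets (restrict_space borel \<Omega>)"
    "\<And>B. B \<in> sets (restrict_space borel \<Omega>) \<Longrightarrow> measure (R h) B = (LINT x:B|M. h x)"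
    "\<And>\<phi>. \<phi> \<in> test_functions \<Omega> \<Longrightarrow> (LINT x|R h. \<phi> x) = (LINT x|M. \<phi> x * h x)"
    if h: "integrable M h" "\<And>x. 0 \<le> h x" for h
  proof -
    have hm[measurable]: "h \<in> borel_measurable borel" using borel_measurable_integrable[OF h(1)] M by simp
    show sR: "sets (R h) = sets (restrict_space borel \<Omega>)"
      unfolding R_def using M by (intro sets_restrict_space_cong) simp
    have sp: "space (R h) = \<Omega>" unfolding R_def using spM by (simp add: space_restrict_space)
    have em: "emeasure (R h) B = ennreal (LINT x:B|M. h x)" if B: "B \<in> sets (restrict_space borel \<Omega>)" for B
    proof -
      have B': "B \<in> sets borel" "B \<subseteq> \<Omega>" using restrict_borel_subset[OF \<Omega>b B] by auto
      have "emeasure (R h) B = emeasure (density M (\<lambda>x. ennreal (h x))) B"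
        unfolding R_def using B' \<Omega>b spM M by (intro emeasure_restrict_space) auto
      also have "\<dots> = (\<integral>\<^sup>+x. ennreal (indicator B x *\<^sub>R h x) \<partial>M)"
        using B' by (subst emeasure_density) (auto intro!: nn_integral_cong split: split_indicator)
      also have "\<dots> = ennreal (LINT x:B|M. h x)"
        unfolding set_lebesgue_integral_def
        using h B' M by (intro nn_integral_eq_integral integrable_mult_indicator) auto
      finally show ?thesis .
    qed
    have pos: "0 \<le> (LINT x:B|M. h x)" for B
      unfolding set_lebesgue_integral_def using h(2) by (intro integral_nonneg_AE) auto
    have "\<Omega> \<in> sets (restrict_space borel \<Omega>)" using \<Omega>b by (auto simp: sets_restrict_space)
    then show "finite_measure (R h)" by (intro finite_measureI) (simp add: em sp)
    show "measure (R h) B = (LINT x:B|M. h x)" if "B \<in> sets (restrict_space borel \<Omega>)" for B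
      using em[OF that] pos by (simp add: measure_def)
    fix \<phi> assume \<phi>: "\<phi> \<in> test_functions \<Omega>"
    have [measurable]: "\<phi> \<in> borel_measurable borel" using \<phi> by (simp add: test_functions_smooth)
    have ind: "indicator \<Omega> x *\<^sub>R \<phi> x = \<phi> x" for x
      using test_functions_outside[OF \<phi>, of x] by (auto split: split_indicator)
    have "(LINT x|R h. \<phi> x) = (LINT x|density M (\<lambda>x. ennreal (h x)). indicator \<Omega> x *\<^sub>R \<phi> x)"
      unfolding R_def using \<Omega>b spM M by (intro integral_restrict_space) auto
    also have "\<dots> = (LINT x|M. \<phi> x * h x)"
      unfolding ind using h(2) by (subst integral_density) (auto simp: mult_ac)
    finally show "(LINT x|R h. \<phi> x) = (LINT x|M. \<phi> x * h x)" .
  qed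
  let ?p = "\<lambda>x. max 0 (f x)" and ?m = "\<lambda>x. max 0 (- f x)"
  have ip: "integrable M ?p" and im: "integrable M ?m" using f by auto
  note Rp = R[of ?p, OF ip] and Rm = R[of ?m, OF im]
  have split: "f x = ?p x - ?m x" for x by auto
  show ?thesis
    unfolding represents_def
  proof (intro exI conjI ballI)
    show "finite_measure (R ?p)" "sets (R ?p) = sets (restrict_space borel \<Omega>)" by (rule Rp; simp)+
    show "finite_measure (R ?m)" "sets (R ?m) = sets (restrict_space borel \<Omega>)" by (rule Rm; simp)+
    show "(LINT x:B|M. f x) = measure (R ?p) B - measure (R ?m) B" if B: "B \<in> sets (restrict_space borel \<Omega>)" for B
    proof -
      have B': "B \<in> sets M" using restrict_borel_subset[OF \<Omega>b B] M by auto
      have "(LINT x:B|M. f x) = (LINT x:B|M. ?p x - ?m x)" by (simp flip: split)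
      also have "\<dots> = (LINT x:B|M. ?p x) - (LINT x:B|M. ?m x)"
        using integrable_mult_indicator[OF B' ip] integrable_mult_indicator[OF B' im]
        by (intro set_integral_diff) (auto simp: set_integrable_def)
      finally show ?thesis using Rp(3)[OF _ B] Rm(3)[OF _ B] by simp
    qed
    show "L \<phi> = (LINT x|R ?p. \<phi> x) - (LINT x|R ?m. \<phi> x)" if \<phi>: "\<phi> \<in> test_functions \<Omega>" for \<phi>
    proof -
      have \<phi>m: "\<phi> \<in> borel_measurable M" using \<phi> M by (simp add: test_functions_smooth)
      obtain C where C: "\<And>x. \<bar>\<phi> x\<bar> \<le> C" using test_functions_bounded[OF \<phi>] by metis
      have "L \<phi> = (LINT x|M. \<phi> x * ?p x - \<phi> x * ?m x)"
        unfolding L[OF \<phi>] by (intro Bochner_Integration.integral_cong refl) (auto simp: max_def)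
      also have "\<dots> = (LINT x|M. \<phi> x * ?p x) - (LINT x|M. \<phi> x * ?m x)"
        by (intro Bochner_Integration.integral_diff integrable_mult_bounded(2)[OF ip \<phi>m C] integrable_mult_bounded(2)[OF im \<phi>m C])
      finally show ?thesis using Rp(4)[OF _ \<phi>] Rm(4)[OF _ \<phi>] by simp
    qed
  qed
qed

section \<open>Blocks of variables\<close>

lemma block_inner: "block blk i v \<bullet> w = v \<bullet> block blk i w"
  by (auto simp: block_def inner_prod_def inner_vec_def intro!: sum.cong)

lemma block_idem: "block blk i (block blk i v) = block blk i v"
  by (auto simp: block_def vec_eq_iff)

definition block_index :: "('m \<Rightarrow> nat) \<Rightarrow> ('n::finite, 'm::finite) space \<Rightarrow> nat" where
  "block_index blk b = (if snd b = 0 then 1 else blk (SOME j. snd b = axis j 1))"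

lemma Basis_space:
  "(Basis :: ('n::finite, 'm::finite) space set) = (\<lambda>e. (e, 0)) ` Basis \<union> (\<lambda>e. (0, e)) ` Basis"
  by (simp add: Basis_prod_def)

lemma Basis_space_disjoint: "((\<lambda>e. (e, 0)) ` Basis) \<inter> ((\<lambda>e. (0, e)) ` Basis) = ({} :: ('n::finite, 'm::finite) space set)"
  by auto

lemma block_index_first: "block_index blk (e, 0) = 1"
  by (simp add: block_index_def)

lemma block_index_axis: "block_index blk (0, axis j 1) = blk j"
proof -
  have "(SOME j'. axis j (1::real) = axis j' 1) = j" by (rule some_equality) (auto simp: axis_eq_axis)
  moreover have "axis j (1::real) \<noteq> 0" by (simp add: axis_eq_0_iff)
  ultimately show ?thesis by (simp add: block_index_def)
qed

lemma block_index_later: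
  assumes "range blk = {2..k}" "b \<in> (\<lambda>e. (0, e)) ` Basis"
  shows "block_index blk b \<in> {2..k}"
  using assms by (auto simp: Basis_vec_def block_index_axis)

lemma block_index_range:
  assumes "range blk = {2..k}" "2 \<le> k" "b \<in> Basis"
  shows "block_index blk b \<in> {1..k}"
  using block_index_later[OF assms(1), of b] assms(2,3) by (auto simp: Basis_space block_index_first)

lemma block_Basis:
  assumes "range blk = {2..k}" "b \<in> Basis"
  shows "block blk i b = (if block_index blk b = i then b else 0)"
proof -
  consider e where "b = (e, 0)" | j where "b = (0, axis j 1)"
    using assms(2) by (auto simp: Basis_space Basis_vec_def)
  then show ?thesis
  proof cases
    case 1
    then show ?thesis by (auto simp: block_def block_index_first zero_prod_def vec_eq_iff)
  next
    case 2
    have "blk j \<in> {2..k}" using assms(1) by blast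
    then have "blk j \<noteq> 1" by simp
    then show ?thesis
      unfolding 2 block_index_axis by (auto simp: block_def zero_prod_def vec_eq_iff axis_def)
  qed
qed

lemma block_component:
  assumes "range blk = {2..k}" "b \<in> Basis"
  shows "block blk i v \<bullet> b = (if block_index blk b = i then v \<bullet> b else 0)"
  unfolding block_inner block_Basis[OF assms] by simp

lemma block_inner_sum:
  assumes "range blk = {2..k}"
  shows "block blk i v \<bullet> w = (\<Sum>b\<in>Basis. if block_index blk b = i then (v \<bullet> b) * (w \<bullet> b) else 0)"
  by (subst euclidean_inner) (intro sum.cong refl, simp add: block_component[OF assms])

lemma grad_component: "b \<in> Basis \<Longrightarrow> grad \<phi> x \<bullet> b = dir_deriv b \<phi> x"
  by (simp add: grad_def inner_sum_left_Basis)

text \<open>Regroups the block sums of the pairing as sums over basis vectors.\<close>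

lemma sum_over_blocks:
  fixes X :: "('n::finite, 'm::finite) space \<Rightarrow> real"
  assumes "finite A" "\<And>b. b \<in> A \<Longrightarrow> block_index blk b \<in> K" "finite K"
  shows "(\<Sum>i\<in>K. \<Sum>b\<in>A. if block_index blk b = i then X b else 0) = (\<Sum>b\<in>A. X b)"
  by (subst sum.swap) (auto intro!: sum.cong simp: assms sum.delta')

section \<open>Weak gradients, derivative measures and pairings through Borel versions\<close>

text \<open>Integrals over \<open>lebesgue_on \<Omega>\<close> of Lebesgue measurable functions become integrals over the whole space of Borel
functions, for which Fubini's theorem and translations are available.\<close>

definition borel_version :: "'a::euclidean_space set \<Rightarrow> ('a \<Rightarrow> real) \<Rightarrow> ('a \<Rightarrow> real) \<Rightarrow> bool" where
  "borel_version \<Omega> G F \<longleftrightarrow> G \<in> borel_measurable borel \<and> (\<forall>x. x \<notin> \<Omega> \<longrightarrow> G x = 0) \<and>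
     (AE x in lborel. x \<in> \<Omega> \<longrightarrow> G x = F x)"

lemma borel_version_integral:
  assumes "borel_version \<Omega> G F" "\<Omega> \<in> sets borel"
  shows "(LINT x|lebesgue_on \<Omega>. F x) = (LINT x|lborel. G x)"
  using assms lebesgue_on_representative(2)[of \<Omega> G F] by (simp add: borel_version_def)

lemma borel_version_mult:
  assumes "borel_version \<Omega> G F" "borel_version \<Omega> G' F'"
  shows "borel_version \<Omega> (\<lambda>x. G x * G' x) (\<lambda>x. F x * F' x)"
proof -
  have "AE x in lborel. x \<in> \<Omega> \<longrightarrow> G x = F x" "AE x in lborel. x \<in> \<Omega> \<longrightarrow> G' x = F' x"
    using assms by (simp_all add: borel_version_def)
  then have "AE x in lborel. x \<in> \<Omega> \<longrightarrow> G x * G' x = F x * F' x" by eventually_elim simp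
  moreover have "(\<lambda>x. G x * G' x) \<in> borel_measurable borel"
    using assms by (intro borel_measurable_times) (simp_all add: borel_version_def)
  ultimately show ?thesis using assms by (simp add: borel_version_def)
qed

lemma borel_version_mult_borel:
  assumes "borel_version \<Omega> G F" "\<phi> \<in> borel_measurable borel"
  shows "borel_version \<Omega> (\<lambda>x. G x * \<phi> x) (\<lambda>x. F x * \<phi> x)"
proof -
  have "AE x in lborel. x \<in> \<Omega> \<longrightarrow> G x = F x"
    using assms by (simp add: borel_version_def)
  then have "AE x in lborel. x \<in> \<Omega> \<longrightarrow> G x * \<phi> x = F x * \<phi> x" by eventually_elim simp
  moreover have "(\<lambda>x. G x * \<phi> x) \<in> borel_measurable borel"
    using assms by (intro borel_measurable_times) (simp_all add: borel_version_def)
  ultimately show ?thesis using assms by (simp add: borel_version_def)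
qed

lemma borel_version_sum:
  assumes "finite I" "\<And>i. i \<in> I \<Longrightarrow> borel_version \<Omega> (G i) (F i)"
  shows "borel_version \<Omega> (\<lambda>x. \<Sum>i\<in>I. G i x) (\<lambda>x. \<Sum>i\<in>I. F i x)"
proof -
  have "AE x in lborel. \<forall>i\<in>I. x \<in> \<Omega> \<longrightarrow> G i x = F i x"
    using assms by (intro AE_finite_allI) (auto simp: borel_version_def)
  then have "AE x in lborel. x \<in> \<Omega> \<longrightarrow> (\<Sum>i\<in>I. G i x) = (\<Sum>i\<in>I. F i x)"
    by eventually_elim (auto intro!: sum.cong)
  then show ?thesis using assms(2) unfolding borel_version_def by (auto intro!: borel_measurable_sum)
qed

lemma borel_version_zero: "borel_version \<Omega> (\<lambda>x. 0) (\<lambda>x. 0)"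
  by (simp add: borel_version_def)

text \<open>The field with the components \<open>H b\<close> is a weak gradient in the variables of block \<open>i\<close>. Hence the choice in
the definition of \<open>weak_grad\<close> has a witness, and uniqueness of weak gradients identifies its components.\<close>

lemma weak_grad_component:
  fixes v :: "('n::finite, 'm::finite) space \<Rightarrow> real"
  assumes \<Omega>: "open \<Omega>" and blk: "range blk = {2..k}" and i: "i \<in> {2..k}"
    and V: "borel_version \<Omega> V v" "integrable lborel V"
    and H: "\<And>b. b \<in> (\<lambda>e. (0, e)) ` Basis \<Longrightarrow> weak_deriv \<Omega> lborel V b (H b)"
      "\<And>b x. b \<in> (\<lambda>e. (0, e)) ` Basis \<Longrightarrow> x \<notin> \<Omega> \<Longrightarrow> H b x = 0"
    and b: "b \<in> Basis" "block_index blk b = i"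
  shows "borel_version \<Omega> (H b) (\<lambda>x. weak_grad blk i \<Omega> v x \<bullet> b)"
proof -
  have \<Omega>b: "\<Omega> \<in> sets borel" using \<Omega> by simp
  let ?B = "{b\<in>Basis. block_index blk b = i} :: ('n, 'm) space set"
  have B: "c \<in> (\<lambda>e. (0, e)) ` Basis" if "c \<in> ?B" for c
    using that i by (auto simp: Basis_space block_index_first)
  have Hi: "integrable lborel (H c)" if "c \<in> ?B" for c
    using H(1)[OF B[OF that]] by (simp add: weak_deriv_def)
  define g where "g x = (\<Sum>c\<in>?B. H c x *\<^sub>R c)" for x
  have gc: "g x \<bullet> w = (\<Sum>c\<in>?B. H c x * (c \<bullet> w))" for x w by (simp add: g_def inner_sum_left)
  have gi: "integrable lborel g" unfolding g_def using Hi by (intro Bochner_Integration.integrable_sum integrable_scaleR_left) auto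
  have "is_weak_grad blk i \<Omega> v g"
    unfolding is_weak_grad_def
  proof (intro conjI ballI allI)
    have "integrable lebesgue g" using gi by (simp add: integrable_completion)
    then show "locally_integrable \<Omega> g"
      unfolding locally_integrable_def set_integrable_def
      by (auto intro!: integrable_mult_indicator fmeasurableD lmeasurable_compact)
    fix \<phi> w assume \<phi>: "\<phi> \<in> test_functions \<Omega>"
    have sm: "smooth \<phi>" using \<phi> by (rule test_functions_smooth)
    have m: "\<phi> \<in> borel_measurable borel" "dir_deriv c \<phi> \<in> borel_measurable borel" for c
      using smooth_measurable[OF sm] smooth_measurable[OF smooth_dir_deriv[OF sm]] by auto
    have Vi: "integrable lborel (\<lambda>x. V x * dir_deriv c \<phi> x)" for c
    proof -
      obtain C where "\<And>x. \<bar>dir_deriv c \<phi> x\<bar> \<le> C" using test_functions_bounded[OF test_functions_dir_deriv[OF \<phi>]] by metis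
      then show ?thesis using m by (intro integrable_mult_bounded(1)[OF V(2)]) auto
    qed
    have H\<phi>: "integrable lborel (\<lambda>x. H c x * \<phi> x)" if c: "c \<in> ?B" for c
    proof -
      obtain C where "\<And>x. \<bar>\<phi> x\<bar> \<le> C" using test_functions_bounded[OF \<phi>] by metis
      then show ?thesis using m by (intro integrable_mult_bounded(1)[OF Hi[OF c]]) auto
    qed
    have "(LINT x|lebesgue_on \<Omega>. v x * dir_deriv (block blk i w) \<phi> x) = (LINT x|lborel. V x * dir_deriv (block blk i w) \<phi> x)"
      by (rule borel_version_integral[OF borel_version_mult_borel[OF V(1) m(2)] \<Omega>b])
    also have "\<dots> = (LINT x|lborel. (\<Sum>c\<in>?B. (w \<bullet> c) * (V x * dir_deriv c \<phi> x)))"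
    proof (intro Bochner_Integration.integral_cong refl)
      fix x
      have "dir_deriv (block blk i w) \<phi> x = (\<Sum>c\<in>Basis. (if block_index blk c = i then w \<bullet> c else 0) * dir_deriv c \<phi> x)"
        unfolding dir_deriv_eq_sum_Basis[OF smooth_differentiable[OF sm], of "block blk i w"]
        by (intro sum.cong refl) (simp add: block_component[OF blk])
      also have "\<dots> = (\<Sum>c\<in>?B. (w \<bullet> c) * dir_deriv c \<phi> x)"
        by (rule sum.mono_neutral_cong_right) auto
      finally show "V x * dir_deriv (block blk i w) \<phi> x = (\<Sum>c\<in>?B. (w \<bullet> c) * (V x * dir_deriv c \<phi> x))"
        by (simp add: sum_distrib_left mult_ac)
    qed
    also have "\<dots> = (\<Sum>c\<in>?B. (w \<bullet> c) * (LINT x|lborel. V x * dir_deriv c \<phi> x))"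
      using Vi by (subst Bochner_Integration.integral_sum) auto
    also have "\<dots> = (\<Sum>c\<in>?B. (w \<bullet> c) * - (LINT x|lborel. H c x * \<phi> x))"
    proof (intro sum.cong refl)
      fix c assume "c \<in> ?B"
      then have "(LINT x|lborel. V x * dir_deriv c \<phi> x) = - (LINT x|lborel. \<phi> x * H c x)"
        using H(1)[OF B] \<phi> by (simp add: weak_deriv_def)
      then show "(w \<bullet> c) * (LINT x|lborel. V x * dir_deriv c \<phi> x) = (w \<bullet> c) * - (LINT x|lborel. H c x * \<phi> x)"
        by (simp add: mult.commute)
    qed
    also have "\<dots> = - (LINT x|lborel. (\<Sum>c\<in>?B. (w \<bullet> c) * (H c x * \<phi> x)))"
      using H\<phi> by (subst Bochner_Integration.integral_sum) (auto simp: sum_negf)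
    also have "(LINT x|lborel. (\<Sum>c\<in>?B. (w \<bullet> c) * (H c x * \<phi> x))) = (LINT x|lborel. (g x \<bullet> w) * \<phi> x)"
      unfolding gc by (intro Bochner_Integration.integral_cong refl) (simp add: sum_distrib_left sum_distrib_right mult_ac inner_commute)
    also have "\<dots> = (LINT x|lebesgue_on \<Omega>. (g x \<bullet> w) * \<phi> x)"
    proof (rule borel_version_integral[OF borel_version_mult_borel[OF _ m(1)] \<Omega>b, symmetric])
      have "g x = 0" if "x \<notin> \<Omega>" for x
        unfolding g_def by (rule sum.neutral) (use H(2)[OF B that] in simp)
      then show "borel_version \<Omega> (\<lambda>x. g x \<bullet> w) (\<lambda>x. g x \<bullet> w)"
        using gi by (auto simp: borel_version_def)
    qed
    finally show "(LINT x|lebesgue_on \<Omega>. v x * dir_deriv (block blk i w) \<phi> x) = - (LINT x|lebesgue_on \<Omega>. (g x \<bullet> w) * \<phi> x)" .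
  qed
  then have "is_weak_grad blk i \<Omega> v (weak_grad blk i \<Omega> v)" and g: "is_weak_grad blk i \<Omega> v g"
    unfolding weak_grad_def using someI[of "is_weak_grad blk i \<Omega> v" g] by simp_all
  then have same: "AE x in lborel. x \<in> \<Omega> \<longrightarrow> g x = weak_grad blk i \<Omega> v x"
    by (intro locally_integrable_unique[OF \<Omega>]) (auto simp: is_weak_grad_def)
  have gb: "g x \<bullet> b = H b x" for x
  proof -
    have "g x \<bullet> b = (\<Sum>c\<in>?B. if c = b then H c x else 0)"
      unfolding gc using b(1) by (intro sum.cong refl) (auto simp: inner_Basis)
    then show ?thesis using b by (simp add: sum.delta)
  qed
  have "AE x in lborel. x \<in> \<Omega> \<longrightarrow> H b x = weak_grad blk i \<Omega> v x \<bullet> b"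
    using same by eventually_elim (simp flip: gb)
  then show ?thesis
    using b Hi[of b] H(2)[OF B] unfolding borel_version_def by auto
qed

text \<open>The set function with density \<open>S\<close> is a derivative measure, so the choice in the definition of \<open>D1\<close> has a witness, and
representing measures are unique.\<close>

lemma D1_density:
  fixes v :: "('n::finite, 'm::finite) space \<Rightarrow> real" and S :: "('n, 'm) space \<Rightarrow> real^'n"
  assumes \<Omega>: "open \<Omega>" and V: "borel_version \<Omega> V v" and M: "finite_measure M" "sets M = sets borel"
    and S: "integrable M S" and deriv: "\<And>w. weak_deriv \<Omega> M V (w, 0) (\<lambda>x. S x \<bullet> w)"
    and B: "B \<in> sets (restrict_space borel \<Omega>)"
  shows "D1 \<Omega> v B = (LINT x:B|M. S x)"
proof -
  have \<Omega>b: "\<Omega> \<in> sets borel" using \<Omega> by simp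
  let ?L = "\<lambda>w \<phi>. - (LINT x|lebesgue_on \<Omega>. v x * dir_deriv (w, 0) \<phi> x)"
  have L: "?L w \<phi> = (LINT x|M. \<phi> x * (S x \<bullet> w))" if "\<phi> \<in> test_functions \<Omega>" for w \<phi>
  proof -
    have "dir_deriv (w, 0) \<phi> \<in> borel_measurable borel"
      using that by (intro smooth_measurable smooth_dir_deriv test_functions_smooth)
    then have "(LINT x|lebesgue_on \<Omega>. v x * dir_deriv (w, 0) \<phi> x) = (LINT x|lborel. V x * dir_deriv (w, 0) \<phi> x)"
      by (intro borel_version_integral[OF borel_version_mult_borel[OF V] \<Omega>b])
    then show ?thesis using deriv[of w] that by (simp add: weak_deriv_def)
  qed
  have Si: "integrable M (\<lambda>x. S x \<bullet> w)" for w using S by simp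
  have inner: "(LINT x:B|M. S x) \<bullet> w = (LINT x:B|M. S x \<bullet> w)" if "B \<in> sets (restrict_space borel \<Omega>)" for B w
  proof -
    have "integrable M (\<lambda>x. indicator B x *\<^sub>R S x)"
      using restrict_borel_subset[OF \<Omega>b that] M S by (intro integrable_mult_indicator) auto
    then show ?thesis unfolding set_lebesgue_integral_def by (subst integral_inner_left[symmetric]) auto
  qed
  have "is_deriv_measure \<Omega> (\<lambda>v. (v, 0)) v (\<lambda>B. LINT x:B|M. S x)"
    unfolding is_deriv_measure_def
  proof
    fix w
    have "represents \<Omega> (\<lambda>B. LINT x:B|M. S x \<bullet> w) (?L w)"
      by (rule represents_density[OF \<Omega> M Si L])
    then show "represents \<Omega> (\<lambda>B. (LINT x:B|M. S x) \<bullet> w) (?L w)"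
      unfolding represents_def by (simp add: inner cong: conj_cong)
  qed
  then have D: "is_deriv_measure \<Omega> (\<lambda>v. (v, 0)) v (D1 \<Omega> v)"
    unfolding D1_def using someI[of "is_deriv_measure \<Omega> (\<lambda>v. (v, 0)) v"] by simp
  show ?thesis
  proof (rule euclidean_eqI)
    fix w :: "real^'n" assume "w \<in> Basis"
    have "D1 \<Omega> v B \<bullet> w = (LINT x:B|M. S x \<bullet> w)"
      using D by (intro represents_eq_density[OF \<Omega> _ M Si L B]) (auto simp: is_deriv_measure_def)
    then show "D1 \<Omega> v B \<bullet> w = (LINT x:B|M. S x) \<bullet> w" by (simp add: inner[OF B])
  qed
qed

lemma pairing_density:
  assumes \<Omega>: "open \<Omega>" and M: "finite_measure M" "sets M = sets borel" and f: "integrable M f"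
    and eq: "\<And>\<phi>. \<phi> \<in> test_functions \<Omega> \<Longrightarrow> pairing_functional blk k \<Omega> z v \<phi> = (LINT x|M. \<phi> x * f x)"
    and B: "B \<in> sets (restrict_space borel \<Omega>)"
  shows "pairing blk k \<Omega> z v B = (LINT x:B|M. f x)"
proof -
  have "represents \<Omega> (pairing blk k \<Omega> z v) (pairing_functional blk k \<Omega> z v)"
    unfolding pairing_def
    using someI[of "\<lambda>\<nu>. represents \<Omega> \<nu> (pairing_functional blk k \<Omega> z v)", OF represents_density[OF \<Omega> M f eq]] .
  then show ?thesis by (rule represents_eq_density[OF \<Omega> _ M f eq B])
qed

lemma pairing_functional_eq:
  fixes v :: "('n::finite, 'm::finite) space \<Rightarrow> real" and z :: "('n, 'm) space \<Rightarrow> ('n, 'm) space"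
  assumes \<Omega>: "open \<Omega>" and blk: "range blk = {2..k}" and k: "2 \<le> k"
    and V: "borel_version \<Omega> V v"
    and Z: "\<And>b. b \<in> Basis \<Longrightarrow> borel_version \<Omega> (Z b) (\<lambda>x. z x \<bullet> b)"
    and d: "borel_version \<Omega> d (weak_div \<Omega> z)"
    and H: "\<And>b. b \<in> (\<lambda>e. (0, e)) ` Basis \<Longrightarrow> borel_version \<Omega> (H b) (\<lambda>x. weak_grad blk (block_index blk b) \<Omega> v x \<bullet> b)"
    and VZ: "\<And>b. b \<in> Basis \<Longrightarrow> young_pair V (Z b)"
    and HZ: "\<And>b. b \<in> (\<lambda>e. (0, e)) ` Basis \<Longrightarrow> young_pair (H b) (Z b)"
    and \<phi>: "\<phi> \<in> test_functions \<Omega>"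
  shows "pairing_functional blk k \<Omega> z v \<phi> =
     - (LINT x|lborel. V x * \<phi> x * d x) - (\<Sum>b\<in>Basis. LINT x|lborel. V x * (Z b x * dir_deriv b \<phi> x))
      - (\<Sum>b\<in>(\<lambda>e. (0, e)) ` Basis. LINT x|lborel. \<phi> x * (Z b x * H b x))"
proof -
  have \<Omega>b: "\<Omega> \<in> sets borel" using \<Omega> by simp
  have sm: "smooth \<phi>" using \<phi> by (rule test_functions_smooth)
  have m: "\<phi> \<in> borel_measurable borel" "dir_deriv c \<phi> \<in> borel_measurable borel" for c
    using smooth_measurable[OF sm] smooth_measurable[OF smooth_dir_deriv[OF sm]] by auto
  let ?J = "(\<lambda>e. (0, e)) ` Basis :: ('n, 'm) space set"
  have J: "?J \<subseteq> Basis" "finite ?J" by (auto simp: Basis_space)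
  have 1: "(LINT x|lebesgue_on \<Omega>. v x * \<phi> x * weak_div \<Omega> z x) = (LINT x|lborel. V x * \<phi> x * d x)"
    by (rule borel_version_integral[OF borel_version_mult[OF borel_version_mult_borel[OF V m(1)] d] \<Omega>b])
  have 2: "(LINT x|lebesgue_on \<Omega>. v x * (block blk i (z x) \<bullet> block blk i (grad \<phi> x)))
     = (\<Sum>b\<in>Basis. if block_index blk b = i then LINT x|lborel. V x * (Z b x * dir_deriv b \<phi> x) else 0)" for i
  proof -
    have eq: "v x * (block blk i (z x) \<bullet> block blk i (grad \<phi> x)) =
      (\<Sum>b\<in>Basis. if block_index blk b = i then v x * ((z x \<bullet> b) * dir_deriv b \<phi> x) else 0)" for x
    proof -
      have "block blk i (z x) \<bullet> block blk i (grad \<phi> x) = block blk i (z x) \<bullet> grad \<phi> x"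
        by (simp add: block_inner[symmetric] block_idem)
      then show ?thesis
        unfolding block_inner_sum[OF blk] by (auto simp: sum_distrib_left grad_component intro!: sum.cong)
    qed
    have rep: "borel_version \<Omega> (\<lambda>x. if block_index blk b = i then V x * (Z b x * dir_deriv b \<phi> x) else 0)
        (\<lambda>x. if block_index blk b = i then v x * ((z x \<bullet> b) * dir_deriv b \<phi> x) else 0)" if "b \<in> Basis" for b
      using borel_version_mult[OF V borel_version_mult_borel[OF Z[OF that] m(2)[of b]]]
      by (cases "block_index blk b = i") (simp_all add: borel_version_zero)
    have "(LINT x|lebesgue_on \<Omega>. v x * (block blk i (z x) \<bullet> block blk i (grad \<phi> x)))
      = (LINT x|lborel. (\<Sum>b\<in>Basis. if block_index blk b = i then V x * (Z b x * dir_deriv b \<phi> x) else 0))"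
      unfolding eq by (rule borel_version_integral[OF borel_version_sum[OF finite_Basis rep] \<Omega>b])
    also have "\<dots> = (\<Sum>b\<in>Basis. LINT x|lborel. (if block_index blk b = i then V x * (Z b x * dir_deriv b \<phi> x) else 0))"
    proof (rule Bochner_Integration.integral_sum)
      fix b :: "('n, 'm) space" assume b: "b \<in> Basis"
      obtain C where "\<And>x. \<bar>dir_deriv b \<phi> x\<bar> \<le> C" using test_functions_bounded[OF test_functions_dir_deriv[OF \<phi>]] by metis
      then have "integrable lborel (\<lambda>x. V x * Z b x * dir_deriv b \<phi> x)"
        using m by (intro integrable_mult_bounded(1)[OF young_pair_integrable[OF VZ[OF b]]]) auto
      then show "integrable lborel (\<lambda>x. if block_index blk b = i then V x * (Z b x * dir_deriv b \<phi> x) else 0)"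
        by (cases "block_index blk b = i") (simp_all add: mult.assoc)
    qed
    also have "\<dots> = (\<Sum>b\<in>Basis. if block_index blk b = i then LINT x|lborel. V x * (Z b x * dir_deriv b \<phi> x) else 0)"
      by (intro sum.cong) auto
    finally show ?thesis .
  qed
  have 3: "(LINT x|lebesgue_on \<Omega>. \<phi> x * (block blk i (z x) \<bullet> weak_grad blk i \<Omega> v x))
     = (\<Sum>b\<in>?J. if block_index blk b = i then LINT x|lborel. \<phi> x * (Z b x * H b x) else 0)" if i: "i \<in> {2..k}" for i
  proof -
    have "block blk i (z x) \<bullet> weak_grad blk i \<Omega> v x =
      (\<Sum>b\<in>?J. if block_index blk b = i then (z x \<bullet> b) * (weak_grad blk i \<Omega> v x \<bullet> b) else 0)" for x
      unfolding block_inner_sum[OF blk]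
      by (rule sum.mono_neutral_right) (use J i in \<open>auto simp: Basis_space block_index_first\<close>)
    then have eq: "\<phi> x * (block blk i (z x) \<bullet> weak_grad blk i \<Omega> v x) =
      (\<Sum>b\<in>?J. if block_index blk b = i then ((z x \<bullet> b) * (weak_grad blk i \<Omega> v x \<bullet> b)) * \<phi> x else 0)" for x
      by (auto simp: sum_distrib_left intro!: sum.cong)
    have rep: "borel_version \<Omega> (\<lambda>x. if block_index blk b = i then (Z b x * H b x) * \<phi> x else 0)
        (\<lambda>x. if block_index blk b = i then ((z x \<bullet> b) * (weak_grad blk i \<Omega> v x \<bullet> b)) * \<phi> x else 0)" if b: "b \<in> ?J" for b
    proof (cases "block_index blk b = i")
      case True
      have "b \<in> Basis" using b J by blast
      with True show ?thesis
        using borel_version_mult_borel[OF borel_version_mult[OF Z H[OF b]] m(1)] by simp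
    qed (simp add: borel_version_zero)
    have "(LINT x|lebesgue_on \<Omega>. \<phi> x * (block blk i (z x) \<bullet> weak_grad blk i \<Omega> v x))
      = (LINT x|lborel. (\<Sum>b\<in>?J. if block_index blk b = i then (Z b x * H b x) * \<phi> x else 0))"
      unfolding eq by (rule borel_version_integral[OF borel_version_sum[OF J(2) rep] \<Omega>b])
    also have "\<dots> = (\<Sum>b\<in>?J. LINT x|lborel. (if block_index blk b = i then (Z b x * H b x) * \<phi> x else 0))"
    proof (rule Bochner_Integration.integral_sum)
      fix b assume b: "b \<in> ?J"
      obtain C where C: "\<And>x. \<bar>\<phi> x\<bar> \<le> C" using test_functions_bounded[OF \<phi>] by metis
      have "integrable lborel (\<lambda>x. H b x * Z b x * \<phi> x)"
        using m by (intro integrable_mult_bounded(1)[OF young_pair_integrable[OF HZ[OF b]] _ C]) auto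
      then show "integrable lborel (\<lambda>x. if block_index blk b = i then (Z b x * H b x) * \<phi> x else 0)"
        by (cases "block_index blk b = i") (simp_all add: mult_ac)
    qed
    also have "\<dots> = (\<Sum>b\<in>?J. if block_index blk b = i then LINT x|lborel. \<phi> x * (Z b x * H b x) else 0)"
      by (intro sum.cong) (auto simp: mult_ac)
    finally show ?thesis .
  qed
  have "(\<Sum>i=1..k. LINT x|lebesgue_on \<Omega>. v x * (block blk i (z x) \<bullet> block blk i (grad \<phi> x)))
     = (\<Sum>b\<in>Basis. LINT x|lborel. V x * (Z b x * dir_deriv b \<phi> x))"
    unfolding 2 by (rule sum_over_blocks) (use block_index_range[OF blk k] in auto)
  moreover have "(\<Sum>i=2..k. LINT x|lebesgue_on \<Omega>. \<phi> x * (block blk i (z x) \<bullet> weak_grad blk i \<Omega> v x))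
     = (\<Sum>b\<in>?J. LINT x|lborel. \<phi> x * (Z b x * H b x))"
    using sum_over_blocks[OF J(2) block_index_later[OF blk], of "\<lambda>b. LINT x|lborel. \<phi> x * (Z b x * H b x)"]
    by (simp add: 3)
  ultimately show ?thesis unfolding pairing_functional_def 1 by simp
qed

lemma total_variation_integral:
  fixes \<theta> c :: "'a::euclidean_space \<Rightarrow> real"
  assumes \<Omega>: "open \<Omega>" and M: "sets M = sets borel"
    and c: "integrable M c" "\<And>x. 0 \<le> c x" and \<theta>: "\<theta> \<in> borel_measurable borel" "\<And>x. \<bar>\<theta> x\<bar> \<le> C"
  defines "R \<equiv> restrict_space (density M (\<lambda>x. ennreal (c x))) \<Omega>"
  shows "integrable R \<theta>" "sets R = sets (restrict_space borel \<Omega>)"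
    "B \<in> sets (restrict_space borel \<Omega>) \<Longrightarrow> (LINT x:B|R. \<theta> x) = (LINT x:B|M. c x * \<theta> x)"
proof -
  have \<Omega>b: "\<Omega> \<in> sets borel" using \<Omega> by simp
  have [measurable_cong]: "sets M = sets borel" by fact
  have spM: "space M = UNIV" using sets_eq_imp_space_eq[OF M] by simp
  have [measurable]: "c \<in> borel_measurable borel" using borel_measurable_integrable[OF c(1)] M by simp
  have i: "integrable M (\<lambda>x. c x * \<theta> x)" using \<theta> by (intro integrable_mult_bounded(1)[OF c(1)]) auto
  have "integrable M (\<lambda>x. indicator \<Omega> x *\<^sub>R (c x * \<theta> x))"
    using \<Omega>b i M by (intro integrable_mult_indicator) auto
  then have "integrable (density M (\<lambda>x. ennreal (c x))) (\<lambda>x. indicator \<Omega> x *\<^sub>R \<theta> x)"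
    using c(2) \<theta>(1) \<Omega>b by (subst integrable_density) (auto simp: mult_ac)
  then show "integrable R \<theta>"
    unfolding R_def using \<Omega>b spM M by (subst integrable_restrict_space) auto
  show "sets R = sets (restrict_space borel \<Omega>)"
    unfolding R_def using M by (intro sets_restrict_space_cong) simp
  show "(LINT x:B|R. \<theta> x) = (LINT x:B|M. c x * \<theta> x)" if "B \<in> sets (restrict_space borel \<Omega>)"
  proof -
    have B: "B \<in> sets borel" "B \<subseteq> \<Omega>" using restrict_borel_subset[OF \<Omega>b that] by auto
    have "(LINT x:B|R. \<theta> x) = (LINT x|density M (\<lambda>x. ennreal (c x)). indicator \<Omega> x *\<^sub>R (indicator B x *\<^sub>R \<theta> x))"
      unfolding R_def set_lebesgue_integral_def using \<Omega>b spM M by (intro integral_restrict_space) auto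
    also have "\<dots> = (LINT x:B|density M (\<lambda>x. ennreal (c x)). \<theta> x)"
      unfolding set_lebesgue_integral_def
      by (intro Bochner_Integration.integral_cong refl) (use B in \<open>auto split: split_indicator\<close>)
    also have "\<dots> = (LINT x:B|M. c x * \<theta> x)"
      by (rule set_integral_density[OF M _ c(2) \<theta>(1) B(1)]) simp
    finally show ?thesis .
  qed
qed

section \<open>The chain rule for the density of the pairing\<close>

lemma weak_deriv_linear:
  assumes I: "finite I" and f: "\<And>i. i \<in> I \<Longrightarrow> weak_deriv \<Omega> M u (b i) (f i)" and u: "integrable lborel u"
    and M: "sets M = sets borel"
  shows "weak_deriv \<Omega> M u (\<Sum>i\<in>I. c i *\<^sub>R b i) (\<lambda>x. \<Sum>i\<in>I. c i * f i x)"
proof -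
  have fi: "integrable M (f i)" if "i \<in> I" for i using f[OF that] by (simp add: weak_deriv_def)
  have "(LINT x|lborel. u x * dir_deriv (\<Sum>i\<in>I. c i *\<^sub>R b i) \<phi> x) = - (LINT x|M. \<phi> x * (\<Sum>i\<in>I. c i * f i x))"
    if \<phi>: "\<phi> \<in> test_functions \<Omega>" for \<phi>
  proof -
    have sm: "smooth \<phi>" using \<phi> by (rule test_functions_smooth)
    obtain C where C: "\<And>x. \<bar>\<phi> x\<bar> \<le> C" using test_functions_bounded[OF \<phi>] by metis
    have \<phi>m: "\<phi> \<in> borel_measurable M" using smooth_measurable[OF sm] M by simp
    have i1: "integrable lborel (\<lambda>x. u x * dir_deriv w \<phi> x)" for w
    proof -
      obtain D where D: "\<And>x. \<bar>dir_deriv w \<phi> x\<bar> \<le> D"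
        using test_functions_bounded[OF test_functions_dir_deriv[OF \<phi>]] by metis
      show ?thesis by (rule integrable_mult_bounded(1)[OF u _ D]) (simp add: smooth_dir_deriv sm)
    qed
    have i2: "integrable M (\<lambda>x. \<phi> x * f i x)" if "i \<in> I" for i
      by (rule integrable_mult_bounded(2)[OF fi[OF that] \<phi>m C])
    have lin: "dir_deriv (\<Sum>i\<in>I. c i *\<^sub>R b i) \<phi> x = (\<Sum>i\<in>I. c i * dir_deriv (b i) \<phi> x)" for x
    proof -
      interpret bounded_linear "\<lambda>w. dir_deriv w \<phi> x"
        by (rule has_derivative_bounded_linear[OF smooth_has_derivative[OF sm]])
      show ?thesis by (simp add: sum scaleR)
    qed
    have "(LINT x|lborel. u x * dir_deriv (\<Sum>i\<in>I. c i *\<^sub>R b i) \<phi> x) = (LINT x|lborel. (\<Sum>i\<in>I. c i * (u x * dir_deriv (b i) \<phi> x)))"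
      by (intro Bochner_Integration.integral_cong refl) (simp add: lin sum_distrib_left mult_ac)
    also have "\<dots> = (\<Sum>i\<in>I. c i * (LINT x|lborel. u x * dir_deriv (b i) \<phi> x))"
      using i1 by (subst Bochner_Integration.integral_sum) auto
    also have "\<dots> = (\<Sum>i\<in>I. c i * - (LINT x|M. \<phi> x * f i x))"
      using f \<phi> by (intro sum.cong refl) (simp add: weak_deriv_def)
    also have "\<dots> = - (LINT x|M. (\<Sum>i\<in>I. c i * (\<phi> x * f i x)))"
      using i2 by (subst Bochner_Integration.integral_sum) (auto simp: sum_negf)
    also have "(LINT x|M. (\<Sum>i\<in>I. c i * (\<phi> x * f i x))) = (LINT x|M. \<phi> x * (\<Sum>i\<in>I. c i * f i x))"
      by (intro Bochner_Integration.integral_cong refl) (simp add: sum_distrib_left mult_ac)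
    finally show ?thesis .
  qed
  then show ?thesis using fi by (simp add: weak_deriv_def)
qed

lemma finite_measure_lebesgue_indicator:
  assumes "\<Omega> \<in> sets borel" "emeasure lborel \<Omega> < \<infinity>"
  shows "finite_measure (density lborel (indicator \<Omega>))"
  by (rule finite_measureI) (use assms in \<open>simp add: emeasure_density\<close>)

text \<open>Transfers integrals of functions supported in \<open>\<Omega>\<close> from Lebesgue measure to a measure that dominates it.\<close>

lemma lebesgue_indicator_density:
  fixes H w :: "'a::euclidean_space \<Rightarrow> real"
  assumes \<Omega>: "\<Omega> \<in> sets borel" and M: "sets M = sets borel"
    and w: "w \<in> borel_measurable borel" "\<And>x. 0 \<le> w x"
    and eq: "density lborel (indicator \<Omega>) = density M (\<lambda>x. ennreal (w x))"
    and H: "H \<in> borel_measurable borel" "\<And>x. x \<notin> \<Omega> \<Longrightarrow> H x = 0"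
  shows "integrable lborel H \<longleftrightarrow> integrable M (\<lambda>x. w x * H x)"
    and "integral\<^sup>L lborel H = (LINT x|M. w x * H x)"
proof -
  have [measurable_cong]: "sets M = sets borel" by fact
  have e: "density lborel (indicator \<Omega>) = density lborel (\<lambda>x. ennreal (indicat_real \<Omega> x))"
    by (intro arg_cong2[where f = density] refl) (auto simp: fun_eq_iff split: split_indicator)
  have h: "indicat_real \<Omega> x * H x = H x" for x using H(2)[of x] by (auto split: split_indicator)
  have "integrable lborel H \<longleftrightarrow> integrable (density lborel (\<lambda>x. ennreal (indicat_real \<Omega> x))) H"
    using \<Omega> H by (subst integrable_density) (auto simp: h)
  also have "\<dots> \<longleftrightarrow> integrable M (\<lambda>x. w x * H x)"
    unfolding e[symmetric] eq using w H(1) by (subst integrable_density) auto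
  finally show "integrable lborel H \<longleftrightarrow> integrable M (\<lambda>x. w x * H x)" .
  have "integral\<^sup>L lborel H = integral\<^sup>L (density lborel (\<lambda>x. ennreal (indicat_real \<Omega> x))) H"
    using \<Omega> H by (subst integral_density) (auto simp: h)
  also have "\<dots> = (LINT x|M. w x * H x)"
    unfolding e[symmetric] eq using w H(1) by (subst integral_density) auto
  finally show "integral\<^sup>L lborel H = (LINT x|M. w x * H x)" .
qed

lemma exponents_gt_1:
  fixes p :: "nat \<Rightarrow> real"
  assumes "1 < p 2" "\<forall>i\<in>{2..<k}. p i \<le> p (Suc i)" "i \<in> {2..k}"
  shows "1 < p i" "p i \<le> p k"
proof -
  have mono: "p i \<le> p j" if "2 \<le> i" "i \<le> j" "j \<le> k" for i j
    using that(2,3)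
  proof (induction j rule: dec_induct)
    case (step n)
    then have "p n \<le> p (Suc n)" using assms(2) that(1) by auto
    with step show ?case by simp
  qed simp
  show "1 < p i" using mono[of 2 i] assms(1,3) by auto
  show "p i \<le> p k" using mono[of i k] assms(3) by auto
qed

lemma represents_borel_measures:
  fixes u :: "'a::euclidean_space \<Rightarrow> real"
  assumes "represents \<Omega> \<nu> L" "\<Omega> \<in> sets borel"
  obtains P Q where "finite_measure P" "sets P = sets borel" "finite_measure Q" "sets Q = sets borel"
    "\<And>\<phi>. \<phi> \<in> test_functions \<Omega> \<Longrightarrow> L \<phi> = (LINT x|P. \<phi> x) - (LINT x|Q. \<phi> x)"
proof -
  obtain P Q where PQ: "finite_measure P" "sets P = sets (restrict_space borel \<Omega>)"
     "finite_measure Q" "sets Q = sets (restrict_space borel \<Omega>)"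
     "\<And>\<phi>. \<phi>\<in>test_functions \<Omega> \<Longrightarrow> L \<phi> = (LINT x|P. \<phi> x) - (LINT x|Q. \<phi> x)"
    using assms(1) unfolding represents_def by blast
  obtain P' where P': "finite_measure P'" "sets P' = sets borel"
    "\<And>\<phi>. \<phi> \<in> borel_measurable borel \<Longrightarrow> (LINT x|P'. \<phi> x) = (LINT x|P. (\<phi> x :: real))"
    by (rule extend_to_borel[OF PQ(1,2) assms(2)]) blast
  obtain Q' where Q': "finite_measure Q'" "sets Q' = sets borel"
    "\<And>\<phi>. \<phi> \<in> borel_measurable borel \<Longrightarrow> (LINT x|Q'. \<phi> x) = (LINT x|Q. (\<phi> x :: real))"
    by (rule extend_to_borel[OF PQ(3,4) assms(2)]) blast
  show thesis
    by (rule that[OF P'(1,2) Q'(1,2)]) (simp add: PQ(5) P'(3) Q'(3) test_functions_smooth)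
qed

text \<open>All derivatives of \<open>u\<close> get densities with respect to one finite measure \<open>M\<close> that dominates both \<open>D\<^sub>1 u\<close> and Lebesgue measure on \<open>\<Omega>\<close>.
The chain rule with respect to \<open>M\<close> then yields at once \<open>D\<^sub>1 (T \<circ> u) = h D\<^sub>1 u\<close> and
\<open>\<nabla>\<^sub>i (T \<circ> u) = h \<nabla>\<^sub>i u\<close> with the same \<open>h\<close>, and \<open>pairing_densities\<close> applies to both functions.\<close>

theorem pairing_density_chain_rule:
  fixes \<Omega> :: "('n::finite, 'm::finite) space set" and blk :: "'m \<Rightarrow> nat" and p :: "nat \<Rightarrow> real"
    and u :: "('n, 'm) space \<Rightarrow> real" and z :: "('n, 'm) space \<Rightarrow> ('n, 'm) space"
  assumes k: "2 \<le> k" and blk: "range blk = {2..k}" and \<Omega>: "open \<Omega>" "bounded \<Omega>"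
    and p: "p 1 = 1" "1 < p 2" "\<forall>i\<in>{2..<k}. p i \<le> p (Suc i)" and q: "1 \<le> q"
    and u: "u \<in> BV_aniso blk k p \<Omega>" "u \<in> Lspace (max (ennreal (p k)) q) \<Omega>"
    and z: "z \<in> X_space blk k p (conj_exp q) \<Omega>"
    and T: "L-lipschitz_on UNIV T" "mono T"
    and \<theta>u: "is_theta blk k \<Omega> z u \<theta>\<^sub>u"
  shows "\<exists>\<theta>\<^sub>T. is_theta blk k \<Omega> z (T \<circ> u) \<theta>\<^sub>T \<and> (AE x in total_variation \<Omega> (D1 \<Omega> u). \<theta>\<^sub>T x = \<theta>\<^sub>u x)"
proof -
  let ?I = "(\<lambda>e. (e, 0)) ` Basis :: ('n, 'm) space set" and ?J = "(\<lambda>e. (0, e)) ` Basis :: ('n, 'm) space set"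
  have \<Omega>b: "\<Omega> \<in> sets borel" using \<Omega> by simp
  have \<Omega>f: "emeasure lborel \<Omega> < \<infinity>" using emeasure_bounded_finite[OF \<Omega>(2)] by simp
  have I: "b \<in> Basis" "block_index blk b = 1" if "b \<in> ?I" for b
    using that by (auto simp: Basis_space block_index_first)
  have J: "b \<in> Basis" "block_index blk b \<in> {2..k}" if "b \<in> ?J" for b
    using that block_index_later[OF blk that] by (auto simp: Basis_space)
  have pk: "1 < p k" using exponents_gt_1[OF p(2,3), of k] k by simp
  let ?r = "max (ennreal (p k)) q"
  have r1: "1 \<le> ?r" using q by (simp add: le_max_iff_disj)

  obtain U where U: "U \<in> borel_measurable borel" "\<And>x. x \<notin> \<Omega> \<Longrightarrow> U x = 0"
    "AE x in lborel. x \<in> \<Omega> \<longrightarrow> U x = u x \<bullet> 1" "power_integrable ?r U"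
    by (rule Lspace_component_representative[OF \<Omega>b u(2), of 1]) auto
  have Uu: "borel_version \<Omega> U u" using U by (simp add: borel_version_def)
  have Ui: "integrable lborel U" by (rule power_integrable_integrable[OF U(1,2) \<Omega>b \<Omega>f U(4) r1])
  have "\<exists>Z. borel_version \<Omega> Z (\<lambda>x. z x \<bullet> b) \<and> power_integrable (conj_exp (ennreal (p (block_index blk b)))) Z"
    if b: "b \<in> Basis" for b
  proof -
    let ?i = "block_index blk b"
    have "(\<lambda>x. block blk ?i (z x)) \<in> Lspace (conj_exp (ennreal (p ?i))) \<Omega>"
      using z block_index_range[OF blk k b] by (simp add: X_space_def)
    then obtain Z where "Z \<in> borel_measurable borel" "\<And>x. x \<notin> \<Omega> \<Longrightarrow> Z x = 0"
      "AE x in lborel. x \<in> \<Omega> \<longrightarrow> Z x = block blk ?i (z x) \<bullet> b" "power_integrable (conj_exp (ennreal (p ?i))) Z"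
      by (rule Lspace_component_representative[OF \<Omega>b, of _ _ b]) (use b in auto)
    then show ?thesis using b by (intro exI[of _ Z]) (auto simp: borel_version_def block_component[OF blk b])
  qed
  then obtain Z where Z: "\<And>b. b \<in> Basis \<Longrightarrow> borel_version \<Omega> (Z b) (\<lambda>x. z x \<bullet> b)"
    "\<And>b. b \<in> Basis \<Longrightarrow> power_integrable (conj_exp (ennreal (p (block_index blk b)))) (Z b)" by metis
  have Zm: "Z b \<in> borel_measurable borel" "\<And>x. x \<notin> \<Omega> \<Longrightarrow> Z b x = 0" if "b \<in> Basis" for b
    using Z(1)[OF that] by (auto simp: borel_version_def)
  have ZI: "power_integrable \<infinity> (Z b)" if "b \<in> ?I" for b
    using Z(2)[OF I(1)[OF that]] p(1) by (simp add: I(2)[OF that] conj_exp_1)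
  \<comment> \<open>In the first block \<open>z\<close> is bounded, and the exponent \<open>p k\<close> of \<open>u\<close> is the one to use.\<close>
  have UZ: "young_pair U (Z b)" if b: "b \<in> Basis" for b
  proof (cases "b \<in> ?I")
    case True
    show ?thesis
      by (rule young_pair_exponents[OF U(1,2) Zm[OF b] \<Omega>b \<Omega>f pk U(4) _ ZI[OF True]]) auto
  next
    case False
    then have "b \<in> ?J" using b by (auto simp: Basis_space)
    note i = exponents_gt_1[OF p(2,3) J(2)[OF this]]
    have "ennreal (p (block_index blk b)) \<le> ?r" using i(2) by (simp add: le_max_iff_disj ennreal_leI)
    then show ?thesis
      by (intro young_pair_exponents[OF U(1,2) Zm[OF b] \<Omega>b \<Omega>f i(1) U(4) _ Z(2)[OF b]]) auto
  qed
  have Zi: "integrable lborel (Z b)" if "b \<in> Basis" for b using UZ[OF that] by (simp add: young_pair_def)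
  have "\<exists>C. \<forall>x. \<bar>Z b x\<bar> \<le> C" if "b \<in> ?I" for b using ZI[OF that] by (simp add: power_integrable_def)
  then obtain c where c: "\<And>b x. b \<in> ?I \<Longrightarrow> \<bar>Z b x\<bar> \<le> c b" by metis
  have Zb: "\<bar>Z b x\<bar> \<le> (\<Sum>b\<in>?I. \<bar>c b\<bar>)" if "b \<in> ?I" for b x
    using c[OF that, of x] member_le_sum[of b ?I "\<lambda>b. \<bar>c b\<bar>"] that by force
  obtain d0 where d0: "d0 \<in> Lspace (conj_exp q) \<Omega>" "is_weak_div \<Omega> z d0" using z by (auto simp: X_space_def)
  obtain d where d: "d \<in> borel_measurable borel" "\<And>x. x \<notin> \<Omega> \<Longrightarrow> d x = 0"
    "AE x in lborel. x \<in> \<Omega> \<longrightarrow> d x = d0 x \<bullet> 1" "power_integrable (conj_exp q) d"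
    by (rule Lspace_component_representative[OF \<Omega>b d0(1), of 1]) auto
  have dd0: "borel_version \<Omega> d d0" using d by (simp add: borel_version_def)
  have Ud: "young_pair U d" by (rule young_pair_max_exponents[OF U(1,2) d(1,2) \<Omega>b \<Omega>f pk q U(4) d(4)])
  have "is_weak_div \<Omega> z (weak_div \<Omega> z)"
    unfolding weak_div_def using someI[of "is_weak_div \<Omega> z" d0] d0(2) by simp
  then have "AE x in lborel. x \<in> \<Omega> \<longrightarrow> d0 x = weak_div \<Omega> z x"
    using d0(2) by (intro locally_integrable_unique[OF \<Omega>(1)]) (auto simp: is_weak_div_def)
  then have "AE x in lborel. x \<in> \<Omega> \<longrightarrow> d x = weak_div \<Omega> z x"
    using d(3) by eventually_elim simp
  then have dz: "borel_version \<Omega> d (weak_div \<Omega> z)" using d by (simp add: borel_version_def)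
  have div: "(LINT x|lborel. (\<Sum>b\<in>Basis. Z b x * dir_deriv b \<psi> x)) = - (LINT x|lborel. d x * \<psi> x)"
    if \<psi>: "\<psi> \<in> test_functions \<Omega>" for \<psi>
  proof -
    have sm: "smooth \<psi>" using \<psi> by (rule test_functions_smooth)
    have "borel_version \<Omega> (\<lambda>x. \<Sum>b\<in>Basis. Z b x * dir_deriv b \<psi> x) (\<lambda>x. \<Sum>b\<in>Basis. (z x \<bullet> b) * dir_deriv b \<psi> x)"
      by (intro borel_version_sum finite_Basis borel_version_mult_borel Z(1) smooth_measurable smooth_dir_deriv sm)
    then have "(LINT x|lborel. (\<Sum>b\<in>Basis. Z b x * dir_deriv b \<psi> x)) = (LINT x|lebesgue_on \<Omega>. (\<Sum>b\<in>Basis. (z x \<bullet> b) * dir_deriv b \<psi> x))"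
      by (rule borel_version_integral[OF _ \<Omega>b, symmetric])
    also have "\<dots> = (LINT x|lebesgue_on \<Omega>. z x \<bullet> grad \<psi> x)"
      by (intro Bochner_Integration.integral_cong refl) (simp add: euclidean_inner[of "z x" "grad \<psi> x" for x] grad_component)
    also have "\<dots> = - (LINT x|lebesgue_on \<Omega>. d0 x * \<psi> x)" using d0(2) \<psi> by (simp add: is_weak_div_def)
    also have "(LINT x|lebesgue_on \<Omega>. d0 x * \<psi> x) = (LINT x|lborel. d x * \<psi> x)"
      by (rule borel_version_integral[OF borel_version_mult_borel[OF dd0 smooth_measurable[OF sm]] \<Omega>b])
    finally show ?thesis .
  qed
  have "\<exists>G. (\<forall>x. x \<notin> \<Omega> \<longrightarrow> G x = 0) \<and> weak_deriv \<Omega> lborel U b G \<and> young_pair G (Z b)" if b: "b \<in> ?J" for b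
  proof -
    let ?i = "block_index blk b"
    note i = exponents_gt_1[OF p(2,3) J(2)[OF b]]
    obtain g where g: "g \<in> Lspace (ennreal (p ?i)) \<Omega>" "is_weak_grad blk ?i \<Omega> u g"
      using u(1) J(2)[OF b] unfolding BV_aniso_def by blast
    obtain G where G: "G \<in> borel_measurable borel" "\<And>x. x \<notin> \<Omega> \<Longrightarrow> G x = 0"
      "AE x in lborel. x \<in> \<Omega> \<longrightarrow> G x = g x \<bullet> b" "power_integrable (ennreal (p ?i)) G"
      by (rule Lspace_component_representative[OF \<Omega>b g(1), of b]) (use J(1)[OF b] in auto)
    have Gg: "borel_version \<Omega> G (\<lambda>x. g x \<bullet> b)" using G by (simp add: borel_version_def)
    have y: "young_pair G (Z b)"
      by (rule young_pair_exponents[OF G(1,2) Zm[OF J(1)[OF b]] \<Omega>b \<Omega>f i(1) G(4) _ Z(2)[OF J(1)[OF b]]]) auto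
    have "weak_deriv \<Omega> lborel U b G"
      unfolding weak_deriv_def
    proof (intro conjI ballI)
      show "integrable lborel G" using y by (simp add: young_pair_def)
      fix \<phi> assume \<phi>: "\<phi> \<in> test_functions \<Omega>"
      have sm: "smooth \<phi>" using \<phi> by (rule test_functions_smooth)
      have "(LINT x|lborel. U x * dir_deriv b \<phi> x) = (LINT x|lebesgue_on \<Omega>. u x * dir_deriv b \<phi> x)"
        by (rule borel_version_integral[OF borel_version_mult_borel[OF Uu smooth_measurable[OF smooth_dir_deriv[OF sm]]] \<Omega>b, symmetric])
      also have "\<dots> = - (LINT x|lebesgue_on \<Omega>. (g x \<bullet> b) * \<phi> x)"
      proof -
        have bb: "block blk ?i b = b" using block_Basis[OF blk J(1)[OF b]] by simp
        have "(LINT x|lebesgue_on \<Omega>. u x * dir_deriv (block blk ?i b) \<phi> x) = - (LINT x|lebesgue_on \<Omega>. (g x \<bullet> b) * \<phi> x)"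
          using g(2) \<phi> unfolding is_weak_grad_def by blast
        then show ?thesis unfolding bb .
      qed
      also have "(LINT x|lebesgue_on \<Omega>. (g x \<bullet> b) * \<phi> x) = (LINT x|lborel. G x * \<phi> x)"
        by (rule borel_version_integral[OF borel_version_mult_borel[OF Gg smooth_measurable[OF sm]] \<Omega>b])
      finally show "(LINT x|lborel. U x * dir_deriv b \<phi> x) = - (LINT x|lborel. \<phi> x * G x)" by (simp add: mult.commute)
    qed
    with G y show ?thesis by blast
  qed
  then obtain G where G: "\<And>b x. b \<in> ?J \<Longrightarrow> x \<notin> \<Omega> \<Longrightarrow> G b x = 0" "\<And>b. b \<in> ?J \<Longrightarrow> weak_deriv \<Omega> lborel U b (G b)"
    "\<And>b. b \<in> ?J \<Longrightarrow> young_pair (G b) (Z b)" by metis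
  have Gm: "G b \<in> borel_measurable borel" "integrable lborel (G b)" if "b \<in> ?J" for b
    using G(3)[OF that] by (auto simp: young_pair_def)

  obtain D where D: "is_deriv_measure \<Omega> (\<lambda>v. v) u D" using u(1) by (auto simp: BV_aniso_def BV_def)
  let ?A = "\<lambda>e P Q. finite_measure P \<and> sets P = sets borel \<and> finite_measure Q \<and> sets Q = sets borel \<and>
      (\<forall>\<phi>\<in>test_functions \<Omega>. - (LINT x|lebesgue_on \<Omega>. u x * dir_deriv (e, 0) \<phi> x) = (LINT x|P. \<phi> x) - (LINT x|Q. \<phi> x))"
  have "\<forall>e :: real^'n. \<exists>P Q. ?A e P Q"
  proof
    fix e :: "real^'n"
    have rep: "represents \<Omega> (\<lambda>B. D B \<bullet> (e, 0)) (\<lambda>\<phi>. - (LINT x|lebesgue_on \<Omega>. u x * dir_deriv (e, 0) \<phi> x))"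
      using D by (simp add: is_deriv_measure_def)
    show "\<exists>P Q. ?A e P Q" by (rule represents_borel_measures[OF rep \<Omega>b]) blast
  qed
  from choice[OF this] obtain P where "\<forall>e. \<exists>Q. ?A e (P e) Q" by (rule exE)
  from choice[OF this] obtain Q where PQ_all: "\<forall>e. ?A e (P e) (Q e)" by (rule exE)
  have PQ: "\<And>e::real^'n. finite_measure (P e)" "\<And>e. sets (P e) = sets borel"
    "\<And>e. finite_measure (Q e)" "\<And>e. sets (Q e) = sets borel"
    "\<And>e \<phi>. \<phi> \<in> test_functions \<Omega> \<Longrightarrow> - (LINT x|lebesgue_on \<Omega>. u x * dir_deriv (e, 0) \<phi> x) = (LINT x|P e. \<phi> x) - (LINT x|Q e. \<phi> x)"
    using PQ_all by blast+
  \<comment> \<open>The index \<open>None\<close> stands for Lebesgue measure on \<open>\<Omega>\<close>; \<open>Some (e, True)\<close> and \<open>Some (e, False)\<close> for the two measures whose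
difference is the derivative of \<open>u\<close> in direction \<open>e\<close>.\<close>
  define N where "N i = (case i of None \<Rightarrow> density lborel (indicator \<Omega>) | Some (e, s) \<Rightarrow> if s then P e else Q e)"
    for i :: "((real^'n) \<times> bool) option"
  let ?K = "insert None (Some ` (Basis \<times> UNIV)) :: ((real^'n) \<times> bool) option set"
  have Nf: "finite_measure (N i)" "sets (N i) = sets borel" for i
    using PQ finite_measure_lebesgue_indicator[OF \<Omega>b \<Omega>f] by (auto simp: N_def split: option.split prod.split)
  obtain M m where M: "finite_measure M" "sets M = sets borel"
    and m: "\<And>i. i \<in> ?K \<Longrightarrow> m i \<in> borel_measurable borel" "\<And>i x. i \<in> ?K \<Longrightarrow> (0::real) \<le> m i x"
    "\<And>i. i \<in> ?K \<Longrightarrow> integrable M (m i)" "\<And>i. i \<in> ?K \<Longrightarrow> N i = density M (\<lambda>x. ennreal (m i x))"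
    by (rule common_densities[of ?K N]) (use Nf in auto)
  have [measurable_cong]: "sets M = sets borel" by fact
  define w where "w = m None"
  have w: "w \<in> borel_measurable borel" "\<And>x. 0 \<le> w x" and wN: "density lborel (indicator \<Omega>) = density M (\<lambda>x. ennreal (w x))"
    using m(1,2)[of None] m(4)[of None] by (auto simp: w_def N_def)
  define f where "f e x = m (Some (e, True)) x - m (Some (e, False)) x" for e x
  have fi: "integrable M (f e)" if "e \<in> Basis" for e
    unfolding f_def using m(3) that by (intro Bochner_Integration.integrable_diff) auto
  have fd: "weak_deriv \<Omega> M U (e, 0) (f e)" if e: "e \<in> Basis" for e
    unfolding weak_deriv_def
  proof (intro conjI ballI fi[OF e])
    fix \<phi> assume \<phi>: "\<phi> \<in> test_functions \<Omega>"
    have sm: "smooth \<phi>" using \<phi> by (rule test_functions_smooth)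
    have [measurable]: "\<phi> \<in> borel_measurable borel" by (rule smooth_measurable[OF sm])
    obtain C where C: "\<And>x. \<bar>\<phi> x\<bar> \<le> C" using test_functions_bounded[OF \<phi>] by metis
    have K: "Some (e, s) \<in> ?K" for s using e by auto
    have i: "integrable M (\<lambda>x. \<phi> x * m (Some (e, s)) x)" for s
      by (rule integrable_mult_bounded(2)[OF m(3)[OF K] _ C]) simp
    have "(LINT x|P e. \<phi> x) = (LINT x|M. \<phi> x * m (Some (e, True)) x)"
      using m(4)[OF K[of True]] m(1)[OF K] m(2)[OF K] by (simp add: N_def integral_density mult.commute)
    moreover have "(LINT x|Q e. \<phi> x) = (LINT x|M. \<phi> x * m (Some (e, False)) x)"
      using m(4)[OF K[of False]] m(1)[OF K] m(2)[OF K] by (simp add: N_def integral_density mult.commute)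
    moreover have "(LINT x|lborel. U x * dir_deriv (e, 0) \<phi> x) = (LINT x|lebesgue_on \<Omega>. u x * dir_deriv (e, 0) \<phi> x)"
      by (rule borel_version_integral[OF borel_version_mult_borel[OF Uu smooth_measurable[OF smooth_dir_deriv[OF sm]]] \<Omega>b, symmetric])
    ultimately show "(LINT x|lborel. U x * dir_deriv (e, 0) \<phi> x) = - (LINT x|M. \<phi> x * f e x)"
      using PQ(5)[OF \<phi>, of e] i by (simp add: f_def right_diff_distrib)
  qed
  define S where "S x = (\<Sum>e\<in>Basis. f e x *\<^sub>R e)" for x
  have Si: "integrable M S" unfolding S_def using fi by (intro Bochner_Integration.integrable_sum integrable_scaleR_left) auto
  have Sm: "S \<in> borel_measurable borel" using borel_measurable_integrable[OF Si] by simp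
  have Se: "S x \<bullet> e = f e x" if "e \<in> Basis" for x e using that by (simp add: S_def)
  have Sv: "weak_deriv \<Omega> M U (v, 0) (\<lambda>x. S x \<bullet> v)" for v
  proof -
    have "(\<Sum>e\<in>Basis. (v \<bullet> e) *\<^sub>R (e, 0)) = (v, 0 :: real^'m)"
      by (simp add: prod_eq_iff fst_sum snd_sum euclidean_representation)
    moreover have "(\<Sum>e\<in>Basis. (v \<bullet> e) * f e x) = S x \<bullet> v" for x
      by (simp add: euclidean_inner[of "S x" v] Se mult.commute)
    ultimately show ?thesis
      using weak_deriv_linear[where b = "\<lambda>e. (e, 0)" and f = f and c = "\<lambda>e. v \<bullet> e", OF finite_Basis fd Ui M(2)]
      by (simp only:)
  qed

  obtain h where h: "h \<in> borel_measurable borel" "\<And>x. 0 \<le> h x" "\<And>x. h x \<le> L"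
    "\<And>v f. weak_deriv \<Omega> M U v f \<Longrightarrow> weak_deriv \<Omega> M (\<lambda>x. T (U x)) v (\<lambda>x. h x * f x)"
    by (rule weak_deriv_lipschitz_chain[OF \<Omega>(1) Ui M T]) blast
  have ha: "\<bar>h x\<bar> \<le> L" for x using h(2,3)[of x] by simp
  \<comment> \<open>Outside \<open>\<Omega>\<close> the function \<open>T \<circ> U\<close> has the value \<open>T 0\<close>, which need not be zero.\<close>
  define UT where "UT x = indicator \<Omega> x * T (U x)" for x
  have L0: "L \<ge> 0" by (rule lipschitz_on_nonneg[OF T(1)])
  have Tm: "T \<in> borel_measurable borel"
    by (intro borel_measurable_continuous_onI lipschitz_on_continuous_on[OF T(1)])
  have UTm: "UT \<in> borel_measurable borel" unfolding UT_def[abs_def] using Tm U(1) \<Omega>b by measurable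
  have UTb: "\<bar>UT x\<bar> \<le> \<bar>T 0\<bar> * indicator \<Omega> x + L * \<bar>U x\<bar>" for x
  proof -
    have "\<bar>T (U x) - T 0\<bar> \<le> L * \<bar>U x\<bar>" using lipschitz_onD[OF T(1), of "U x" 0] by (simp add: dist_real_def)
    then show ?thesis using L0 by (auto simp: UT_def split: split_indicator)
  qed
  have UTi: "integrable lborel UT"
  proof (rule Bochner_Integration.integrable_bound[of lborel "\<lambda>x. \<bar>T 0\<bar> * indicator \<Omega> x + L * \<bar>U x\<bar>"])
    show "integrable lborel (\<lambda>x. \<bar>T 0\<bar> * indicator \<Omega> x + L * \<bar>U x\<bar>)"
      using Ui \<Omega>b \<Omega>f by (auto intro!: Bochner_Integration.integrable_add integrable_mult_right integrable_real_indicator)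
    show "AE x in lborel. norm (UT x) \<le> norm (\<bar>T 0\<bar> * indicator \<Omega> x + L * \<bar>U x\<bar>)"
      using UTb by (auto intro!: AE_I2 intro: order_trans[OF _ abs_ge_self])
  qed (use UTm in simp)
  have UTy: "young_pair UT F" if "young_pair U F" for F
  proof (rule young_pair_affine[OF that UTi, of "\<bar>T 0\<bar>" "L + 1"])
    fix x
    have "\<bar>T 0\<bar> * indicator \<Omega> x \<le> \<bar>T 0\<bar>" by (auto split: split_indicator)
    moreover have "L * \<bar>U x\<bar> \<le> (L + 1) * \<bar>U x\<bar>" by (simp add: distrib_right)
    ultimately show "\<bar>UT x\<bar> \<le> \<bar>T 0\<bar> + (L + 1) * \<bar>U x\<bar>" using UTb[of x] by linarith
  qed (use L0 in simp)
  have UTu: "borel_version \<Omega> UT (T \<circ> u)"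
    using Uu UTm unfolding borel_version_def by (auto simp: UT_def elim!: eventually_mono)
  have UTd: "weak_deriv \<Omega> M UT v (\<lambda>x. h x * F x)" if "weak_deriv \<Omega> M U v F" for v F
  proof -
    have "(\<lambda>x. UT x * dir_deriv v \<phi> x) = (\<lambda>x. T (U x) * dir_deriv v \<phi> x)" if "\<phi> \<in> test_functions \<Omega>" for \<phi>
    proof
      fix x
      show "UT x * dir_deriv v \<phi> x = T (U x) * dir_deriv v \<phi> x"
        using test_functions_outside[OF test_functions_dir_deriv[OF that], of x v]
        by (auto simp: UT_def split: split_indicator)
    qed
    then show ?thesis using h(4)[OF that] unfolding weak_deriv_def by simp
  qed
  \<comment> \<open>The factor \<open>h\<close> is known only with respect to \<open>M\<close>: the Sobolev derivatives pass to \<open>M\<close> and back.\<close>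
  have GT: "weak_deriv \<Omega> lborel UT b (\<lambda>x. h x * G b x)" if b: "b \<in> ?J" for b
  proof -
    note leb = lebesgue_indicator_density[OF \<Omega>b M(2) w wN]
    have "weak_deriv \<Omega> M U b (\<lambda>x. w x * G b x)"
      using G(2)[OF b] unfolding weak_deriv_def
    proof (elim conjE, intro conjI ballI)
      show "integrable M (\<lambda>x. w x * G b x)" if "integrable lborel (G b)"
        using leb(1)[OF Gm(1)[OF b] G(1)[OF b]] that by simp
      fix \<phi> assume \<phi>: "\<phi> \<in> test_functions \<Omega>"
        and eq: "\<forall>\<phi>\<in>test_functions \<Omega>. (LINT x|lborel. U x * dir_deriv b \<phi> x) = - (LINT x|lborel. \<phi> x * G b x)"
      have "(LINT x|lborel. \<phi> x * G b x) = (LINT x|M. w x * (\<phi> x * G b x))"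
        using smooth_measurable[OF test_functions_smooth[OF \<phi>]] Gm(1)[OF b] G(1)[OF b] by (intro leb(2)) auto
      then show "(LINT x|lborel. U x * dir_deriv b \<phi> x) = - (LINT x|M. \<phi> x * (w x * G b x))"
        using eq \<phi> by (simp add: mult_ac)
    qed
    from UTd[OF this] show ?thesis
      unfolding weak_deriv_def
    proof (elim conjE, intro conjI ballI)
      show "integrable lborel (\<lambda>x. h x * G b x)"
        by (rule integrable_mult_bounded(2)[OF Gm(2)[OF b] _ ha]) (use h(1) in simp)
      fix \<phi> assume \<phi>: "\<phi> \<in> test_functions \<Omega>"
        and eq: "\<forall>\<phi>\<in>test_functions \<Omega>. (LINT x|lborel. UT x * dir_deriv b \<phi> x) = - (LINT x|M. \<phi> x * (h x * (w x * G b x)))"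
      have "(LINT x|lborel. \<phi> x * (h x * G b x)) = (LINT x|M. w x * (\<phi> x * (h x * G b x)))"
        using smooth_measurable[OF test_functions_smooth[OF \<phi>]] Gm(1)[OF b] G(1)[OF b] h(1) by (intro leb(2)) auto
      then show "(LINT x|lborel. UT x * dir_deriv b \<phi> x) = - (LINT x|lborel. \<phi> x * (h x * G b x))"
        using eq \<phi> by (simp add: mult_ac)
    qed
  qed
  have GTy: "young_pair (\<lambda>x. h x * G b x) (Z b)" if "b \<in> ?J" for b
    by (rule young_pair_mult[OF G(3)[OF that] h(1) ha])

  have hS: "integrable M (\<lambda>x. h x *\<^sub>R S x)"
    by (rule Bochner_Integration.integrable_bound[of M "\<lambda>x. L *\<^sub>R S x"])
       (use Si h L0 in \<open>auto intro!: AE_I2 mult_right_mono\<close>)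
  have D1u: "D1 \<Omega> u B = (LINT x:B|M. S x)" if "B \<in> sets (restrict_space borel \<Omega>)" for B
    by (rule D1_density[OF \<Omega>(1) Uu M Si Sv that])
  have D1T: "D1 \<Omega> (T \<circ> u) B = (LINT x:B|M. h x *\<^sub>R S x)" if "B \<in> sets (restrict_space borel \<Omega>)" for B
    using UTd[OF Sv] by (intro D1_density[OF \<Omega>(1) UTu M hS _ that]) simp
  let ?n = "\<lambda>x. norm (S x)"
  have ni: "integrable M ?n" and hni: "integrable M (\<lambda>x. h x * ?n x)"
    using Si integrable_norm[OF hS] h(2) by simp_all
  have tvu: "total_variation \<Omega> (D1 \<Omega> u) = restrict_space (density M (\<lambda>x. ennreal (?n x))) \<Omega>"
    by (rule total_variation_density[OF M Si \<Omega>b D1u])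
  have tvT: "total_variation \<Omega> (D1 \<Omega> (T \<circ> u)) = restrict_space (density M (\<lambda>x. ennreal (h x * ?n x))) \<Omega>"
    using total_variation_density[OF M hS \<Omega>b D1T] h(2) by simp

  have fI: "weak_deriv \<Omega> M U b (\<lambda>x. S x \<bullet> fst b)" if "b \<in> ?I" for b
    using that Sv by auto
  obtain \<theta> C where \<theta>: "\<theta> \<in> borel_measurable borel" "\<And>x. \<bar>\<theta> x\<bar> \<le> C" and pairing:
    "\<And>u g h \<phi> L. \<phi> \<in> test_functions \<Omega> \<Longrightarrow> h \<in> borel_measurable borel \<Longrightarrow> (\<And>x. \<bar>h x\<bar> \<le> L) \<Longrightarrow>
      integrable lborel u \<Longrightarrow>
      (\<And>b. b \<in> ?I \<Longrightarrow> weak_deriv \<Omega> M u b (\<lambda>x. h x * (S x \<bullet> fst b))) \<Longrightarrow>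
      (\<And>b. b \<in> ?J \<Longrightarrow> weak_deriv \<Omega> lborel u b (g b)) \<Longrightarrow>
      (\<And>b. b \<in> Basis \<Longrightarrow> young_pair u (Z b)) \<Longrightarrow> young_pair u d \<Longrightarrow>
      (\<And>b. b \<in> ?J \<Longrightarrow> young_pair (g b) (Z b)) \<Longrightarrow>
      - (LINT x|lborel. u x * \<phi> x * d x) - (\<Sum>b\<in>Basis. LINT x|lborel. u x * (Z b x * dir_deriv b \<phi> x))
      - (\<Sum>b\<in>?J. LINT x|lborel. \<phi> x * (Z b x * g b x)) = (LINT x|M. \<phi> x * (h x * ?n x) * \<theta> x)"
  proof (rule pairing_densities[OF \<Omega>(1) M Basis_space Basis_space_disjoint div, where f = "\<lambda>b x. S x \<bullet> fst b" and N = ?n and C = "\<Sum>b\<in>?I. \<bar>c b\<bar>"])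
    show "\<bar>S x \<bullet> fst b\<bar> \<le> ?n x" if "b \<in> ?I" for b x
      using that by (auto intro: Basis_le_norm)
  qed (use Zi I Zb ni Sm in auto)
  have H: "borel_version \<Omega> (F b) (\<lambda>x. weak_grad blk (block_index blk b) \<Omega> v x \<bullet> b)"
    if "borel_version \<Omega> V v" "integrable lborel V" "\<And>b. b \<in> ?J \<Longrightarrow> weak_deriv \<Omega> lborel V b (F b)"
      "\<And>b x. b \<in> ?J \<Longrightarrow> x \<notin> \<Omega> \<Longrightarrow> F b x = 0" "b \<in> ?J" for V v F b
    by (rule weak_grad_component[OF \<Omega>(1) blk J(2)[OF that(5)] that(1-4) J(1)[OF that(5)] refl])
  have pu: "pairing_functional blk k \<Omega> z u \<phi> = (LINT x|M. \<phi> x * (?n x * \<theta> x))" if \<phi>: "\<phi> \<in> test_functions \<Omega>" for \<phi>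
  proof -
    have "pairing_functional blk k \<Omega> z u \<phi> = - (LINT x|lborel. U x * \<phi> x * d x)
      - (\<Sum>b\<in>Basis. LINT x|lborel. U x * (Z b x * dir_deriv b \<phi> x)) - (\<Sum>b\<in>?J. LINT x|lborel. \<phi> x * (Z b x * G b x))"
      by (rule pairing_functional_eq[OF \<Omega>(1) blk k Uu Z(1) dz H[OF Uu Ui G(2,1)] UZ G(3) \<phi>])
    also have "\<dots> = (LINT x|M. \<phi> x * (1 * ?n x) * \<theta> x)"
      by (rule pairing[OF \<phi>, of "\<lambda>x. 1" 1]) (use Ui fI G UZ Ud in auto)
    finally show ?thesis by (simp add: mult.assoc)
  qed
  have pT: "pairing_functional blk k \<Omega> z (T \<circ> u) \<phi> = (LINT x|M. \<phi> x * ((h x * ?n x) * \<theta> x))" if \<phi>: "\<phi> \<in> test_functions \<Omega>" for \<phi>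
  proof -
    have G0: "h x * G b x = 0" if "b \<in> ?J" "x \<notin> \<Omega>" for b x using G(1)[OF that] by simp
    have "pairing_functional blk k \<Omega> z (T \<circ> u) \<phi> = - (LINT x|lborel. UT x * \<phi> x * d x)
      - (\<Sum>b\<in>Basis. LINT x|lborel. UT x * (Z b x * dir_deriv b \<phi> x)) - (\<Sum>b\<in>?J. LINT x|lborel. \<phi> x * (Z b x * (h x * G b x)))"
      by (rule pairing_functional_eq[OF \<Omega>(1) blk k UTu Z(1) dz H[OF UTu UTi GT G0] UTy[OF UZ] GTy \<phi>])
    also have "\<dots> = (LINT x|M. \<phi> x * (h x * ?n x) * \<theta> x)"
      by (rule pairing[OF \<phi> h(1) ha UTi UTd[OF fI] GT UTy[OF UZ] UTy[OF Ud] GTy])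
    finally show ?thesis by (simp add: mult.assoc)
  qed
  have ni\<theta>: "integrable M (\<lambda>x. ?n x * \<theta> x)" and hni\<theta>: "integrable M (\<lambda>x. (h x * ?n x) * \<theta> x)"
    using integrable_mult_bounded(1)[OF ni _ \<theta>(2)] integrable_mult_bounded(1)[OF hni _ \<theta>(2)] \<theta>(1) by auto
  note tiu = total_variation_integral[OF \<Omega>(1) M(2) ni norm_ge_zero \<theta>, folded tvu]
  have hn0: "0 \<le> h x * ?n x" for x using h(2) by simp
  note tiT = total_variation_integral[OF \<Omega>(1) M(2) hni hn0 \<theta>, folded tvT]
  have "is_theta blk k \<Omega> z (T \<circ> u) \<theta>"
    unfolding is_theta_def
  proof (intro conjI ballI)
    fix B assume B: "B \<in> sets (restrict_space borel \<Omega>)"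
    show "pairing blk k \<Omega> z (T \<circ> u) B = (LINT x:B|total_variation \<Omega> (D1 \<Omega> (T \<circ> u)). \<theta> x)"
      unfolding tiT(3)[OF B] by (rule pairing_density[OF \<Omega>(1) M hni\<theta> pT B])
  qed (rule tiT(1))
  moreover have "AE x in total_variation \<Omega> (D1 \<Omega> u). \<theta> x = \<theta>\<^sub>u x"
  proof (rule density_unique_real[OF tiu(1)])
    show "integrable (total_variation \<Omega> (D1 \<Omega> u)) \<theta>\<^sub>u" using \<theta>u by (simp add: is_theta_def)
    fix B assume "B \<in> sets (total_variation \<Omega> (D1 \<Omega> u))"
    then have B: "B \<in> sets (restrict_space borel \<Omega>)" by (simp add: tiu(2))
    have "(LINT x:B|total_variation \<Omega> (D1 \<Omega> u). \<theta> x) = pairing blk k \<Omega> z u B"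
      unfolding tiu(3)[OF B] by (rule pairing_density[OF \<Omega>(1) M ni\<theta> pu B, symmetric])
    then show "(LINT x:B|total_variation \<Omega> (D1 \<Omega> u). \<theta> x) = (LINT x:B|total_variation \<Omega> (D1 \<Omega> u). \<theta>\<^sub>u x)"
      using \<theta>u B by (simp add: is_theta_def)
  qed
  ultimately show ?thesis by blast
qed

theorem proposition3p8:
  fixes \<Omega>1 :: "(real^'n) set" and \<Omega>2 :: "(real^'m) set"
    and blk :: "'m \<Rightarrow> nat" and k :: nat and p :: "nat \<Rightarrow> real" and q :: ennreal
    and u :: "('n::finite, 'm::finite) space \<Rightarrow> real"
    and z :: "('n, 'm) space \<Rightarrow> ('n, 'm) space"
    and T :: "real \<Rightarrow> real" and \<theta>\<^sub>u :: "('n, 'm) space \<Rightarrow> real"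
  assumes "2 \<le> k" and "range blk = {2..k}"
    and "open \<Omega>1" "bounded \<Omega>1" and "open \<Omega>2" "bounded \<Omega>2"
    and "lipschitz_boundary (\<Omega>1 \<times> \<Omega>2)"
    and "p 1 = 1" and "1 < p 2" and "\<forall>i\<in>{2..<k}. p i \<le> p (Suc i)"
    and "1 \<le> q"
    and "u \<in> BV_aniso blk k p (\<Omega>1 \<times> \<Omega>2) \<inter> Lspace (max (ennreal (p k)) q) (\<Omega>1 \<times> \<Omega>2)"
    and "z \<in> X_space blk k p (conj_exp q) (\<Omega>1 \<times> \<Omega>2)"
    and "\<exists>L. L-lipschitz_on UNIV T" and "strict_mono T"
    and "is_theta blk k (\<Omega>1 \<times> \<Omega>2) z u \<theta>\<^sub>u"
  shows "\<exists>\<theta>\<^sub>T. is_theta blk k (\<Omega>1 \<times> \<Omega>2) z (T \<circ> u) \<theta>\<^sub>T \<and>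
    (AE x in total_variation (\<Omega>1 \<times> \<Omega>2) (D1 (\<Omega>1 \<times> \<Omega>2) u). \<theta>\<^sub>T x = \<theta>\<^sub>u x)"
proof -
  obtain L where L: "L-lipschitz_on UNIV T" using assms(14) by blast
  have "open (\<Omega>1 \<times> \<Omega>2)" "bounded (\<Omega>1 \<times> \<Omega>2)"
    using assms(3-6) by (simp_all add: open_Times bounded_Times)
  moreover have "u \<in> BV_aniso blk k p (\<Omega>1 \<times> \<Omega>2)" "u \<in> Lspace (max (ennreal (p k)) q) (\<Omega>1 \<times> \<Omega>2)"
    using assms(12) by simp_all
  ultimately show ?thesis
    by (rule pairing_density_chain_rule[OF assms(1,2) _ _ assms(8-11) _ _ assms(13) L strict_mono_mono[OF assms(15)] assms(16)])
qed

end
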